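(* Let $(M',J,g')$ be a Kähler manifold with Norden metric, $\dim M'=2n+2\ge4$, of constant totally real sectional curvatures $\nu'$ and $\widetilde{\nu'}$, and let $(M,\varphi,\xi,\eta,g)$, $\dim M=2n+1$, be a real time-like hypersurface of it, with function $t$, which is an $(\mathcal F_4^0\oplus\mathcal F_5^0)$-manifold. Then the canonical curvature tensor $K$ of $M$ is $$\begin{aligned}K={}&\Big(\nu'+\frac{\theta^*(\xi)^2}{4n^2}\Big)[\pi_1-\pi_2]+\Big(\widetilde{\nu'}-\frac{\theta(\xi)\theta^*(\xi)}{4n^2}\Big)\pi_3\\&-\Big(\widetilde{\nu'}\tan t+\frac{dt(\xi)\theta(\xi)}{4n}+\frac{dt(\xi)\theta^*(\xi)}{4n}\tan t-\frac{\xi\theta^*(\xi)}{2n}+\frac{\theta(\xi)^2}{4n^2}\Big)\pi_4\\&-\Big(\nu'\tan t+\frac{dt(\xi)\theta(\xi)}{4n}\tan t-\frac{dt(\xi)\theta^*(\xi)}{4n}-\frac{\xi\theta(\xi)}{2n}-\frac{\theta(\xi)\theta^*(\xi)}{4n^2}\Big)\pi_5\\&-\frac{(\theta(\xi)\cos t+\theta^*(\xi)\sin t)^2}{4n^2}[\pi_1-\pi_2-\pi_4]\\&+\frac{(\theta(\xi)\sin t-\theta^*(\xi)\cos t)(\theta(\xi)\cos t+\theta^*(\xi)\sin t)}{4n^2}[\pi_3+\pi_5],\end{aligned}$$ where $\xi\theta(\xi)$ and $\xi\theta^*(\xi)$ denote the derivatives of the functions $\theta(\xi)$ and $\theta^*(\xi)$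 in the direction of $\xi$.
   Context: Kähler manifold with Norden metric: a $(2n+2)$-dimensional manifold $M'$ with an almost complex structure $J$ ($J^2=-\mathrm{id}$) and a pseudo-Riemannian metric $g'$ such that $g'(JX,JY)=-g'(X,Y)$ and $\nabla'J=0$, where $\nabla'$ is the Levi-Civita connection of $g'$. The signature of $g'$ is neutral. Curvature tensor: $R'(X,Y)Z=\nabla'_X\nabla'_YZ-\nabla'_Y\nabla'_XZ-\nabla'_{[X,Y]}Z$, $R'(X,Y,Z,U)=g'(R'(X,Y)Z,U)$, and $\widetilde{R'}(X,Y,Z,U)=R'(X,Y,Z,JU)$. Put $\pi_1'(x,y,z,u)=g'(y,z)g'(x,u)-g'(x,z)g'(y,u)$. A 2-plane (section) with basis $\{x,y\}$ is nondegenerate if $\pi_1'(x,y,y,x)\ne0$. $M'$ is of constant totally real sectional curvatures $\nu'$, $\widetilde{\nu'}$ (functions on $M'$) if for every $p'\in M'$ and every nondegenerate section $\alpha'\subset T_{p'}M'$ with $J\alpha'\perp\alpha'$ and basis $\{x,y\}$, $R'(x,y,y,x)/\pi_1'(x,y,y,x)=\nu'(p')$ and $\widetilde{R'}(x,y,y,x)/\pi_1'(x,y,y,x)=\widetilde{\nu'}(p')$. Real time-like hypersurface: a hypersurface $M$ of $M'$ with unit normal field $N$, $g'(N,N)=-1$, equipped with the structure $$\varphi=J+\cos t\,g'(\cdot,JN)\{\cos t\,N-\sin t\,JN\},\quad \xi=\sin t\,N+\cos t\,JN,\quad \eta=\cos t\,g'(\cdot,JN),\quad g=g'|_M,$$ where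 $t=\arctan\{g'(N,JN)\}\in(-\pi/2,\pi/2)$. This is an almost contact structure with Norden metric: $\varphi^2X=-X+\eta(X)\xi$, $\eta(\xi)=1$, $g(\varphi X,\varphi Y)=-g(X,Y)+\eta(X)\eta(Y)$. $\nabla$ is the Levi-Civita connection of $g$. The Weingarten and Gauss formulas are normalized as $\nabla'_XN=-AX$, $\nabla'_XY=\nabla_XY-g(AX,Y)N$. Along $M$, $\nu'$ and $\widetilde{\nu'}$ denote their restrictions. Let $F(X,Y,Z)=g((\nabla_X\varphi)Y,Z)$. With $\{e_i,\xi\}$ ($i=1,\dots,2n$) a basis of $T_pM$, $e_i\in\ker\eta$, and $(g^{ij})$ the inverse of $(g(e_i,e_j))$, put $\theta(\cdot)=g^{ij}F(e_i,e_j,\cdot)$, $\theta^*(\cdot)=g^{ij}F(e_i,\varphi e_j,\cdot)$. $M$ is an $\mathcal F_4\oplus\mathcal F_5$-manifold if $$F(x,y,z)=-\frac{\theta(\xi)}{2n}\{g(\varphi x,\varphi y)\eta(z)+g(\varphi x,\varphi z)\eta(y)\}-\frac{\theta^*(\xi)}{2n}\{g(x,\varphi y)\eta(z)+g(x,\varphi z)\eta(y)\},$$ and an $(\mathcal F_4^0\oplus\mathcal F_5^0)$-manifold if in addition the 1-forms $\theta$ and $\theta^*$ are closed. The canonical connection on $M$ is $$D_XY=\nabla_XY+\tfrac12\{(\nabla_X\varphi)\varphi Y+(\nabla_X\eta)Y\cdot\xi\}-\eta(Y)\nabla_X\xi,$$ and the canonical curvature tensor is $K(X,Y)Z=D_XD_YZ-D_YD_XZ-D_{[X,Y]}Z$,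 $K(X,Y,Z,U)=g(K(X,Y)Z,U)$. Tensors on $M$: $\pi_1(x,y,z,u)=g(y,z)g(x,u)-g(x,z)g(y,u)$; $\pi_2(x,y,z,u)=g(y,\varphi z)g(x,\varphi u)-g(x,\varphi z)g(y,\varphi u)$; $\pi_3(x,y,z,u)=-g(y,z)g(x,\varphi u)+g(x,z)g(y,\varphi u)-g(y,\varphi z)g(x,u)+g(x,\varphi z)g(y,u)$; $\pi_4(x,y,z,u)=\eta(y)\eta(z)g(x,u)-\eta(x)\eta(z)g(y,u)+\eta(x)\eta(u)g(y,z)-\eta(y)\eta(u)g(x,z)$; $\pi_5(x,y,z,u)=\eta(y)\eta(z)g(x,\varphi u)-\eta(x)\eta(z)g(y,\varphi u)+\eta(x)\eta(u)g(y,\varphi z)-\eta(y)\eta(u)g(x,\varphi z)$. *)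

theory Defs
  imports "HOL-Analysis.Analysis" "HOL-Library.Function_Algebras"
begin

section \<open>Smooth manifolds\<close>

text \<open>\<open>Ck_on k S f\<close> is meant for open \<open>S\<close>: all directional derivatives of order up to \<open>k\<close>
  exist and are continuous. Values of \<open>f\<close> outside \<open>S\<close> are irrelevant.\<close>

fun Ck_on :: "nat \<Rightarrow> 'e::euclidean_space set \<Rightarrow> ('e \<Rightarrow> 'f::real_normed_vector) \<Rightarrow> bool" where
  "Ck_on 0 S f \<longleftrightarrow> continuous_on S f"
| "Ck_on (Suc k) S f \<longleftrightarrow>
     (\<forall>x\<in>S. f differentiable (at x)) \<and> (\<forall>v. Ck_on k S (\<lambda>x. frechet_derivative f (at x) v))"

definition smooth_on :: "'e::euclidean_space set \<Rightarrow> ('e \<Rightarrow> 'f::real_normed_vector) \<Rightarrow> bool" where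
  "smooth_on S f \<longleftrightarrow> (\<forall>k. Ck_on k S f)"

text \<open>A chart is a pair of a domain and a coordinate map into the model space \<open>'e\<close>; the dimension of
  the manifold is \<open>DIM('e)\<close>. The atlas need not be maximal.\<close>

record ('a, 'e) mfd =
  mtop :: "'a topology"
  charts :: "('a set \<times> ('a \<Rightarrow> 'e)) set"

definition smooth_manifold :: "('a, 'e::euclidean_space) mfd \<Rightarrow> bool" where
  "smooth_manifold M \<longleftrightarrow>
     Hausdorff_space (mtop M) \<and> second_countable (mtop M) \<and>
     (\<Union>(U, c)\<in>charts M. U) = topspace (mtop M) \<and>
     (\<forall>(U, c)\<in>charts M. openin (mtop M) U \<and> open (c ` U) \<and>
        homeomorphic_map (subtopology (mtop M) U) (top_of_set (c ` U)) c) \<and>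
     (\<forall>(U, c)\<in>charts M. \<forall>(V, d)\<in>charts M. smooth_on (c ` (U \<inter> V)) (d \<circ> inv_into U c))"

text \<open>Smoothness on a neighbourhood of a point.\<close>

definition smooth_at :: "('a, 'e::euclidean_space) mfd \<Rightarrow> 'a \<Rightarrow> ('a \<Rightarrow> real) \<Rightarrow> bool" where
  "smooth_at M p f \<longleftrightarrow>
     (\<exists>V. openin (mtop M) V \<and> p \<in> V \<and>
        (\<forall>(U, c)\<in>charts M. smooth_on (c ` (U \<inter> V)) (f \<circ> inv_into U c)))"

text \<open>Tangent vectors at \<open>p\<close> are the derivations at \<open>p\<close> of the functions smooth near \<open>p\<close>,
  made unique as HOL functions by the value 0 on all other functions. That a derivation only depends
  on the germ follows from the Leibniz rule (multiply by a function that is 0 near \<open>p\<close> and 1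
  elsewhere). Addition, subtraction and 0 are the pointwise ones of
  \<^theory>\<open>HOL-Library.Function_Algebras\<close>.\<close>

type_synonym 'a tvec = "('a \<Rightarrow> real) \<Rightarrow> real"
type_synonym 'a vfield = "'a \<Rightarrow> 'a tvec"

definition tscale :: "real \<Rightarrow> 'a tvec \<Rightarrow> 'a tvec" (infixr "*\<^sub>t" 75) where
  "a *\<^sub>t v = (\<lambda>f. a * v f)"

definition tangent_space :: "('a, 'e::euclidean_space) mfd \<Rightarrow> 'a \<Rightarrow> 'a tvec set" where
  "tangent_space M p =
     {v. (\<forall>f. \<not> smooth_at M p f \<longrightarrow> v f = 0) \<and>
         (\<forall>a f. smooth_at M p f \<longrightarrow> v (\<lambda>q. a * f q) = a * v f) \<and>
         (\<forall>f h. smooth_at M p f \<and> smooth_at M p h \<longrightarrow>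
            v (\<lambda>q. f q + h q) = v f + v h \<and>
            v (\<lambda>q. f q * h q) = f p * v h + h p * v f)}"

definition smooth_vfields :: "('a, 'e::euclidean_space) mfd \<Rightarrow> 'a set \<Rightarrow> 'a vfield set" where
  "smooth_vfields M V =
     {X. \<forall>q\<in>V. X q \<in> tangent_space M q \<and>
           (\<forall>f. smooth_at M q f \<longrightarrow> smooth_at M q (\<lambda>r. X r f))}"

definition lie_bracket :: "('a, 'e::euclidean_space) mfd \<Rightarrow> 'a vfield \<Rightarrow> 'a vfield \<Rightarrow> 'a vfield" where
  "lie_bracket M X Y p =
     (\<lambda>f. if smooth_at M p f then X p (\<lambda>q. Y q f) - Y p (\<lambda>q. X q f) else 0)"

text \<open>A vector field extending a given tangent vector smoothly to a neighbourhood. It is used to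
  evaluate, on tangent vectors, expressions in vector fields that are tensorial.\<close>

definition vext :: "('a, 'e::euclidean_space) mfd \<Rightarrow> 'a \<Rightarrow> 'a tvec \<Rightarrow> 'a vfield" where
  "vext M p x =
     (SOME X. X p = x \<and> (\<exists>V. openin (mtop M) V \<and> p \<in> V \<and> X \<in> smooth_vfields M V))"

section \<open>Connections, metrics, curvature\<close>

text \<open>A connection acts on vector fields that are smooth on an arbitrary open set.\<close>

type_synonym 'a connection = "'a vfield \<Rightarrow> 'a vfield \<Rightarrow> 'a vfield"
type_synonym 'a metric = "'a \<Rightarrow> 'a tvec \<Rightarrow> 'a tvec \<Rightarrow> real"
type_synonym 'a endo = "'a \<Rightarrow> 'a tvec \<Rightarrow> 'a tvec"
type_synonym 'a form1 = "'a \<Rightarrow> 'a tvec \<Rightarrow> real"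

definition affine_connection :: "('a, 'e::euclidean_space) mfd \<Rightarrow> 'a connection \<Rightarrow> bool" where
  "affine_connection M D \<longleftrightarrow>
     (\<forall>V X Y. openin (mtop M) V \<and> X \<in> smooth_vfields M V \<and> Y \<in> smooth_vfields M V \<longrightarrow>
        D X Y \<in> smooth_vfields M V \<and>
        (\<forall>Z\<in>smooth_vfields M V. \<forall>p\<in>V.
           D (\<lambda>q. X q + Z q) Y p = D X Y p + D Z Y p \<and>
           D X (\<lambda>q. Y q + Z q) p = D X Y p + D X Z p) \<and>
        (\<forall>f. (\<forall>q\<in>V. smooth_at M q f) \<longrightarrow> (\<forall>p\<in>V.
           D (\<lambda>q. f q *\<^sub>t X q) Y p = f p *\<^sub>t D X Y p \<and>
           D X (\<lambda>q. f q *\<^sub>t Y q) p = X p f *\<^sub>t Y p + f p *\<^sub>t D X Y p)))"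

text \<open>A nondegenerate symmetric form that varies smoothly; its index is then locally constant.\<close>

definition pseudo_riemannian_metric :: "('a, 'e::euclidean_space) mfd \<Rightarrow> 'a metric \<Rightarrow> bool" where
  "pseudo_riemannian_metric M g \<longleftrightarrow>
     (\<forall>p\<in>topspace (mtop M).
        (\<forall>x\<in>tangent_space M p. \<forall>y\<in>tangent_space M p.
           g p x y = g p y x \<and>
           (\<forall>a. g p (a *\<^sub>t x) y = a * g p x y) \<and>
           (\<forall>z\<in>tangent_space M p. g p (x + z) y = g p x y + g p z y)) \<and>
        (\<forall>x\<in>tangent_space M p. (\<forall>y\<in>tangent_space M p. g p x y = 0) \<longrightarrow> x = 0)) \<and>
     (\<forall>V X Y. openin (mtop M) V \<and> X \<in> smooth_vfields M V \<and> Y \<in> smooth_vfields M V \<longrightarrow>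
        (\<forall>p\<in>V. smooth_at M p (\<lambda>q. g q (X q) (Y q))))"

definition levi_civita :: "('a, 'e::euclidean_space) mfd \<Rightarrow> 'a metric \<Rightarrow> 'a connection \<Rightarrow> bool" where
  "levi_civita M g D \<longleftrightarrow>
     affine_connection M D \<and>
     (\<forall>V X Y. openin (mtop M) V \<and> X \<in> smooth_vfields M V \<and> Y \<in> smooth_vfields M V \<longrightarrow>
        (\<forall>p\<in>V. D X Y p - D Y X p = lie_bracket M X Y p) \<and>
        (\<forall>Z\<in>smooth_vfields M V. \<forall>p\<in>V.
           X p (\<lambda>q. g q (Y q) (Z q)) = g p (D X Y p) (Z p) + g p (Y p) (D X Z p)))"

text \<open>\<open>(D\<^sub>X P) Y\<close> for an endomorphism field and \<open>(D\<^sub>X \<omega>) Y\<close> for a 1-form.\<close>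

definition nabla_endo :: "'a connection \<Rightarrow> 'a endo \<Rightarrow> 'a vfield \<Rightarrow> 'a vfield \<Rightarrow> 'a vfield" where
  "nabla_endo D P X Y p = D X (\<lambda>q. P q (Y q)) p - P p (D X Y p)"

definition nabla_form :: "'a connection \<Rightarrow> 'a form1 \<Rightarrow> 'a vfield \<Rightarrow> 'a vfield \<Rightarrow> 'a \<Rightarrow> real" where
  "nabla_form D \<omega> X Y p = X p (\<lambda>q. \<omega> q (Y q)) - \<omega> p (D X Y p)"

definition curvature ::
    "('a, 'e::euclidean_space) mfd \<Rightarrow> 'a connection \<Rightarrow> 'a vfield \<Rightarrow> 'a vfield \<Rightarrow> 'a vfield \<Rightarrow> 'a vfield" where
  "curvature M D X Y Z p = D X (D Y Z) p - D Y (D X Z) p - D (lie_bracket M X Y) Z p"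

definition curvature4 ::
    "('a, 'e::euclidean_space) mfd \<Rightarrow> 'a metric \<Rightarrow> 'a connection \<Rightarrow>
     'a \<Rightarrow> 'a tvec \<Rightarrow> 'a tvec \<Rightarrow> 'a tvec \<Rightarrow> 'a tvec \<Rightarrow> real" where
  "curvature4 M g D p x y z u = g p (curvature M D (vext M p x) (vext M p y) (vext M p z) p) u"

definition closed_form1 :: "('a, 'e::euclidean_space) mfd \<Rightarrow> 'a form1 \<Rightarrow> bool" where
  "closed_form1 M \<omega> \<longleftrightarrow>
     (\<forall>V X Y. openin (mtop M) V \<and> X \<in> smooth_vfields M V \<and> Y \<in> smooth_vfields M V \<longrightarrow>
        (\<forall>p\<in>V. X p (\<lambda>q. \<omega> q (Y q)) - Y p (\<lambda>q. \<omega> q (X q)) - \<omega> p (lie_bracket M X Y p) = 0))"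

section \<open>Kaehler manifolds with Norden metric\<close>

text \<open>Neutrality of the signature is a consequence of \<open>g (J x) (J y) = - g x y\<close>.\<close>

definition kaehler_norden ::
    "('b, 'f::euclidean_space) mfd \<Rightarrow> 'b endo \<Rightarrow> 'b metric \<Rightarrow> 'b connection \<Rightarrow> bool" where
  "kaehler_norden M J g D \<longleftrightarrow>
     smooth_manifold M \<and> pseudo_riemannian_metric M g \<and> levi_civita M g D \<and>
     (\<forall>p\<in>topspace (mtop M). \<forall>x\<in>tangent_space M p.
        J p x \<in> tangent_space M p \<and> J p (J p x) = - x \<and>
        (\<forall>a. J p (a *\<^sub>t x) = a *\<^sub>t J p x) \<and>
        (\<forall>y\<in>tangent_space M p. J p (x + y) = J p x + J p y \<and> g p (J p x) (J p y) = - g p x y)) \<and>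
     (\<forall>V X. openin (mtop M) V \<and> X \<in> smooth_vfields M V \<longrightarrow>
        (\<lambda>q. J q (X q)) \<in> smooth_vfields M V \<and>
        (\<forall>Y\<in>smooth_vfields M V. \<forall>p\<in>V. nabla_endo D J X Y p = 0))"

text \<open>In the following tensors, \<open>g\<close>, \<open>P\<close> (standing for \<open>\<phi>\<close>) and \<open>e\<close> (standing for \<open>\<eta>\<close>) are the values
  at one point.\<close>

definition pi1 :: "('v \<Rightarrow> 'v \<Rightarrow> real) \<Rightarrow> 'v \<Rightarrow> 'v \<Rightarrow> 'v \<Rightarrow> 'v \<Rightarrow> real" where
  "pi1 g x y z u = g y z * g x u - g x z * g y u"

definition pi2 :: "('v \<Rightarrow> 'v \<Rightarrow> real) \<Rightarrow> ('v \<Rightarrow> 'v) \<Rightarrow> 'v \<Rightarrow> 'v \<Rightarrow> 'v \<Rightarrow> 'v \<Rightarrow> real" where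
  "pi2 g P x y z u = g y (P z) * g x (P u) - g x (P z) * g y (P u)"

definition pi3 :: "('v \<Rightarrow> 'v \<Rightarrow> real) \<Rightarrow> ('v \<Rightarrow> 'v) \<Rightarrow> 'v \<Rightarrow> 'v \<Rightarrow> 'v \<Rightarrow> 'v \<Rightarrow> real" where
  "pi3 g P x y z u =
     - g y z * g x (P u) + g x z * g y (P u) - g y (P z) * g x u + g x (P z) * g y u"

definition pi4 :: "('v \<Rightarrow> 'v \<Rightarrow> real) \<Rightarrow> ('v \<Rightarrow> real) \<Rightarrow> 'v \<Rightarrow> 'v \<Rightarrow> 'v \<Rightarrow> 'v \<Rightarrow> real" where
  "pi4 g e x y z u =
     e y * e z * g x u - e x * e z * g y u + e x * e u * g y z - e y * e u * g x z"

definition pi5 ::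
    "('v \<Rightarrow> 'v \<Rightarrow> real) \<Rightarrow> ('v \<Rightarrow> 'v) \<Rightarrow> ('v \<Rightarrow> real) \<Rightarrow> 'v \<Rightarrow> 'v \<Rightarrow> 'v \<Rightarrow> 'v \<Rightarrow> real" where
  "pi5 g P e x y z u =
     e y * e z * g x (P u) - e x * e z * g y (P u) + e x * e u * g y (P z) - e y * e u * g x (P z)"

definition plane :: "'a tvec \<Rightarrow> 'a tvec \<Rightarrow> 'a tvec set" where
  "plane x y = {a *\<^sub>t x + b *\<^sub>t y | a b. True}"

definition const_totally_real_curvatures ::
    "('b, 'f::euclidean_space) mfd \<Rightarrow> 'b endo \<Rightarrow> 'b metric \<Rightarrow> 'b connection \<Rightarrow>
     ('b \<Rightarrow> real) \<Rightarrow> ('b \<Rightarrow> real) \<Rightarrow> bool" where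
  "const_totally_real_curvatures M J g D \<nu> \<nu>t \<longleftrightarrow>
     (\<forall>p\<in>topspace (mtop M). \<forall>x\<in>tangent_space M p. \<forall>y\<in>tangent_space M p.
        (\<forall>a b. a *\<^sub>t x + b *\<^sub>t y = 0 \<longrightarrow> a = 0 \<and> b = 0) \<and>
        pi1 (g p) x y y x \<noteq> 0 \<and>
        (\<forall>v\<in>plane x y. \<forall>w\<in>plane x y. g p (J p v) w = 0) \<longrightarrow>
          curvature4 M g D p x y y x / pi1 (g p) x y y x = \<nu> p \<and>
          curvature4 M g D p x y y (J p x) / pi1 (g p) x y y x = \<nu>t p)"

section \<open>Real time-like hypersurfaces\<close>

text \<open>A hypersurface is given by an immersion \<open>\<iota>\<close> of codimension 1 (the inclusion, if it is a subset).\<close>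

definition differential ::
    "('b, 'f::euclidean_space) mfd \<Rightarrow> ('a \<Rightarrow> 'b) \<Rightarrow> 'a \<Rightarrow> 'a tvec \<Rightarrow> 'b tvec" where
  "differential M' \<iota> p v = (\<lambda>h. if smooth_at M' (\<iota> p) h then v (h \<circ> \<iota>) else 0)"

definition immersion ::
    "('a, 'e::euclidean_space) mfd \<Rightarrow> ('b, 'f::euclidean_space) mfd \<Rightarrow> ('a \<Rightarrow> 'b) \<Rightarrow> bool" where
  "immersion M M' \<iota> \<longleftrightarrow>
     continuous_map (mtop M) (mtop M') \<iota> \<and>
     (\<forall>p\<in>topspace (mtop M).
        (\<forall>h. smooth_at M' (\<iota> p) h \<longrightarrow> smooth_at M p (h \<circ> \<iota>)) \<and>
        inj_on (differential M' \<iota> p) (tangent_space M p))"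

definition hypersurface ::
    "('a, 'e::euclidean_space) mfd \<Rightarrow> ('b, 'f::euclidean_space) mfd \<Rightarrow> ('a \<Rightarrow> 'b) \<Rightarrow> bool" where
  "hypersurface M M' \<iota> \<longleftrightarrow>
     smooth_manifold M \<and> smooth_manifold M' \<and> DIM('f) = DIM('e) + 1 \<and> immersion M M' \<iota>"

text \<open>\<open>N\<close> is a smooth vector field along \<open>\<iota>\<close>.\<close>

definition timelike_unit_normal ::
    "('a, 'e::euclidean_space) mfd \<Rightarrow> ('b, 'f::euclidean_space) mfd \<Rightarrow> ('a \<Rightarrow> 'b) \<Rightarrow> 'b metric \<Rightarrow>
     ('a \<Rightarrow> 'b tvec) \<Rightarrow> bool" where
  "timelike_unit_normal M M' \<iota> g' N \<longleftrightarrow>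
     (\<forall>p\<in>topspace (mtop M).
        N p \<in> tangent_space M' (\<iota> p) \<and>
        (\<forall>h. smooth_at M' (\<iota> p) h \<longrightarrow> smooth_at M p (\<lambda>q. N q h)) \<and>
        g' (\<iota> p) (N p) (N p) = - 1 \<and>
        (\<forall>x\<in>tangent_space M p. g' (\<iota> p) (differential M' \<iota> p x) (N p) = 0))"

definition induced_metric ::
    "('b, 'f::euclidean_space) mfd \<Rightarrow> ('a \<Rightarrow> 'b) \<Rightarrow> 'b metric \<Rightarrow> 'a metric" where
  "induced_metric M' \<iota> g' p x y = g' (\<iota> p) (differential M' \<iota> p x) (differential M' \<iota> p y)"

definition normal_angle ::
    "('a \<Rightarrow> 'b) \<Rightarrow> 'b endo \<Rightarrow> 'b metric \<Rightarrow> ('a \<Rightarrow> 'b tvec) \<Rightarrow> 'a \<Rightarrow> real" where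
  "normal_angle \<iota> J g' N p = arctan (g' (\<iota> p) (N p) (J (\<iota> p) (N p)))"

text \<open>The formulas for \<open>\<phi>\<close> and \<open>\<xi>\<close> yield vectors tangent to the image of \<open>\<iota>\<close>, which are pulled back to \<open>M\<close>
  along the injective differential.\<close>

definition tangent_pullback ::
    "('a, 'e::euclidean_space) mfd \<Rightarrow> ('b, 'f::euclidean_space) mfd \<Rightarrow> ('a \<Rightarrow> 'b) \<Rightarrow>
     'a \<Rightarrow> 'b tvec \<Rightarrow> 'a tvec" where
  "tangent_pullback M M' \<iota> p = inv_into (tangent_space M p) (differential M' \<iota> p)"

definition hyp_eta ::
    "('b, 'f::euclidean_space) mfd \<Rightarrow> ('a \<Rightarrow> 'b) \<Rightarrow> 'b endo \<Rightarrow> 'b metric \<Rightarrow> ('a \<Rightarrow> 'b tvec) \<Rightarrow>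
     'a form1" where
  "hyp_eta M' \<iota> J g' N p x =
     cos (normal_angle \<iota> J g' N p) * g' (\<iota> p) (differential M' \<iota> p x) (J (\<iota> p) (N p))"

definition hyp_xi ::
    "('a, 'e::euclidean_space) mfd \<Rightarrow> ('b, 'f::euclidean_space) mfd \<Rightarrow> ('a \<Rightarrow> 'b) \<Rightarrow> 'b endo \<Rightarrow>
     'b metric \<Rightarrow> ('a \<Rightarrow> 'b tvec) \<Rightarrow> 'a vfield" where
  "hyp_xi M M' \<iota> J g' N p =
     (let t = normal_angle \<iota> J g' N p in
      tangent_pullback M M' \<iota> p (sin t *\<^sub>t N p + cos t *\<^sub>t J (\<iota> p) (N p)))"

definition hyp_phi ::
    "('a, 'e::euclidean_space) mfd \<Rightarrow> ('b, 'f::euclidean_space) mfd \<Rightarrow> ('a \<Rightarrow> 'b) \<Rightarrow> 'b endo \<Rightarrow>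
     'b metric \<Rightarrow> ('a \<Rightarrow> 'b tvec) \<Rightarrow> 'a endo" where
  "hyp_phi M M' \<iota> J g' N p x =
     (let t = normal_angle \<iota> J g' N p; X = differential M' \<iota> p x; JN = J (\<iota> p) (N p) in
      tangent_pullback M M' \<iota> p
        (J (\<iota> p) X + (cos t * g' (\<iota> p) X JN) *\<^sub>t (cos t *\<^sub>t N p - sin t *\<^sub>t JN)))"

section \<open>Almost contact structures with Norden metric\<close>

definition F_tensor ::
    "('a, 'e::euclidean_space) mfd \<Rightarrow> 'a metric \<Rightarrow> 'a connection \<Rightarrow> 'a endo \<Rightarrow>
     'a \<Rightarrow> 'a tvec \<Rightarrow> 'a tvec \<Rightarrow> 'a tvec \<Rightarrow> real" where
  "F_tensor M g D \<phi> p x y z = g p (nabla_endo D \<phi> (vext M p x) (vext M p y) p) z"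

text \<open>\<open>e 0, \<dots>, e (m - 1), \<xi>\<close> is a basis of the tangent space, with all \<open>e i\<close> in the kernel of \<open>\<eta>\<close>.\<close>

definition adapted_basis ::
    "('a, 'e::euclidean_space) mfd \<Rightarrow> 'a vfield \<Rightarrow> 'a form1 \<Rightarrow> nat \<Rightarrow> 'a \<Rightarrow> (nat \<Rightarrow> 'a tvec) \<Rightarrow> bool" where
  "adapted_basis M \<xi> \<eta> m p e \<longleftrightarrow>
     (\<forall>i<m. e i \<in> tangent_space M p \<and> \<eta> p (e i) = 0) \<and>
     (\<forall>a b. (\<Sum>i<m. a i *\<^sub>t e i) + b *\<^sub>t \<xi> p = 0 \<longrightarrow> (\<forall>i<m. a i = 0) \<and> b = 0) \<and>
     (\<forall>x\<in>tangent_space M p. \<exists>a b. x = (\<Sum>i<m. a i *\<^sub>t e i) + b *\<^sub>t \<xi> p)"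

text \<open>The contraction \<open>g\<^sup>i\<^sup>j B (e\<^sub>i, e\<^sub>j)\<close>; it does not depend on the choice of \<open>e\<close>, and \<open>G\<close> is the inverse
  of the Gram matrix.\<close>

definition horizontal_trace ::
    "('a, 'e::euclidean_space) mfd \<Rightarrow> 'a metric \<Rightarrow> 'a vfield \<Rightarrow> 'a form1 \<Rightarrow> nat \<Rightarrow> 'a \<Rightarrow>
     ('a tvec \<Rightarrow> 'a tvec \<Rightarrow> real) \<Rightarrow> real" where
  "horizontal_trace M g \<xi> \<eta> m p B =
     (let e = (SOME e. adapted_basis M \<xi> \<eta> m p e);
          G = (SOME G :: nat \<Rightarrow> nat \<Rightarrow> real.
                 \<forall>i<m. \<forall>j<m. (\<Sum>k<m. G i k * g p (e k) (e j)) = (if i = j then 1 else 0))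
      in \<Sum>i<m. \<Sum>j<m. G i j * B (e i) (e j))"

definition lee_theta ::
    "('a, 'e::euclidean_space) mfd \<Rightarrow> 'a metric \<Rightarrow> 'a connection \<Rightarrow> 'a endo \<Rightarrow> 'a vfield \<Rightarrow> 'a form1 \<Rightarrow>
     nat \<Rightarrow> 'a form1" where
  "lee_theta M g D \<phi> \<xi> \<eta> n p z =
     horizontal_trace M g \<xi> \<eta> (2 * n) p (\<lambda>x y. F_tensor M g D \<phi> p x y z)"

definition lee_theta_star ::
    "('a, 'e::euclidean_space) mfd \<Rightarrow> 'a metric \<Rightarrow> 'a connection \<Rightarrow> 'a endo \<Rightarrow> 'a vfield \<Rightarrow> 'a form1 \<Rightarrow>
     nat \<Rightarrow> 'a form1" where
  "lee_theta_star M g D \<phi> \<xi> \<eta> n p z =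
     horizontal_trace M g \<xi> \<eta> (2 * n) p (\<lambda>x y. F_tensor M g D \<phi> p x (\<phi> p y) z)"

definition F4_F5_manifold ::
    "('a, 'e::euclidean_space) mfd \<Rightarrow> 'a metric \<Rightarrow> 'a connection \<Rightarrow> 'a endo \<Rightarrow> 'a vfield \<Rightarrow> 'a form1 \<Rightarrow>
     nat \<Rightarrow> bool" where
  "F4_F5_manifold M g D \<phi> \<xi> \<eta> n \<longleftrightarrow>
     (\<forall>p\<in>topspace (mtop M).
      \<forall>x\<in>tangent_space M p. \<forall>y\<in>tangent_space M p. \<forall>z\<in>tangent_space M p.
        F_tensor M g D \<phi> p x y z =
          - (lee_theta M g D \<phi> \<xi> \<eta> n p (\<xi> p) / (2 * real n))
              * (g p (\<phi> p x) (\<phi> p y) * \<eta> p z + g p (\<phi> p x) (\<phi> p z) * \<eta> p y)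
          - (lee_theta_star M g D \<phi> \<xi> \<eta> n p (\<xi> p) / (2 * real n))
              * (g p x (\<phi> p y) * \<eta> p z + g p x (\<phi> p z) * \<eta> p y))"

definition F40_F50_manifold ::
    "('a, 'e::euclidean_space) mfd \<Rightarrow> 'a metric \<Rightarrow> 'a connection \<Rightarrow> 'a endo \<Rightarrow> 'a vfield \<Rightarrow> 'a form1 \<Rightarrow>
     nat \<Rightarrow> bool" where
  "F40_F50_manifold M g D \<phi> \<xi> \<eta> n \<longleftrightarrow>
     F4_F5_manifold M g D \<phi> \<xi> \<eta> n \<and>
     closed_form1 M (lee_theta M g D \<phi> \<xi> \<eta> n) \<and>
     closed_form1 M (lee_theta_star M g D \<phi> \<xi> \<eta> n)"

definition canonical_connection ::
    "'a connection \<Rightarrow> 'a endo \<Rightarrow> 'a vfield \<Rightarrow> 'a form1 \<Rightarrow> 'a connection" where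
  "canonical_connection D \<phi> \<xi> \<eta> X Y p =
     D X Y p
     + (1/2) *\<^sub>t (nabla_endo D \<phi> X (\<lambda>q. \<phi> q (Y q)) p + nabla_form D \<eta> X Y p *\<^sub>t \<xi> p)
     - \<eta> p (Y p) *\<^sub>t D X \<xi> p"

end

theory Submission
  imports Defs
begin

text \<open>Along the hypersurface, let \<open>L\<close> be the pull-back of the ambient connection; it is metric,
  torsion-free on pushed-forward fields, commutes with \<open>J\<close> and has the ambient curvature. On the
  horizontal distribution \<open>ker \<eta>\<close> the canonical connection is the orthogonal projection of \<open>L\<close>, since
  the normal bundle of \<open>ker \<eta>\<close> is spanned by \<open>N\<close> and \<open>\<xi>\<close>, and it makes \<open>\<xi>\<close> parallel. Hence \<open>K\<close> is the
  horizontal part of the ambient curvature corrected by the second fundamental forms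
  \<open>h(X,U) = g(\<nabla>\<^sub>X \<xi>, U)\<close> and \<open>g(AX,U)\<close>. With \<open>a = \<theta>(\<xi>)/2n\<close> and \<open>b = \<theta>*(\<xi>)/2n\<close>, the form of \<open>F\<close> on \<open>(X, \<xi>, U)\<close>
  gives \<open>h(X,U) = a g(\<phi>X,U) + b g(X,U)\<close> for horizontal \<open>U\<close>, and \<open>J\<close>-linearity of \<open>L\<close> applied to
  \<open>\<xi> = sin t N + cos t JN\<close> determines \<open>A\<close> from \<open>h\<close>. This expresses \<open>K\<close> through \<open>\<pi>\<^sub>1 - \<pi>\<^sub>2 - \<pi>\<^sub>4\<close> and
  \<open>\<pi>\<^sub>3 + \<pi>\<^sub>5\<close> only. The stated formula follows because the ambient curvature \<open>R'(\<xi>, Y)\<xi>\<close>, computed in two ways,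
  yields the derivatives of \<open>a\<close> and \<open>b\<close> along \<open>\<xi>\<close>, which make the coefficients of \<open>\<pi>\<^sub>4\<close> and \<open>\<pi>\<^sub>5\<close> match.\<close>

section \<open>Calculus of \<open>C\<^sup>k\<close> functions\<close>

text \<open>Tangent vectors are derivations and \<open>curvature4\<close> is evaluated on
  arbitrarily chosen local extensions \<open>vext\<close>; hence the need for Hadamard's lemma (to
  expand derivations in coordinates) and for tensoriality. Since \<open>\<iota>\<close> is only an
  immersion, \<open>N\<close> and \<open>\<xi>\<close> are handled as sections along
  \<open>\<iota>\<close>, not through extensions to the ambient manifold. The ambient curvature is
  known only on totally real planes. Through \<open>J\<close> the tangent space is complex, with a
  complex bilinear metric and a complex multilinear curvature; complex Gram-Schmidt reaches generic
  planes, and a polynomial argument the rest. The horizontal distribution is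
  \<open>J\<close>-invariant, because its normal plane span(N, \<xi>) = span(N, JN) is. The two
  normals have squares -1 and 1, so the products of the two second fundamental forms enter
  \<open>K\<close> with opposite signs. The coefficients of \<open>A\<close> arise from (a, b) by an
  orthogonal matrix, which cancels the one unwanted term. The tensors
  \<open>\<pi>\<^sub>1 - \<pi>\<^sub>2 - \<pi>\<^sub>4\<close> and
  \<open>\<pi>\<^sub>3 + \<pi>\<^sub>5\<close> are just \<open>\<pi>\<^sub>1 - \<pi>\<^sub>2\<close>
  and \<open>\<pi>\<^sub>3\<close> of the horizontal metric g - \<eta>\<otimes>\<eta>.\<close>

lemma Ck_on_cong:
  assumes "open S" "\<And>x. x \<in> S \<Longrightarrow> f x = h x" "Ck_on k S f"
  shows "Ck_on k S h"
  using assms(2,3)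
proof (induction k arbitrary: f h)
  case 0
  then show ?case using continuous_on_cong[of S S f h] by auto
next
  case (Suc k)
  have d: "(h has_derivative frechet_derivative f (at x)) (at x)" if "x \<in> S" for x
    using has_derivative_transform_within_open[OF _ \<open>open S\<close> that Suc.prems(1)]
      Suc.prems(2) that frechet_derivative_works[of f "at x"] by auto
  have e: "frechet_derivative f (at x) = frechet_derivative h (at x)" if "x \<in> S" for x
    using frechet_derivative_at[OF d[OF that]] .
  have "Ck_on k S (\<lambda>x. frechet_derivative h (at x) v)" for v
    using Suc.IH[of "\<lambda>x. frechet_derivative f (at x) v" "\<lambda>x. frechet_derivative h (at x) v"]
      Suc.prems(2) e by auto
  then show ?case using d by (auto simp: differentiable_def)
qed

lemma Ck_on_subset: "Ck_on k S f \<Longrightarrow> T \<subseteq> S \<Longrightarrow> Ck_on k T f"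
  by (induction k arbitrary: f) (auto intro: continuous_on_subset)

text \<open>Lets the derivative be supplied in closed form instead of as an opaque
  \<open>frechet_derivative\<close>. The closure properties below lower the order through this
  rule.\<close>

lemma Ck_on_SucI:
  assumes "open S" "\<And>x. x \<in> S \<Longrightarrow> (f has_derivative f' x) (at x)"
    and "\<And>v. Ck_on k S (\<lambda>x. f' x v)"
  shows "Ck_on (Suc k) S f"
proof -
  have "f' x = frechet_derivative f (at x)" if "x \<in> S" for x
    using frechet_derivative_at assms(2) that by blast
  then have "Ck_on k S (\<lambda>x. frechet_derivative f (at x) v)" for v
    using Ck_on_cong[OF assms(1) _ assms(3)[of v]] by auto
  then show ?thesis using assms(2) by (auto simp: differentiable_def)
qed

text \<open>Order \<open>Suc k\<close> speaks only of differentiability and derivatives, so the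
  lower orders have to be recovered; at the bottom, differentiability supplies continuity.\<close>

lemma Ck_on_SucD:
  "Ck_on (Suc k) S f \<Longrightarrow> Ck_on k S f"
proof (induction k arbitrary: f)
  case 0
  then show ?case
    by (auto intro!: continuous_at_imp_continuous_on differentiable_imp_continuous_within)
next
  case (Suc k)
  then show ?case by (metis Ck_on.simps(2))
qed

lemma Ck_on_imp_continuous_on: "Ck_on k S f \<Longrightarrow> continuous_on S f"
proof (induction k)
  case (Suc k)
  then show ?case using Ck_on_SucD[OF Suc.prems] by blast
qed simp

lemma Ck_on_derivative:
  "Ck_on (Suc k) S f \<Longrightarrow> x \<in> S \<Longrightarrow> (f has_derivative frechet_derivative f (at x)) (at x)"
  by (simp flip: frechet_derivative_works)

lemma Ck_on_const: "open S \<Longrightarrow> Ck_on k S (\<lambda>x. a)"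
proof (induction k arbitrary: a)
  case (Suc k)
  then show ?case by (auto intro!: Ck_on_SucI[where f'="\<lambda>_ _. 0"])
qed auto

lemma Ck_on_bounded_linear: "open S \<Longrightarrow> bounded_linear f \<Longrightarrow> Ck_on k S f"
proof (cases k)
  case 0
  then show "bounded_linear f \<Longrightarrow> ?thesis" by (simp add: linear_continuous_on)
next
  case (Suc m)
  then show "open S \<Longrightarrow> bounded_linear f \<Longrightarrow> ?thesis"
    by (auto simp del: Ck_on.simps
      intro!: Ck_on_SucI[where f'="\<lambda>_. f"] Ck_on_const bounded_linear_imp_has_derivative)
qed

lemma Ck_on_add: "open S \<Longrightarrow> Ck_on k S f \<Longrightarrow> Ck_on k S h \<Longrightarrow> Ck_on k S (\<lambda>x. f x + h x)"
proof (induction k arbitrary: f h)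
  case 0
  then show ?case by (auto intro: continuous_on_add)
next
  case (Suc k)
  show ?case
    by (rule Ck_on_SucI[OF Suc.prems(1) has_derivative_add[OF Ck_on_derivative Ck_on_derivative]])
      (use Suc in auto)
qed

lemma Ck_on_sum:
  "open S \<Longrightarrow> (\<And>i. i \<in> I \<Longrightarrow> Ck_on k S (f i)) \<Longrightarrow> Ck_on k S (\<lambda>x. \<Sum>i\<in>I. f i x)"
  by (induction I rule: infinite_finite_induct) (auto intro: Ck_on_const Ck_on_add)

lemma Ck_on_mult:
  fixes f h :: "'e::euclidean_space \<Rightarrow> real"
  shows "open S \<Longrightarrow> Ck_on k S f \<Longrightarrow> Ck_on k S h \<Longrightarrow> Ck_on k S (\<lambda>x. f x * h x)"
proof (induction k arbitrary: f h)
  case 0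
  then show ?case by (auto intro: continuous_on_mult)
next
  case (Suc k)
  show ?case
  proof (rule Ck_on_SucI[OF Suc.prems(1) has_derivative_mult[OF Ck_on_derivative Ck_on_derivative]])
    fix v
    have "Ck_on k S (\<lambda>x. f x * frechet_derivative h (at x) v)"
      "Ck_on k S (\<lambda>x. frechet_derivative f (at x) v * h x)"
      using Suc.prems Ck_on_SucD[OF Suc.prems(2)] Ck_on_SucD[OF Suc.prems(3)] by (auto intro: Suc.IH)
    then show "Ck_on k S (\<lambda>x. f x * frechet_derivative h (at x) v + frechet_derivative f (at x) v * h x)"
      using Suc.prems(1) by (rule Ck_on_add[rotated])
  qed (use Suc in auto)
qed

lemma Ck_on_inner: "open S \<Longrightarrow> Ck_on k S f \<Longrightarrow> Ck_on k S (\<lambda>x. f x \<bullet> b)"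
proof (induction k arbitrary: f)
  case 0
  then show ?case by (auto intro!: continuous_intros)
next
  case (Suc k)
  show ?case
    by (rule Ck_on_SucI[OF Suc.prems(1) has_derivative_inner_left[OF Ck_on_derivative]])
      (use Suc in auto)
qed

lemma Ck_on_inverse:
  fixes f :: "'e::euclidean_space \<Rightarrow> real"
  assumes "open S" "\<And>x. x \<in> S \<Longrightarrow> f x \<noteq> 0"
  shows "Ck_on k S f \<Longrightarrow> Ck_on k S (\<lambda>x. inverse (f x))"
proof (induction k)
  case 0
  then show ?case using assms by (auto intro!: continuous_intros)
next
  case (Suc k)
  show ?case
  proof (rule Ck_on_SucI[OF assms(1)])
    fix x assume x: "x \<in> S"
    show "((\<lambda>x. inverse (f x)) has_derivative
        (\<lambda>v. - (inverse (f x) * frechet_derivative f (at x) v * inverse (f x)))) (at x)"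
      by (rule Deriv.has_derivative_inverse[OF assms(2)[OF x] Ck_on_derivative[OF Suc.prems x]])
  next
    fix v
    have "Ck_on k S (\<lambda>x. (- 1) * (inverse (f x) * frechet_derivative f (at x) v * inverse (f x)))"
      using Suc Ck_on_SucD[OF Suc.prems] by (intro Ck_on_mult assms(1) Ck_on_const) auto
    then show "Ck_on k S (\<lambda>x. - (inverse (f x) * frechet_derivative f (at x) v * inverse (f x)))"
      by simp
  qed
qed

lemma linear_basis_expansion:
  fixes L :: "'e::euclidean_space \<Rightarrow> 'f::real_vector"
  assumes "linear L"
  shows "L v = (\<Sum>b\<in>Basis. (v \<bullet> b) *\<^sub>R L b)"
proof -
  have "L v = L (\<Sum>b\<in>Basis. (v \<bullet> b) *\<^sub>R b)" by (simp add: euclidean_representation)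
  then show ?thesis using assms by (simp add: linear_sum linear_cmul)
qed

text \<open>The chain rule is written in coordinates: each partial derivative of \<open>h\<close> is
  again a real function composed with the same \<open>f\<close>, so the induction generalizes over
  \<open>h\<close> alone.\<close>

lemma Ck_on_compose:
  fixes f :: "'e::euclidean_space \<Rightarrow> 'f::euclidean_space" and h :: "'f \<Rightarrow> real"
  assumes "open S" "open T" "\<And>x. x \<in> S \<Longrightarrow> f x \<in> T"
  shows "Ck_on k S f \<Longrightarrow> Ck_on k T h \<Longrightarrow> Ck_on k S (\<lambda>x. h (f x))"
proof (induction k arbitrary: h)
  case 0
  then show ?case using assms by (auto intro!: continuous_on_compose2[of T h])
next
  case (Suc k)
  let ?f = "\<lambda>x. frechet_derivative f (at x)" and ?h = "\<lambda>x. frechet_derivative h (at x)"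
  show ?case
  proof (rule Ck_on_SucI[OF assms(1), where f' = "\<lambda>x v. \<Sum>b\<in>Basis. (?f x v \<bullet> b) * ?h (f x) b"])
    fix x assume x: "x \<in> S"
    have "((\<lambda>x. h (f x)) has_derivative (\<lambda>v. ?h (f x) (?f x v))) (at x)"
      using diff_chain_at[OF Ck_on_derivative[OF Suc.prems(1) x] Ck_on_derivative[OF Suc.prems(2) assms(3)[OF x]]]
      by (simp add: o_def)
    moreover have "linear (?h (f x))"
      using Suc.prems(2) assms(3)[OF x] by (auto intro: linear_frechet_derivative)
    ultimately show "((\<lambda>x. h (f x)) has_derivative (\<lambda>v. \<Sum>b\<in>Basis. (?f x v \<bullet> b) * ?h (f x) b)) (at x)"
      using linear_basis_expansion[of "?h (f x)" "?f x v" for v] by (intro has_derivative_eq_rhs[where g' = "\<lambda>v. \<Sum>b\<in>Basis. (?f x v \<bullet> b) * ?h (f x) b"]) (auto simp del: euclidean_representation)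
  next
    fix v
    show "Ck_on k S (\<lambda>x. \<Sum>b\<in>Basis. (?f x v \<bullet> b) * ?h (f x) b)"
      using Suc.prems Suc.IH[OF Ck_on_SucD[OF Suc.prems(1)], of "\<lambda>y. ?h y b" for b]
      by (intro Ck_on_sum Ck_on_mult Ck_on_inner assms(1)) auto
  qed
qed

lemma smooth_on_cong:
  "open S \<Longrightarrow> (\<And>x. x \<in> S \<Longrightarrow> f x = h x) \<Longrightarrow> smooth_on S f \<Longrightarrow> smooth_on S h"
  unfolding smooth_on_def using Ck_on_cong by blast

lemma smooth_on_subset: "smooth_on S f \<Longrightarrow> T \<subseteq> S \<Longrightarrow> smooth_on T f"
  unfolding smooth_on_def using Ck_on_subset by blast

lemma smooth_on_const: "open S \<Longrightarrow> smooth_on S (\<lambda>x. a)"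
  unfolding smooth_on_def using Ck_on_const by blast

lemma smooth_on_bounded_linear: "open S \<Longrightarrow> bounded_linear f \<Longrightarrow> smooth_on S f"
  unfolding smooth_on_def using Ck_on_bounded_linear by blast

lemma smooth_on_add: "open S \<Longrightarrow> smooth_on S f \<Longrightarrow> smooth_on S h \<Longrightarrow> smooth_on S (\<lambda>x. f x + h x)"
  unfolding smooth_on_def using Ck_on_add by blast

lemma smooth_on_mult:
  fixes f h :: "'e::euclidean_space \<Rightarrow> real"
  shows "open S \<Longrightarrow> smooth_on S f \<Longrightarrow> smooth_on S h \<Longrightarrow> smooth_on S (\<lambda>x. f x * h x)"
  unfolding smooth_on_def using Ck_on_mult by blast

lemma smooth_on_inverse:
  fixes f :: "'e::euclidean_space \<Rightarrow> real"
  shows "open S \<Longrightarrow> (\<And>x. x \<in> S \<Longrightarrow> f x \<noteq> 0) \<Longrightarrow> smooth_on S f \<Longrightarrow> smooth_on S (\<lambda>x. inverse (f x))"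
  unfolding smooth_on_def using Ck_on_inverse by blast

lemma smooth_on_compose:
  fixes f :: "'e::euclidean_space \<Rightarrow> 'f::euclidean_space" and h :: "'f \<Rightarrow> real"
  shows "open S \<Longrightarrow> open T \<Longrightarrow> (\<And>x. x \<in> S \<Longrightarrow> f x \<in> T) \<Longrightarrow> smooth_on S f \<Longrightarrow> smooth_on T h
    \<Longrightarrow> smooth_on S (\<lambda>x. h (f x))"
  unfolding smooth_on_def using Ck_on_compose by blast

lemma smooth_on_frechet_derivative:
  "smooth_on S f \<Longrightarrow> smooth_on S (\<lambda>x. frechet_derivative f (at x) v)"
  unfolding smooth_on_def by (metis Ck_on.simps(2))

lemma smooth_on_has_derivative:
  "smooth_on S f \<Longrightarrow> x \<in> S \<Longrightarrow> (f has_derivative frechet_derivative f (at x)) (at x)"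
  unfolding smooth_on_def using Ck_on_derivative by blast

text \<open>One simultaneous induction, because each function is the derivative of the other up to
  sign.\<close>

lemma smooth_on_sin_cos: "smooth_on UNIV (sin :: real \<Rightarrow> real) \<and> smooth_on UNIV (cos :: real \<Rightarrow> real)"
proof -
  have "Ck_on k UNIV (sin :: real \<Rightarrow> real) \<and> Ck_on k UNIV (cos :: real \<Rightarrow> real)" for k
  proof (induction k)
    case (Suc k)
    have "Ck_on (Suc k) UNIV (sin :: real \<Rightarrow> real)"
      by (rule Ck_on_SucI[where f' = "\<lambda>x v. v * cos x"])
        (use Suc in \<open>auto intro!: derivative_eq_intros Ck_on_mult Ck_on_const\<close>)
    moreover have "Ck_on (Suc k) UNIV (cos :: real \<Rightarrow> real)"
    proof (rule Ck_on_SucI[where f' = "\<lambda>x v. (- v) * sin x"])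
      show "Ck_on k UNIV (\<lambda>x. (- v) * sin x)" for v :: real
        using Suc by (intro Ck_on_mult Ck_on_const) auto
    qed (auto intro!: derivative_eq_intros)
    ultimately show ?case by blast
  qed (auto intro!: continuous_intros)
  then show ?thesis by (auto simp: smooth_on_def)
qed

text \<open>The angle \<open>t\<close> is defined as an arctangent. The derivative 1 / (1 + x^2) is
  the inverse of a smooth function without zeros.\<close>

lemma smooth_on_arctan: "smooth_on UNIV arctan"
  unfolding smooth_on_def
proof
  fix k
  show "Ck_on k UNIV arctan"
  proof (cases k)
    case (Suc m)
    have "Ck_on (Suc m) UNIV arctan"
    proof (rule Ck_on_SucI[where f' = "\<lambda>x v. v * inverse (1 + x * x)"])
      fix v :: real
      show "Ck_on m UNIV (\<lambda>x. v * inverse (1 + x * x))"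
        by (intro Ck_on_mult Ck_on_inverse Ck_on_const Ck_on_add Ck_on_bounded_linear) 
          (auto simp: add_nonneg_eq_0_iff)
    qed (auto intro!: derivative_eq_intros simp: power2_eq_square)
    then show ?thesis using Suc by simp
  qed (auto intro!: continuous_intros)
qed

section \<open>Hadamard's lemma\<close>

lemma Ck_on_integral_ray:
  fixes h :: "'e::euclidean_space \<Rightarrow> real"
  assumes S: "open S" "convex S" "p \<in> S"
  shows "Ck_on k S h \<Longrightarrow> Ck_on k S (\<lambda>x. integral (cbox 0 1) (\<lambda>s. s ^ j * h (p + s *\<^sub>R (x - p))))"
proof -
  have ray: "p + s *\<^sub>R (x - p) \<in> S" if "x \<in> S" "s \<in> cbox 0 1" for x s
    using convexD_alt[OF S(2,3) that(1), of s] that(2) by (simp add: algebra_simps)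
  have cont: "continuous_on (S \<times> cbox 0 1) (\<lambda>(x, s). s ^ j * f (p + s *\<^sub>R (x - p)))"
    if "continuous_on S f" for f :: "'e \<Rightarrow> real" and j
    unfolding case_prod_unfold
    by (intro continuous_intros continuous_on_compose2[OF that]) (auto intro: ray)
  show "Ck_on k S h \<Longrightarrow> Ck_on k S (\<lambda>x. integral (cbox 0 1) (\<lambda>s. s ^ j * h (p + s *\<^sub>R (x - p))))"
  \<comment> \<open>The exponent is general because the inner derivative of the ray contributes a
    factor \<open>s\<close>: differentiating once passes from \<open>j\<close> to
    \<open>Suc j\<close> and from \<open>h\<close> to its partial derivatives.\<close>
  proof (induction k arbitrary: h j)
    case 0
    then show ?case using integral_continuous_on_param[OF cont[of h j]] by simp
  next
    case (Suc k)
    let ?D = "\<lambda>x. frechet_derivative h (at x)"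
    let ?I = "\<lambda>b x. integral (cbox 0 1) (\<lambda>s. s ^ Suc j * ?D (p + s *\<^sub>R (x - p)) b)"
    have c0: "continuous_on S h" by (rule Ck_on_imp_continuous_on[OF Suc.prems])
    have cD: "continuous_on S (\<lambda>x. ?D x b)" for b
      using Suc.prems by (intro Ck_on_imp_continuous_on[of k]) simp
    show ?case
    proof (rule Ck_on_SucI[OF S(1), where f' = "\<lambda>x v. \<Sum>b\<in>Basis. (v \<bullet> b) * ?I b x"])
      fix x assume x: "x \<in> S"
      \<comment> \<open>\<open>leibniz_rule\<close> expects the derivative of the integrand as a
        bounded linear function, depending continuously on both variables; expanded in the basis,
        this reduces to continuity of the partial derivatives.\<close>
      let ?fx = "\<lambda>x s. \<Sum>b\<in>Basis. (s ^ Suc j * ?D (p + s *\<^sub>R (x - p)) b) *\<^sub>R blinfun_inner_left b"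
      have ap: "blinfun_apply (?fx x s) = (\<lambda>v. s ^ j * ?D (p + s *\<^sub>R (x - p)) (s *\<^sub>R v))"
        if "x \<in> S" "s \<in> cbox 0 1" for x s
      proof -
        have "linear (?D (p + s *\<^sub>R (x - p)))"
          using Suc.prems ray[OF that] by (auto intro: linear_frechet_derivative)
        then show ?thesis
          using linear_basis_expansion[of "?D (p + s *\<^sub>R (x - p))" "s *\<^sub>R v" for v]
          by (simp add: fun_eq_iff blinfun.sum_left blinfun.scaleR_left sum_distrib_left algebra_simps)
      qed
      have "((\<lambda>x. integral (cbox 0 1) (\<lambda>s. s ^ j * h (p + s *\<^sub>R (x - p)))) has_derivative
          blinfun_apply (integral (cbox 0 1) (?fx x))) (at x within S)"
      proof (rule leibniz_rule[OF _ _ _ x S(2)])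
        fix x s assume xs: "x \<in> S" "s \<in> cbox (0::real) 1"
        have "((\<lambda>x. h (p + s *\<^sub>R (x - p))) has_derivative (\<lambda>v. ?D (p + s *\<^sub>R (x - p)) (s *\<^sub>R v))) (at x)"
          using has_derivative_compose[where f = "\<lambda>x. p + s *\<^sub>R (x - p)" and f' = "\<lambda>v. s *\<^sub>R v"
              and s = UNIV, OF _ Ck_on_derivative[OF Suc.prems ray[OF xs]]]
          by (fastforce intro!: derivative_eq_intros)
        then have "((\<lambda>x. s ^ j * h (p + s *\<^sub>R (x - p))) has_derivative
            (\<lambda>v. s ^ j * ?D (p + s *\<^sub>R (x - p)) (s *\<^sub>R v))) (at x)"
          by (rule has_derivative_mult_right)
        then show "((\<lambda>x. s ^ j * h (p + s *\<^sub>R (x - p))) has_derivative blinfun_apply (?fx x s)) (at x within S)"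
          unfolding ap[OF xs] by (rule has_derivative_at_withinI)
      next
        fix x assume x: "x \<in> S"
        have "continuous_on (cbox 0 1) (\<lambda>s. s ^ j * h (p + s *\<^sub>R (x - p)))"
          by (intro continuous_intros continuous_on_compose2[OF c0]) (auto intro: ray x)
        then show "(\<lambda>s. s ^ j * h (p + s *\<^sub>R (x - p))) integrable_on cbox 0 1"
          by (rule integrable_continuous)
      next
        show "continuous_on (S \<times> cbox 0 1) (\<lambda>(x, s). ?fx x s)"
          using cont[OF cD, of "Suc j"] unfolding case_prod_unfold
          by (intro continuous_on_sum continuous_on_scaleR continuous_on_const) auto
      qed
      moreover have "blinfun_apply (integral (cbox 0 1) (?fx x)) v = (\<Sum>b\<in>Basis. (v \<bullet> b) * ?I b x)" for v
      proof -
        have cb: "continuous_on (cbox 0 1) (\<lambda>s. s ^ Suc j * ?D (p + s *\<^sub>R (x - p)) b)" for b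
          by (intro continuous_intros continuous_on_compose2[OF cD]) (auto intro: ray x)
        have i1: "?fx x integrable_on cbox 0 1"
          by (intro integrable_continuous continuous_on_sum continuous_on_scaleR continuous_on_const cb)
        have "blinfun_apply (integral (cbox 0 1) (?fx x)) v = integral (cbox 0 1) (\<lambda>s. blinfun_apply (?fx x s) v)"
          using integral_linear[OF i1 blinfun.bounded_linear_left[of v]] by (simp add: o_def)
        also have "\<dots> = integral (cbox 0 1) (\<lambda>s. \<Sum>b\<in>Basis. (v \<bullet> b) * (s ^ Suc j * ?D (p + s *\<^sub>R (x - p)) b))"
          by (rule integral_cong) (simp add: blinfun.sum_left blinfun.scaleR_left algebra_simps)
        also have "\<dots> = (\<Sum>b\<in>Basis. integral (cbox 0 1) (\<lambda>s. (v \<bullet> b) * (s ^ Suc j * ?D (p + s *\<^sub>R (x - p)) b)))"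
          by (rule integral_sum[OF finite_Basis]) (intro integrable_continuous continuous_on_mult continuous_on_const cb)
        finally show ?thesis by simp
      qed
      ultimately show "((\<lambda>x. integral (cbox 0 1) (\<lambda>s. s ^ j * h (p + s *\<^sub>R (x - p)))) has_derivative
          (\<lambda>v. \<Sum>b\<in>Basis. (v \<bullet> b) * ?I b x)) (at x)"
        unfolding at_within_open[OF x S(1)] by (rule has_derivative_eq_rhs[OF _ ext])
    next
      fix v
      show "Ck_on k S (\<lambda>x. \<Sum>b\<in>Basis. (v \<bullet> b) * ?I b x)"
        using Suc.prems by (intro Ck_on_sum Ck_on_mult Ck_on_const S(1) Suc.IH) auto
    qed
  qed
qed

text \<open>The fundamental theorem of calculus along the segment from \<open>p\<close> to
  \<open>x\<close>, with the directional derivative split over the basis. Convexity keeps the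
  segment inside \<open>S\<close>.\<close>

lemma smooth_on_hadamard:
  fixes f :: "'e::euclidean_space \<Rightarrow> real"
  assumes S: "open S" "convex S" "p \<in> S" and f: "smooth_on S f"
  obtains h where "\<And>b. smooth_on S (h b)" "\<And>b. h b p = frechet_derivative f (at p) b"
    "\<And>x. x \<in> S \<Longrightarrow> f x = f p + (\<Sum>b\<in>Basis. ((x - p) \<bullet> b) * h b x)"
proof
  let ?D = "\<lambda>x. frechet_derivative f (at x)"
  \<comment> \<open>The factor \<open>s ^ 0\<close> is kept so that the ray integral lemma applies
    literally.\<close>
  define h where "h b x = integral (cbox 0 1) (\<lambda>s. s ^ 0 * ?D (p + s *\<^sub>R (x - p)) b)" for b x
  show "smooth_on S (h b)" for b
    using smooth_on_frechet_derivative[OF f] Ck_on_integral_ray[OF S]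
    unfolding smooth_on_def h_def by blast
  show "h b p = ?D p b" for b by (simp add: h_def)
  fix x assume x: "x \<in> S"
  have ray: "p + s *\<^sub>R (x - p) \<in> S" if "s \<in> cbox 0 1" for s
    using convexD_alt[OF S(2,3) x, of s] that by (simp add: algebra_simps)
  have cD: "continuous_on S (\<lambda>x. ?D x b)" for b
    using smooth_on_frechet_derivative[OF f, of b] Ck_on.simps(1) unfolding smooth_on_def by blast
  have cb: "continuous_on (cbox 0 1) (\<lambda>s. ?D (p + s *\<^sub>R (x - p)) b)" for b
    by (intro continuous_on_compose2[OF cD] continuous_intros) (auto intro: ray)
  have "((\<lambda>s. ?D (p + s *\<^sub>R (x - p)) (x - p)) has_integral f (p + 1 *\<^sub>R (x - p)) - f (p + 0 *\<^sub>R (x - p))) {0..1}"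
  proof (rule fundamental_theorem_of_calculus)
    fix s :: real assume s: "s \<in> {0..1}"
    then have r: "p + s *\<^sub>R (x - p) \<in> S" using ray by simp
    have "((\<lambda>s. f (p + s *\<^sub>R (x - p))) has_derivative (\<lambda>v. ?D (p + s *\<^sub>R (x - p)) (v *\<^sub>R (x - p)))) (at s)"
      using has_derivative_compose[where f = "\<lambda>s. p + s *\<^sub>R (x - p)" and f' = "\<lambda>v. v *\<^sub>R (x - p)"
          and s = UNIV, OF _ smooth_on_has_derivative[OF f r]]
      by (fastforce intro!: derivative_eq_intros)
    moreover have "linear (?D (p + s *\<^sub>R (x - p)))"
      using smooth_on_has_derivative[OF f r] has_derivative_linear by blast
    ultimately show "((\<lambda>s. f (p + s *\<^sub>R (x - p))) has_vector_derivative ?D (p + s *\<^sub>R (x - p)) (x - p)) (at s within {0..1})"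
      by (auto simp: has_vector_derivative_def linear_cmul intro: has_derivative_at_withinI)
  qed simp
  then have "f x - f p = integral (cbox 0 1) (\<lambda>s. ?D (p + s *\<^sub>R (x - p)) (x - p))"
    by (simp add: integral_unique)
  also have "\<dots> = integral (cbox 0 1) (\<lambda>s. \<Sum>b\<in>Basis. ((x - p) \<bullet> b) * ?D (p + s *\<^sub>R (x - p)) b)"
  proof (rule integral_cong)
    fix s :: real assume "s \<in> cbox 0 1"
    then have "linear (?D (p + s *\<^sub>R (x - p)))"
      using smooth_on_has_derivative[OF f ray] has_derivative_linear by blast
    from linear_basis_expansion[OF this, of "x - p"]
    show "?D (p + s *\<^sub>R (x - p)) (x - p) = (\<Sum>b\<in>Basis. ((x - p) \<bullet> b) * ?D (p + s *\<^sub>R (x - p)) b)" by simp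
  qed
  also have "\<dots> = (\<Sum>b\<in>Basis. integral (cbox 0 1) (\<lambda>s. ((x - p) \<bullet> b) * ?D (p + s *\<^sub>R (x - p)) b))"
    by (rule integral_sum[OF finite_Basis]) (intro integrable_continuous continuous_on_mult continuous_on_const cb)
  finally show "f x = f p + (\<Sum>b\<in>Basis. ((x - p) \<bullet> b) * h b x)" by (simp add: h_def)
qed

section \<open>Smooth functions and tangent vectors\<close>

text \<open>Tangent vectors are functions on functions. As members of a \<open>real_vector\<close>
  type they fall under the general theory of \<open>linear\<close>, \<open>subspace\<close> and
  scaled sums.\<close>

instantiation "fun" :: (type, real_vector) real_vector
begin

definition scaleR_fun :: "real \<Rightarrow> ('a \<Rightarrow> 'b) \<Rightarrow> 'a \<Rightarrow> 'b"
  where "scaleR_fun a f = (\<lambda>x. a *\<^sub>R f x)"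

instance by standard (auto simp: scaleR_fun_def plus_fun_def algebra_simps)

end

lemma tscale_eq_scaleR [simp]: "a *\<^sub>t v = a *\<^sub>R v"
  by (simp add: tscale_def scaleR_fun_def)

lemma scaleR_fun_apply: "(a *\<^sub>R f) x = a *\<^sub>R f x"
  by (simp add: scaleR_fun_def)

text \<open>The coordinate vector field of a chart in the constant direction \<open>w\<close>; the
  value 0 on non-smooth functions follows the convention of \<open>tangent_space\<close>.\<close>

definition cvec :: "('a, 'e::euclidean_space) mfd \<Rightarrow> 'a set \<Rightarrow> ('a \<Rightarrow> 'e) \<Rightarrow> 'e \<Rightarrow> 'a vfield" where
  "cvec M U c w q f =
     (if smooth_at M q f then frechet_derivative (f \<circ> inv_into U c) (at (c q)) w else 0)"

text \<open>The coordinates of a tangent vector, read off from its values on the coordinate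
  functions; at points of the chart domain it turns out to be the inverse of
  \<open>cvec\<close>.\<close>

definition vcomp :: "('a \<Rightarrow> 'e::euclidean_space) \<Rightarrow> 'a tvec \<Rightarrow> 'e" where
  "vcomp c v = (\<Sum>b\<in>Basis. v (\<lambda>q. c q \<bullet> b) *\<^sub>R b)"

lemma vcomp_inner: "b \<in> Basis \<Longrightarrow> vcomp c v \<bullet> b = v (\<lambda>q. c q \<bullet> b)"
  by (simp add: vcomp_def)

lemma linear_vcomp: "linear (vcomp c)"
  by (rule linearI) (auto simp: vcomp_def scaleR_fun_apply scaleR_left_distrib sum.distrib scaleR_sum_right)

section \<open>Smooth functions on a manifold\<close>

locale manifold =
  fixes M :: "('a, 'e::euclidean_space) mfd"
  assumes smooth_manifold: "smooth_manifold M"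
begin

lemma ex_chart:
  assumes "p \<in> topspace (mtop M)"
  obtains U c where "(U, c) \<in> charts M" "p \<in> U"
  using assms smooth_manifold unfolding smooth_manifold_def by blast

context
  fixes U c
  assumes chart: "(U, c) \<in> charts M"
begin

lemma chart_open: "openin (mtop M) U" and chart_image_open: "open (c ` U)"
  and chart_homeo: "homeomorphic_map (subtopology (mtop M) U) (top_of_set (c ` U)) c"
  using chart smooth_manifold unfolding smooth_manifold_def by fast+

lemma chart_topspace: "topspace (subtopology (mtop M) U) = U"
  using openin_subset[OF chart_open] by auto

lemma chart_inj: "inj_on c U"
  using homeomorphic_imp_injective_map[OF chart_homeo] chart_topspace by simp

lemma chart_inv [simp]: "q \<in> U \<Longrightarrow> inv_into U c (c q) = q"
  using chart_inj by simp

lemma chart_open_image: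
  assumes "openin (mtop M) V"
  shows "open (c ` (U \<inter> V))"
proof -
  have "openin (subtopology (mtop M) U) (U \<inter> V)"
    using assms by (auto simp: openin_subtopology)
  then have "openin (top_of_set (c ` U)) (c ` (U \<inter> V))"
    using homeomorphic_imp_open_map[OF chart_homeo] unfolding open_map_def by blast
  then show ?thesis using chart_image_open by (meson openin_open_eq)
qed

lemma chart_open_preimage:
  assumes "open S"
  shows "openin (mtop M) {q \<in> U. c q \<in> S}"
proof -
  have "continuous_map (subtopology (mtop M) U) (top_of_set (c ` U)) c"
    by (rule homeomorphic_imp_continuous_map[OF chart_homeo])
  then have "openin (subtopology (mtop M) U) {q \<in> U. c q \<in> c ` U \<inter> S}"
    using openin_continuous_map_preimage[of "subtopology (mtop M) U" "top_of_set (c ` U)" c "c ` U \<inter> S"]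
      assms unfolding chart_topspace by blast
  moreover have "{q \<in> U. c q \<in> c ` U \<inter> S} = {q \<in> U. c q \<in> S}" by auto
  ultimately show ?thesis using openin_trans_full[OF _ chart_open] by metis
qed

text \<open>Since transition maps are smooth, smoothness in a single chart around \<open>p\<close>
  suffices. Closure properties then reduce to statements about open sets of the model space.\<close>

lemma smooth_at_chart:
  assumes p: "p \<in> U"
  shows "smooth_at M p f \<longleftrightarrow>
    (\<exists>S. open S \<and> c p \<in> S \<and> S \<subseteq> c ` U \<and> smooth_on S (f \<circ> inv_into U c))"
proof
  assume "smooth_at M p f"
  then obtain V where V: "openin (mtop M) V" "p \<in> V" "smooth_on (c ` (U \<inter> V)) (f \<circ> inv_into U c)"
    using chart unfolding smooth_at_def by fast
  then show "\<exists>S. open S \<and> c p \<in> S \<and> S \<subseteq> c ` U \<and> smooth_on S (f \<circ> inv_into U c)"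
    using chart_open_image[OF V(1)] p by blast
next
  assume "\<exists>S. open S \<and> c p \<in> S \<and> S \<subseteq> c ` U \<and> smooth_on S (f \<circ> inv_into U c)"
  then obtain S where S: "open S" "c p \<in> S" "S \<subseteq> c ` U" "smooth_on S (f \<circ> inv_into U c)" by blast
  define V where "V = {q \<in> U. c q \<in> S}"
  have V: "openin (mtop M) V" "p \<in> V"
    unfolding V_def using chart_open_preimage[OF S(1)] S p by auto
  have "smooth_on (d ` (W \<inter> V)) (f \<circ> inv_into W d)" if W: "(W, d) \<in> charts M" for W d
  proof -
    have W': "inj_on d W" "open (d ` (W \<inter> V))" "smooth_on (d ` (W \<inter> U)) (c \<circ> inv_into W d)"
    proof -
      have h: "homeomorphic_map (subtopology (mtop M) W) (top_of_set (d ` W)) d"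
        "open (d ` W)" "openin (mtop M) W"
        using W smooth_manifold unfolding smooth_manifold_def by fast+
      show "inj_on d W"
        using homeomorphic_imp_injective_map[OF h(1)] openin_subset[OF h(3)] by (simp add: inf_absorb2)
      have "openin (subtopology (mtop M) W) (W \<inter> V)"
        using V by (auto simp: openin_subtopology)
      then have "openin (top_of_set (d ` W)) (d ` (W \<inter> V))"
        using homeomorphic_imp_open_map[OF h(1)] unfolding open_map_def by blast
      then show "open (d ` (W \<inter> V))" using h(2) by (meson openin_open_eq)
      show "smooth_on (d ` (W \<inter> U)) (c \<circ> inv_into W d)"
        using W chart smooth_manifold unfolding smooth_manifold_def by fast
    qed
    have "smooth_on (d ` (W \<inter> V)) (\<lambda>x. (f \<circ> inv_into U c) ((c \<circ> inv_into W d) x))"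
    proof (rule smooth_on_compose[OF W'(2) S(1) _ _ S(4)])
      show "smooth_on (d ` (W \<inter> V)) (c \<circ> inv_into W d)"
        by (rule smooth_on_subset[OF W'(3)]) (auto simp: V_def)
    qed (use W' in \<open>auto simp: V_def\<close>)
    then show ?thesis
      by (rule smooth_on_cong[OF W'(2), rotated]) (use W' in \<open>auto simp: V_def\<close>)
  qed
  then show "smooth_at M p f" using V unfolding smooth_at_def by blast
qed

end

lemma smooth_at_topspace: "smooth_at M p f \<Longrightarrow> p \<in> topspace (mtop M)"
  unfolding smooth_at_def using openin_subset by blast

lemma smooth_at_open:
  assumes "smooth_at M p f"
  obtains V where "openin (mtop M) V" "p \<in> V" "\<And>q. q \<in> V \<Longrightarrow> smooth_at M q f"
  using assms unfolding smooth_at_def by blast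

lemma smooth_at_cong:
  assumes "openin (mtop M) W" "p \<in> W" "\<And>q. q \<in> W \<Longrightarrow> f q = h q" "smooth_at M p f"
  shows "smooth_at M p h"
proof -
  obtain V where V: "openin (mtop M) V" "p \<in> V"
    "\<And>U c. (U, c) \<in> charts M \<Longrightarrow> smooth_on (c ` (U \<inter> V)) (f \<circ> inv_into U c)"
    using assms(4) unfolding smooth_at_def by blast
  have "smooth_on (c ` (U \<inter> (V \<inter> W))) (h \<circ> inv_into U c)" if c: "(U, c) \<in> charts M" for U c
  proof (rule smooth_on_cong)
    show "open (c ` (U \<inter> (V \<inter> W)))"
      using chart_open_image[OF c] V(1) assms(1) by blast
    show "smooth_on (c ` (U \<inter> (V \<inter> W))) (f \<circ> inv_into U c)"
      by (rule smooth_on_subset[OF V(3)[OF c]]) auto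
  qed (use assms(3) chart_inv[OF c] in auto)
  then show ?thesis
    using V assms(1,2) unfolding smooth_at_def by (intro exI[of _ "V \<inter> W"]) auto
qed

lemma smooth_at_const:
  assumes "p \<in> topspace (mtop M)"
  shows "smooth_at M p (\<lambda>q. a)"
proof -
  obtain U c where c: "(U, c) \<in> charts M" "p \<in> U" using ex_chart[OF assms] .
  show ?thesis
    unfolding smooth_at_chart[OF c]
    using chart_image_open[OF c(1)] c(2) smooth_on_const[of "c ` U" a]
    by (intro exI[of _ "c ` U"]) (auto simp: o_def)
qed

lemma smooth_at_coord:
  assumes c: "(U, c) \<in> charts M" and p: "p \<in> U"
  shows "smooth_at M p (\<lambda>q. c q \<bullet> b)"
proof -
  have "smooth_on (c ` U) ((\<lambda>q. c q \<bullet> b) \<circ> inv_into U c)"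
    by (rule smooth_on_cong[OF chart_image_open[OF c] _ smooth_on_bounded_linear[OF chart_image_open[OF c] bounded_linear_inner_left[of b]]])
      (use chart_inv[OF c] in auto)
  then show ?thesis unfolding smooth_at_chart[OF c p] using chart_image_open[OF c] p by blast
qed

lemma smooth_at_add:
  assumes "smooth_at M p f" "smooth_at M p h"
  shows "smooth_at M p (\<lambda>q. f q + h q)"
proof -
  obtain U c where c: "(U, c) \<in> charts M" "p \<in> U" using ex_chart[OF smooth_at_topspace[OF assms(1)]] .
  obtain S where S: "open S" "c p \<in> S" "S \<subseteq> c ` U" "smooth_on S (f \<circ> inv_into U c)"
    using assms(1) unfolding smooth_at_chart[OF c] by blast
  obtain T where T: "open T" "c p \<in> T" "T \<subseteq> c ` U" "smooth_on T (h \<circ> inv_into U c)"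
    using assms(2) unfolding smooth_at_chart[OF c] by blast
  have "smooth_on (S \<inter> T) (\<lambda>x. (f \<circ> inv_into U c) x + (h \<circ> inv_into U c) x)"
    by (intro smooth_on_add smooth_on_subset[OF S(4)] smooth_on_subset[OF T(4)] open_Int S T) auto
  then show ?thesis unfolding smooth_at_chart[OF c] using S T by (intro exI[of _ "S \<inter> T"]) (auto simp: o_def)
qed

lemma smooth_at_mult:
  assumes "smooth_at M p f" "smooth_at M p h"
  shows "smooth_at M p (\<lambda>q. f q * h q)"
proof -
  obtain U c where c: "(U, c) \<in> charts M" "p \<in> U" using ex_chart[OF smooth_at_topspace[OF assms(1)]] .
  obtain S where S: "open S" "c p \<in> S" "S \<subseteq> c ` U" "smooth_on S (f \<circ> inv_into U c)"
    using assms(1) unfolding smooth_at_chart[OF c] by blast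
  obtain T where T: "open T" "c p \<in> T" "T \<subseteq> c ` U" "smooth_on T (h \<circ> inv_into U c)"
    using assms(2) unfolding smooth_at_chart[OF c] by blast
  have "smooth_on (S \<inter> T) (\<lambda>x. (f \<circ> inv_into U c) x * (h \<circ> inv_into U c) x)"
    by (intro smooth_on_mult smooth_on_subset[OF S(4)] smooth_on_subset[OF T(4)] open_Int S T) auto
  then show ?thesis unfolding smooth_at_chart[OF c] using S T by (intro exI[of _ "S \<inter> T"]) (auto simp: o_def)
qed


lemma smooth_at_compose_real:
  assumes "smooth_at M p f" and h: "open T" "f p \<in> T" "smooth_on T (h :: real \<Rightarrow> real)"
  shows "smooth_at M p (\<lambda>q. h (f q))"
proof -
  obtain U c where c: "(U, c) \<in> charts M" "p \<in> U" using ex_chart[OF smooth_at_topspace[OF assms(1)]] .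
  obtain S where S: "open S" "c p \<in> S" "S \<subseteq> c ` U" "smooth_on S (f \<circ> inv_into U c)"
    using assms(1) unfolding smooth_at_chart[OF c] by blast
  define R where "R = S \<inter> (f \<circ> inv_into U c) -` T"
  have "continuous_on S (f \<circ> inv_into U c)"
    using S(4) Ck_on.simps(1) unfolding smooth_on_def by blast
  then have R: "open R" unfolding R_def using S(1) h(1) by (rule continuous_open_preimage)
  have "smooth_on R (\<lambda>x. h ((f \<circ> inv_into U c) x))"
    by (rule smooth_on_compose[OF R h(1) _ _ h(3)]) (auto simp: R_def intro: smooth_on_subset[OF S(4), unfolded o_def])
  moreover have "c p \<in> R" using S c h chart_inv[OF c(1) c(2)] by (auto simp: R_def)
  ultimately show ?thesis unfolding smooth_at_chart[OF c] using S R
    by (intro exI[of _ R]) (auto simp: o_def R_def)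
qed

lemma smooth_at_sin: "smooth_at M p f \<Longrightarrow> smooth_at M p (\<lambda>q. sin (f q))"
  and smooth_at_cos: "smooth_at M p f \<Longrightarrow> smooth_at M p (\<lambda>q. cos (f q))"
  and smooth_at_arctan: "smooth_at M p f \<Longrightarrow> smooth_at M p (\<lambda>q. arctan (f q))"
  using smooth_at_compose_real[of p f UNIV] smooth_on_sin_cos smooth_on_arctan by auto

lemma smooth_at_divide:
  assumes "smooth_at M p f" "smooth_at M p h" "h p \<noteq> 0"
  shows "smooth_at M p (\<lambda>q. f q / h q)"
proof -
  have "smooth_on (- {0 :: real}) (\<lambda>x. inverse x)"
    by (rule smooth_on_inverse) (auto intro: smooth_on_bounded_linear)
  then have "smooth_at M p (\<lambda>q. inverse (h q))"
    using smooth_at_compose_real[OF assms(2), of "- {0}"] assms(3) by auto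
  then show ?thesis using smooth_at_mult[OF assms(1)] by (simp add: divide_inverse)
qed

lemma smooth_at_cmult: "smooth_at M p f \<Longrightarrow> smooth_at M p (\<lambda>q. a * f q)"
  by (intro smooth_at_mult smooth_at_const) (auto dest: smooth_at_topspace)

lemma smooth_at_minus: "smooth_at M p f \<Longrightarrow> smooth_at M p (\<lambda>q. - f q)"
  using smooth_at_cmult[of p f "- 1"] by simp

lemma smooth_at_diff: "smooth_at M p f \<Longrightarrow> smooth_at M p h \<Longrightarrow> smooth_at M p (\<lambda>q. f q - h q)"
  using smooth_at_add[OF _ smooth_at_minus] by fastforce

lemma smooth_at_sum:
  assumes "p \<in> topspace (mtop M)" "\<And>i. i \<in> I \<Longrightarrow> smooth_at M p (f i)"
  shows "smooth_at M p (\<lambda>q. \<Sum>i\<in>I. f i q)"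
  using assms(2)
  by (induction I rule: infinite_finite_induct) (auto intro: smooth_at_add smooth_at_const assms(1))

section \<open>Tangent spaces and coordinate expansion\<close>

abbreviation "T \<equiv> tangent_space M"

lemma subspace_tangent: "subspace (T p)"
  by (auto simp: subspace_def tangent_space_def scaleR_fun_apply algebra_simps)

lemma tangent_0 [simp]: "0 \<in> T p"
  and tangent_add [intro]: "v \<in> T p \<Longrightarrow> w \<in> T p \<Longrightarrow> v + w \<in> T p"
  and tangent_scaleR [intro]: "v \<in> T p \<Longrightarrow> a *\<^sub>R v \<in> T p"
  and tangent_diff [intro]: "v \<in> T p \<Longrightarrow> w \<in> T p \<Longrightarrow> v - w \<in> T p"
  and tangent_minus [intro]: "v \<in> T p \<Longrightarrow> - v \<in> T p"
  and tangent_sum [intro]: "(\<And>i. i \<in> I \<Longrightarrow> u i \<in> T p) \<Longrightarrow> (\<Sum>i\<in>I. u i) \<in> T p"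
  using subspace_tangent[of p]
  by (auto intro: subspace_0 subspace_add subspace_scale subspace_diff subspace_neg subspace_sum)

context
  fixes v p
  assumes v: "v \<in> T p"
begin

lemma tv_add: "smooth_at M p f \<Longrightarrow> smooth_at M p h \<Longrightarrow> v (\<lambda>q. f q + h q) = v f + v h"
  and tv_mult: "smooth_at M p f \<Longrightarrow> smooth_at M p h \<Longrightarrow> v (\<lambda>q. f q * h q) = f p * v h + h p * v f"
  and tv_cmult: "smooth_at M p f \<Longrightarrow> v (\<lambda>q. a * f q) = a * v f"
  and tv_not_smooth: "\<not> smooth_at M p f \<Longrightarrow> v f = 0"
  using v by (auto simp: tangent_space_def)

lemma tv_minus: "v (\<lambda>q. - f q) = - v f"
proof (cases "smooth_at M p f")
  case True
  then show ?thesis using tv_cmult[of f "- 1"] by simp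
next
  case False
  then have "\<not> smooth_at M p (\<lambda>q. - f q)" using smooth_at_minus[of p "\<lambda>q. - f q"] by auto
  then show ?thesis using False by (simp add: tv_not_smooth)
qed

lemma tv_diff: "smooth_at M p f \<Longrightarrow> smooth_at M p h \<Longrightarrow> v (\<lambda>q. f q - h q) = v f - v h"
  using tv_add[OF _ smooth_at_minus, of f h] tv_minus[of h] by simp

text \<open>The Leibniz rule for 1 * 1 makes \<open>v\<close> of the constant 1 equal to twice
  itself. At a point outside the space no function is smooth, and the value is 0 by
  convention.\<close>

lemma tv_const: "v (\<lambda>q. a) = 0"
proof (cases "p \<in> topspace (mtop M)")
  case True
  have "v (\<lambda>q. 1 * 1) = 1 * v (\<lambda>q. 1) + 1 * v (\<lambda>q. 1)"
    by (rule tv_mult) (auto intro: smooth_at_const True)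
  then show ?thesis using tv_cmult[OF smooth_at_const[OF True], of a 1] by simp
next
  case False
  then show ?thesis using smooth_at_topspace tv_not_smooth by blast
qed

text \<open>\<open>f - h\<close> is unchanged by multiplication with the indicator function of the complement of \<open>W\<close>,
  which is smooth at \<open>p\<close>; this replaces the usual bump function.\<close>

lemma tv_cong:
  assumes W: "openin (mtop M) W" "p \<in> W" "\<And>q. q \<in> W \<Longrightarrow> f q = h q"
  shows "v f = v h"
proof (cases "smooth_at M p f")
  case True
  have h: "smooth_at M p h" using smooth_at_cong[OF W True] .
  have p: "p \<in> topspace (mtop M)" using True by (rule smooth_at_topspace)
  define d where "d q = f q - h q" for q
  define e where "e q = (if q \<in> W then 0 else 1 :: real)" for q
  have d: "smooth_at M p d" unfolding d_def by (intro smooth_at_diff True h)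
  have e: "smooth_at M p e"
    by (rule smooth_at_cong[OF W(1,2) _ smooth_at_const[OF p, of 0]]) (simp add: e_def)
  have "d = (\<lambda>q. e q * d q)" using W(3) by (auto simp: d_def e_def)
  then have "v d = v (\<lambda>q. e q * d q)" by simp
  also have "\<dots> = 0" using tv_mult[OF e d] W by (simp add: e_def d_def)
  finally have "v d = 0" .
  then show ?thesis using tv_diff[OF True h] by (simp add: d_def[abs_def])
next
  case False
  then have "\<not> smooth_at M p h" using smooth_at_cong[OF W(1,2), of h f] W(3) by auto
  then show ?thesis using False by (simp add: tv_not_smooth)
qed

lemma tv_sum:
  assumes "p \<in> topspace (mtop M)" "\<And>i. i \<in> I \<Longrightarrow> smooth_at M p (f i)"
  shows "v (\<lambda>q. \<Sum>i\<in>I. f i q) = (\<Sum>i\<in>I. v (f i))"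
  using assms(2)
proof (induction I rule: infinite_finite_induct)
  case (insert i I)
  then show ?case using tv_add[of "f i" "\<lambda>q. \<Sum>i\<in>I. f i q"] smooth_at_sum[OF assms(1), of I f] by auto
qed (auto simp: tv_const)

end

lemma tangent_eqI:
  assumes "v \<in> T p" "w \<in> T p" "\<And>f. smooth_at M p f \<Longrightarrow> v f = w f"
  shows "v = w"
proof
  fix f
  show "v f = w f"
    using assms tv_not_smooth[of v p f] tv_not_smooth[of w p f] by (cases "smooth_at M p f") auto
qed

context
  fixes U c
  assumes chart: "(U, c) \<in> charts M"
begin

lemma smooth_at_has_derivative:
  assumes "p \<in> U" "smooth_at M p f"
  shows "(f \<circ> inv_into U c has_derivative frechet_derivative (f \<circ> inv_into U c) (at (c p))) (at (c p))"
  using assms smooth_on_has_derivative unfolding smooth_at_chart[OF chart assms(1)] by blast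

lemma cvec_smooth:
  assumes p: "p \<in> U" and f: "smooth_at M p f"
  shows "smooth_at M p (\<lambda>r. cvec M U c w r f)"
proof -
  obtain V where V: "openin (mtop M) V" "p \<in> V" "\<And>q. q \<in> V \<Longrightarrow> smooth_at M q f"
    using smooth_at_open[OF f] by blast
  obtain S where S: "open S" "c p \<in> S" "S \<subseteq> c ` U" "smooth_on S (f \<circ> inv_into U c)"
    using f unfolding smooth_at_chart[OF chart p] by blast
  let ?R = "S \<inter> c ` (U \<inter> V)"
  have R: "open ?R" using S(1) chart_open_image[OF chart V(1)] by blast
  have "smooth_on ?R (\<lambda>x. frechet_derivative (f \<circ> inv_into U c) (at x) w)"
    by (rule smooth_on_subset[OF smooth_on_frechet_derivative[OF S(4)]]) auto
  then have "smooth_on ?R ((\<lambda>r. cvec M U c w r f) \<circ> inv_into U c)"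
    by (rule smooth_on_cong[OF R, rotated]) (use V(3) chart_inv[OF chart] in \<open>auto simp: cvec_def\<close>)
  then show ?thesis unfolding smooth_at_chart[OF chart p] using R S V p by (intro exI[of _ ?R]) auto
qed

lemma cvec_tangent:
  assumes p: "p \<in> U"
  shows "cvec M U c w p \<in> T p"
proof -
  let ?i = "inv_into U c"
  have *: "frechet_derivative ((\<lambda>q. f q + h q) \<circ> ?i) (at (c p)) w
      = frechet_derivative (f \<circ> ?i) (at (c p)) w + frechet_derivative (h \<circ> ?i) (at (c p)) w"
    "frechet_derivative ((\<lambda>q. f q * h q) \<circ> ?i) (at (c p)) w
      = f p * frechet_derivative (h \<circ> ?i) (at (c p)) w + h p * frechet_derivative (f \<circ> ?i) (at (c p)) w"
    if fh: "smooth_at M p f" "smooth_at M p h" for f h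
  proof -
    note d = smooth_at_has_derivative[OF p fh(1)] smooth_at_has_derivative[OF p fh(2)]
    show "frechet_derivative ((\<lambda>q. f q + h q) \<circ> ?i) (at (c p)) w
      = frechet_derivative (f \<circ> ?i) (at (c p)) w + frechet_derivative (h \<circ> ?i) (at (c p)) w"
      using frechet_derivative_at[OF has_derivative_add[OF d]] by (simp add: o_def fun_eq_iff)
    show "frechet_derivative ((\<lambda>q. f q * h q) \<circ> ?i) (at (c p)) w
      = f p * frechet_derivative (h \<circ> ?i) (at (c p)) w + h p * frechet_derivative (f \<circ> ?i) (at (c p)) w"
      using frechet_derivative_at[OF has_derivative_mult[OF d]] chart_inv[OF chart p]
      by (simp add: o_def fun_eq_iff algebra_simps)
  qed
  have "frechet_derivative ((\<lambda>q. a * f q) \<circ> ?i) (at (c p)) w = a * frechet_derivative (f \<circ> ?i) (at (c p)) w"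
    if "smooth_at M p f" for a f
    using frechet_derivative_at[OF has_derivative_mult_right[OF smooth_at_has_derivative[OF p that], of a]]
    by (simp add: o_def fun_eq_iff)
  with * show ?thesis
    by (auto simp: tangent_space_def cvec_def smooth_at_add smooth_at_mult smooth_at_cmult)
qed

lemma linear_cvec:
  assumes p: "p \<in> U"
  shows "linear (\<lambda>w. cvec M U c w p)"
proof -
  have "linear (frechet_derivative (f \<circ> inv_into U c) (at (c p)))" if "smooth_at M p f" for f
    using smooth_at_has_derivative[OF p that] has_derivative_linear by blast
  then show ?thesis
    by (intro linearI) (auto simp: cvec_def fun_eq_iff scaleR_fun_apply linear_add linear_cmul)
qed

lemma cvec_coord:
  assumes p: "p \<in> U"
  shows "cvec M U c w p (\<lambda>q. c q \<bullet> b) = w \<bullet> b"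
proof -
  have "((\<lambda>q. c q \<bullet> b) \<circ> inv_into U c has_derivative (\<lambda>x. x \<bullet> b)) (at (c p))"
    by (rule has_derivative_transform_within_open[OF bounded_linear_imp_has_derivative[OF bounded_linear_inner_left]
          chart_image_open[OF chart]])
      (use p chart_inv[OF chart] in auto)
  from fun_cong[OF frechet_derivative_at[OF this], of w] show ?thesis
    using smooth_at_coord[OF chart p] by (simp add: cvec_def)
qed

lemma vcomp_cvec [simp]: "p \<in> U \<Longrightarrow> vcomp c (cvec M U c w p) = w"
  by (simp add: vcomp_def cvec_coord euclidean_representation)

text \<open>A derivation is determined by its values on the coordinates: applied to the Hadamard
  expansion, it sees only the first-order coefficients at \<open>p\<close>.\<close>

lemma cvec_vcomp:
  assumes p: "p \<in> U" and v: "v \<in> T p"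
  shows "cvec M U c (vcomp c v) p = v"
proof (rule tangent_eqI[OF cvec_tangent[OF p] v])
  fix f assume f: "smooth_at M p f"
  have pt: "p \<in> topspace (mtop M)" using f by (rule smooth_at_topspace)
  obtain S0 where S0: "open S0" "c p \<in> S0" "S0 \<subseteq> c ` U" "smooth_on S0 (f \<circ> inv_into U c)"
    using f unfolding smooth_at_chart[OF chart p] by blast
  obtain e where e: "e > 0" "ball (c p) e \<subseteq> S0" using S0(1,2) openE by blast
  \<comment> \<open>Hadamard's lemma needs a convex domain, hence the shrinking to a ball.\<close>
  define S where "S = ball (c p) e"
  have S: "open S" "convex S" "c p \<in> S" "smooth_on S (f \<circ> inv_into U c)"
    using e smooth_on_subset[OF S0(4)] by (auto simp: S_def)
  obtain h where h: "\<And>b. smooth_on S (h b)"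
    "\<And>b. h b (c p) = frechet_derivative (f \<circ> inv_into U c) (at (c p)) b"
    "\<And>x. x \<in> S \<Longrightarrow> (f \<circ> inv_into U c) x = (f \<circ> inv_into U c) (c p) + (\<Sum>b\<in>Basis. ((x - c p) \<bullet> b) * h b x)"
    using smooth_on_hadamard[OF S] by blast
  define k where "k b q = h b (c q)" for b q
  \<comment> \<open>The shifted coordinates vanish at \<open>p\<close>, so in the Leibniz rule for
    \<open>l b * k b\<close> only the derivative of \<open>l b\<close> survives.\<close>
  define l where "l b q = c q \<bullet> b - c p \<bullet> b" for b q
  have k: "smooth_at M p (k b)" for b
    unfolding smooth_at_chart[OF chart p]
  proof (intro exI conjI)
    show "smooth_on S (k b \<circ> inv_into U c)"
      by (rule smooth_on_cong[OF S(1) _ h(1)[of b]])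
        (use e S0(3) chart_inv[OF chart] in \<open>auto simp: S_def k_def\<close>, metis chart_inv[OF chart] imageE mem_ball subsetD)
  qed (use S e S0 in \<open>auto simp: S_def\<close>)
  have l: "smooth_at M p (l b)" for b
    unfolding l_def by (intro smooth_at_diff smooth_at_coord[OF chart p] smooth_at_const pt)
  have vl: "v (l b) = v (\<lambda>q. c q \<bullet> b)" for b
    unfolding l_def using tv_diff[OF v smooth_at_coord[OF chart p] smooth_at_const[OF pt]] tv_const[OF v] by simp
  have "v f = v (\<lambda>q. f p + (\<Sum>b\<in>Basis. l b q * k b q))"
  proof (rule tv_cong[OF v chart_open_preimage[OF chart S(1)]])
    fix q assume "q \<in> {q \<in> U. c q \<in> S}"
    then show "f q = f p + (\<Sum>b\<in>Basis. l b q * k b q)"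
      using h(3)[of "c q"] chart_inv[OF chart] p by (simp add: l_def k_def inner_diff_left)
  qed (use p S in auto)
  also have "\<dots> = (\<Sum>b\<in>Basis. v (\<lambda>q. l b q * k b q))"
    using tv_add[OF v smooth_at_const[OF pt] smooth_at_sum[OF pt smooth_at_mult[OF l k]],
        of "f p" "\<lambda>b. b" "\<lambda>b. b" Basis] tv_const[OF v, of "f p"]
      tv_sum[OF v pt smooth_at_mult[OF l k], of "\<lambda>b. b" "\<lambda>b. b" Basis] by simp
  also have "\<dots> = (\<Sum>b\<in>Basis. v (\<lambda>q. c q \<bullet> b) * frechet_derivative (f \<circ> inv_into U c) (at (c p)) b)"
    using tv_mult[OF v l k] h(2) vl by (intro sum.cong) (auto simp: l_def k_def)
  also have "\<dots> = frechet_derivative (f \<circ> inv_into U c) (at (c p)) (vcomp c v)"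
  proof -
    have "linear (frechet_derivative (f \<circ> inv_into U c) (at (c p)))"
      using smooth_at_has_derivative[OF p f] has_derivative_linear by blast
    then show ?thesis by (simp add: vcomp_def linear_sum linear_cmul)
  qed
  finally show "cvec M U c (vcomp c v) p f = v f" using f by (simp add: cvec_def)
qed

lemma tangent_expand:
  assumes p: "p \<in> U" and v: "v \<in> T p"
  shows "v = (\<Sum>b\<in>Basis. v (\<lambda>q. c q \<bullet> b) *\<^sub>R cvec M U c b p)"
  using linear_basis_expansion[OF linear_cvec[OF p], of "vcomp c v"] cvec_vcomp[OF p v]
  by (simp add: vcomp_inner)

text \<open>Derivations are known algebraically only; the chain rule is obtained from the chart
  representation. It serves to differentiate the angle \<open>t\<close>.\<close>

lemma tv_chain_real:
  assumes p: "p \<in> U" and v: "v \<in> T p" and f: "smooth_at M p f"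
    and h: "open S" "f p \<in> S" "smooth_on S h" "(h has_real_derivative h') (at (f p))"
  shows "v (\<lambda>q. h (f q)) = h' * v f"
proof -
  note s = smooth_at_compose_real[OF f h(1-3)]
  have "((\<lambda>x. h ((f \<circ> inv_into U c) x)) has_derivative
      (\<lambda>w. h' * frechet_derivative (f \<circ> inv_into U c) (at (c p)) w)) (at (c p))"
    using has_derivative_compose[OF smooth_at_has_derivative[OF p f], of h "(*) h'"]
      h(4) chart_inv[OF chart p] by (simp add: has_field_derivative_def)
  then have "frechet_derivative ((\<lambda>q. h (f q)) \<circ> inv_into U c) (at (c p)) (vcomp c v)
      = h' * frechet_derivative (f \<circ> inv_into U c) (at (c p)) (vcomp c v)"
    using frechet_derivative_at by (fastforce simp: o_def fun_eq_iff)
  then have "cvec M U c (vcomp c v) p (\<lambda>q. h (f q)) = h' * cvec M U c (vcomp c v) p f"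
    using s f by (simp add: cvec_def)
  then show ?thesis using cvec_vcomp[OF p v] by simp
qed

end

end

section \<open>Vector fields and connections\<close>

text \<open>Tensoriality at \<open>p\<close> is required for fields on arbitrarily small neighbourhoods. Multiplying
  by the indicator function of an open set then shows locality without bump functions.\<close>

definition tensorial :: "('a, 'e::euclidean_space) mfd \<Rightarrow> 'a \<Rightarrow> ('a vfield \<Rightarrow> 'v::real_vector) \<Rightarrow> bool" where
  "tensorial M p B \<longleftrightarrow>
     (\<forall>W X Y. openin (mtop M) W \<and> p \<in> W \<and> X \<in> smooth_vfields M W \<and> Y \<in> smooth_vfields M W \<longrightarrow>
        B (\<lambda>q. X q + Y q) = B X + B Y) \<and>
     (\<forall>W X f. openin (mtop M) W \<and> p \<in> W \<and> X \<in> smooth_vfields M W \<and> (\<forall>q\<in>W. smooth_at M q f) \<longrightarrow>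
        B (\<lambda>q. f q *\<^sub>R X q) = f p *\<^sub>R B X)"

context manifold
begin

abbreviation "VF \<equiv> smooth_vfields M"
abbreviation "SF V f \<equiv> (\<forall>q\<in>V. smooth_at M q f)"

lemma vf_tangent: "X \<in> VF V \<Longrightarrow> q \<in> V \<Longrightarrow> X q \<in> T q"
  and vf_smooth: "X \<in> VF V \<Longrightarrow> q \<in> V \<Longrightarrow> smooth_at M q f \<Longrightarrow> smooth_at M q (\<lambda>r. X r f)"
  and vf_subset: "X \<in> VF V \<Longrightarrow> W \<subseteq> V \<Longrightarrow> X \<in> VF W"
  by (auto simp: smooth_vfields_def)

lemma vf_cong:
  assumes "openin (mtop M) V" "\<And>q. q \<in> V \<Longrightarrow> X q = Y q" "X \<in> VF V"
  shows "Y \<in> VF V"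
  unfolding smooth_vfields_def
proof (intro CollectI ballI conjI allI impI)
  fix q f assume q: "q \<in> V" and f: "smooth_at M q f"
  show "smooth_at M q (\<lambda>r. Y r f)"
    by (rule smooth_at_cong[OF assms(1) q _ vf_smooth[OF assms(3) q f]]) (simp add: assms(2))
qed (use assms vf_tangent in force)

lemma vf_add: "X \<in> VF V \<Longrightarrow> Y \<in> VF V \<Longrightarrow> (\<lambda>q. X q + Y q) \<in> VF V"
  by (auto simp: smooth_vfields_def intro!: smooth_at_add)

lemma vf_scale: "SF V f \<Longrightarrow> X \<in> VF V \<Longrightarrow> (\<lambda>q. f q *\<^sub>R X q) \<in> VF V"
  by (auto simp: smooth_vfields_def scaleR_fun_apply intro!: smooth_at_mult)

lemma vf_diff: "X \<in> VF V \<Longrightarrow> Y \<in> VF V \<Longrightarrow> (\<lambda>q. X q - Y q) \<in> VF V"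
  by (auto simp: smooth_vfields_def intro!: smooth_at_diff)

lemma vf_zero: "V \<subseteq> topspace (mtop M) \<Longrightarrow> (\<lambda>q. 0) \<in> VF V"
  by (auto simp: smooth_vfields_def intro!: smooth_at_const)

lemma vf_sum:
  assumes "V \<subseteq> topspace (mtop M)" "\<And>i. i \<in> I \<Longrightarrow> X i \<in> VF V"
  shows "(\<lambda>q. \<Sum>i\<in>I. X i q) \<in> VF V"
  using assms(2)
  by (induction I rule: infinite_finite_induct) (auto intro: vf_zero[OF assms(1)] vf_add)

lemma vf_cvec: "(U, c) \<in> charts M \<Longrightarrow> cvec M U c w \<in> VF U"
  by (auto simp: smooth_vfields_def intro: cvec_tangent cvec_smooth)

text \<open>A second-order operator X(Yf) violates the Leibniz rule by
  \<open>X f * Y h + X h * Y f\<close>. This is symmetric in the two fields and cancels in the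
  commutator.\<close>

lemma vf_bracket:
  assumes V: "openin (mtop M) V" and X: "X \<in> VF V" and Y: "Y \<in> VF V"
  shows "lie_bracket M X Y \<in> VF V"
proof -
  have XY: "X q (\<lambda>r. Y r (\<lambda>s. f s + h s)) = X q (\<lambda>r. Y r f) + X q (\<lambda>r. Y r h)"
    "X q (\<lambda>r. Y r (\<lambda>s. f s * h s)) = f q * X q (\<lambda>r. Y r h) + Y q h * X q f + h q * X q (\<lambda>r. Y r f) + Y q f * X q h"
    "X q (\<lambda>r. Y r (\<lambda>s. a * f s)) = a * X q (\<lambda>r. Y r f)"
    if q: "q \<in> V" and X: "X \<in> VF V" and Y: "Y \<in> VF V" and f: "smooth_at M q f" and h: "smooth_at M q h"
    for q X Y f h a
  proof -
    note Xq = vf_tangent[OF X q]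
    obtain F where F: "openin (mtop M) F" "q \<in> F" "\<And>r. r \<in> F \<Longrightarrow> smooth_at M r f" using smooth_at_open[OF f] by blast
    obtain H where H: "openin (mtop M) H" "q \<in> H" "\<And>r. r \<in> H \<Longrightarrow> smooth_at M r h" using smooth_at_open[OF h] by blast
    have W: "openin (mtop M) (V \<inter> (F \<inter> H))" "q \<in> V \<inter> (F \<inter> H)" using V F H q by auto
    note Yf = vf_smooth[OF Y q f] and Yh = vf_smooth[OF Y q h]
    have "X q (\<lambda>r. Y r (\<lambda>s. f s + h s)) = X q (\<lambda>r. Y r f + Y r h)"
      by (rule tv_cong[OF Xq W]) (use F H in \<open>auto intro!: tv_add vf_tangent[OF Y]\<close>)
    then show "X q (\<lambda>r. Y r (\<lambda>s. f s + h s)) = X q (\<lambda>r. Y r f) + X q (\<lambda>r. Y r h)"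
      using tv_add[OF Xq Yf Yh] by simp
    have "X q (\<lambda>r. Y r (\<lambda>s. f s * h s)) = X q (\<lambda>r. f r * Y r h + h r * Y r f)"
      by (rule tv_cong[OF Xq W]) (use F H in \<open>auto intro!: tv_mult vf_tangent[OF Y]\<close>)
    then show "X q (\<lambda>r. Y r (\<lambda>s. f s * h s)) = f q * X q (\<lambda>r. Y r h) + Y q h * X q f + h q * X q (\<lambda>r. Y r f) + Y q f * X q h"
      using tv_add[OF Xq smooth_at_mult[OF f Yh] smooth_at_mult[OF h Yf]]
        tv_mult[OF Xq f Yh] tv_mult[OF Xq h Yf] by simp
    have "X q (\<lambda>r. Y r (\<lambda>s. a * f s)) = X q (\<lambda>r. a * Y r f)"
      by (rule tv_cong[OF Xq W]) (use F H in \<open>auto intro!: tv_cmult vf_tangent[OF Y]\<close>)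
    then show "X q (\<lambda>r. Y r (\<lambda>s. a * f s)) = a * X q (\<lambda>r. Y r f)"
      using tv_cmult[OF Xq Yf] by simp
  qed
  show ?thesis
    unfolding smooth_vfields_def
  proof (intro CollectI ballI conjI allI impI)
    fix q assume q: "q \<in> V"
    show "lie_bracket M X Y q \<in> T q"
      using XY[OF q X Y] XY[OF q Y X]
      by (auto simp: tangent_space_def lie_bracket_def smooth_at_add smooth_at_mult smooth_at_cmult algebra_simps)
    fix f assume f: "smooth_at M q f"
    obtain F where F: "openin (mtop M) F" "q \<in> F" "\<And>r. r \<in> F \<Longrightarrow> smooth_at M r f" using smooth_at_open[OF f] by blast
    show "smooth_at M q (\<lambda>r. lie_bracket M X Y r f)"
      by (rule smooth_at_cong[OF F(1,2) _ smooth_at_diff[OF vf_smooth[OF X q vf_smooth[OF Y q f]] vf_smooth[OF Y q vf_smooth[OF X q f]]]])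
        (simp add: lie_bracket_def F(3))
  qed
qed

lemma lie_bracket_apply: "smooth_at M q f \<Longrightarrow> lie_bracket M X Y q f = X q (\<lambda>r. Y r f) - Y q (\<lambda>r. X r f)"
  by (simp add: lie_bracket_def)

lemma lie_bracket_swap: "lie_bracket M Y X q = - lie_bracket M X Y q"
  by (auto simp: lie_bracket_def)

lemma lie_bracket_scale:
  assumes V: "openin (mtop M) V" "q \<in> V" and X: "X \<in> VF V" and Y: "Y \<in> VF V" and f: "SF V f"
  shows "lie_bracket M (\<lambda>r. f r *\<^sub>R X r) Y q = f q *\<^sub>R lie_bracket M X Y q - Y q f *\<^sub>R X q"
proof (rule tangent_eqI)
  show "lie_bracket M (\<lambda>r. f r *\<^sub>R X r) Y q \<in> T q"
    by (rule vf_tangent[OF vf_bracket[OF V(1) vf_scale[OF f X] Y] V(2)])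
  show "f q *\<^sub>R lie_bracket M X Y q - Y q f *\<^sub>R X q \<in> T q"
    using vf_tangent[OF vf_bracket[OF V(1) X Y] V(2)] vf_tangent[OF X V(2)] by auto
  fix h assume h: "smooth_at M q h"
  show "lie_bracket M (\<lambda>r. f r *\<^sub>R X r) Y q h = (f q *\<^sub>R lie_bracket M X Y q - Y q f *\<^sub>R X q) h"
    using tv_mult[OF vf_tangent[OF Y V(2)], of f "\<lambda>r. X r h"] f V(2) vf_smooth[OF X V(2) h]
    by (simp add: lie_bracket_apply[OF h] scaleR_fun_apply algebra_simps)
qed

text \<open>A coordinate field maps each coordinate function to a constant, so both second
  derivatives of the coordinate functions vanish, and a tangent vector is determined by its values
  on them.\<close>

lemma lie_bracket_cvec:
  assumes c: "(U, c) \<in> charts M" "q \<in> U"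
  shows "lie_bracket M (cvec M U c v) (cvec M U c w) q = 0"
proof -
  let ?E = "cvec M U c"
  have "vcomp c (lie_bracket M (?E v) (?E w) q) = 0"
  proof -
    have "lie_bracket M (?E v) (?E w) q (\<lambda>r. c r \<bullet> b) = 0" for b
    proof -
      have const: "?E x q (\<lambda>r. ?E y r (\<lambda>s. c s \<bullet> b)) = 0" for x y
        using tv_cong[OF cvec_tangent[OF c] chart_open[OF c(1)] c(2), of "\<lambda>r. ?E y r (\<lambda>s. c s \<bullet> b)" "\<lambda>r. y \<bullet> b"]
          cvec_coord[OF c(1)] tv_const[OF cvec_tangent[OF c]] by simp
      then show ?thesis by (simp add: lie_bracket_apply[OF smooth_at_coord[OF c]])
    qed
    then show ?thesis by (simp add: vcomp_def)
  qed
  then show ?thesis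
    using cvec_vcomp[OF c vf_tangent[OF vf_bracket[OF chart_open[OF c(1)] vf_cvec[OF c(1)] vf_cvec[OF c(1)]] c(2)]]
      linear_0[OF linear_cvec[OF c]] by metis
qed

lemma vf_expand:
  assumes c: "(U, c) \<in> charts M" "q \<in> U" "q \<in> V" and X: "X \<in> VF V"
  shows "X q = (\<Sum>b\<in>Basis. X q (\<lambda>r. c r \<bullet> b) *\<^sub>R cvec M U c b q)"
  using tangent_expand[OF c(1,2) vf_tangent[OF X c(3)]] .

text \<open>\<open>vext\<close> is a Hilbert choice; a coordinate field with constant coefficients
  witnesses that its defining property is satisfiable.\<close>

lemma vext:
  assumes p: "p \<in> topspace (mtop M)" and x: "x \<in> T p"
  shows vext_eq: "vext M p x p = x"
    and ex_vext: "\<exists>V. openin (mtop M) V \<and> p \<in> V \<and> vext M p x \<in> VF V"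
proof -
  obtain U c where c: "(U, c) \<in> charts M" "p \<in> U" using ex_chart[OF p] .
  have "cvec M U c (vcomp c x) p = x \<and> (\<exists>V. openin (mtop M) V \<and> p \<in> V \<and> cvec M U c (vcomp c x) \<in> VF V)"
    using cvec_vcomp[OF c x] chart_open[OF c(1)] vf_cvec[OF c(1)] c(2) by blast
  then have "vext M p x p = x \<and> (\<exists>V. openin (mtop M) V \<and> p \<in> V \<and> vext M p x \<in> VF V)"
    unfolding vext_def
    by (rule someI[of "\<lambda>X. X p = x \<and> (\<exists>V. openin (mtop M) V \<and> p \<in> V \<and> X \<in> VF V)"])
  then show "vext M p x p = x" "\<exists>V. openin (mtop M) V \<and> p \<in> V \<and> vext M p x \<in> VF V"
    by (rule conjunct1, rule conjunct2)
qed

context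
  fixes B :: "'a vfield \<Rightarrow> 'v::real_vector" and p
  assumes B: "tensorial M p B"
begin

lemma tensorial_add:
  "openin (mtop M) W \<Longrightarrow> p \<in> W \<Longrightarrow> X \<in> VF W \<Longrightarrow> Y \<in> VF W \<Longrightarrow> B (\<lambda>q. X q + Y q) = B X + B Y"
  and tensorial_scale:
  "openin (mtop M) W \<Longrightarrow> p \<in> W \<Longrightarrow> X \<in> VF W \<Longrightarrow> SF W f \<Longrightarrow> B (\<lambda>q. f q *\<^sub>R X q) = f p *\<^sub>R B X"
  using B by (auto simp: tensorial_def)

lemma tensorial_zero:
  assumes W: "openin (mtop M) W" "p \<in> W"
  shows "B (\<lambda>q. 0) = 0"
  using tensorial_add[OF W vf_zero[OF openin_subset[OF W(1)]] vf_zero[OF openin_subset[OF W(1)]]] by simp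

lemma tensorial_sum:
  assumes W: "openin (mtop M) W" "p \<in> W" and X: "\<And>i. i \<in> I \<Longrightarrow> X i \<in> VF W"
  shows "B (\<lambda>q. \<Sum>i\<in>I. X i q) = (\<Sum>i\<in>I. B (X i))"
  using X
proof (induction I rule: infinite_finite_induct)
  case (insert i I)
  have X: "X i \<in> VF W" "\<And>j. j \<in> I \<Longrightarrow> X j \<in> VF W" using insert.prems by auto
  show ?case
    using tensorial_add[OF W X(1) vf_sum[OF openin_subset[OF W(1)], of I X, OF X(2)]] insert.IH[OF X(2)]
    by (simp only: sum.insert[OF insert.hyps] simp_thms)
qed (use tensorial_zero[OF W] in auto)

lemma tensorial_local:
  assumes W: "openin (mtop M) W" "p \<in> W" and X: "X \<in> VF W" and eq: "\<And>q. q \<in> W \<Longrightarrow> X q = Y q"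
  shows "B X = B Y"
proof -
  define f where "f q = (if q \<in> W then 1 else 0 :: real)" for q
  have f: "SF W f"
  proof
    fix q assume q: "q \<in> W"
    show "smooth_at M q f"
      by (rule smooth_at_cong[OF W(1) q _ smooth_at_const[of q 1]])
        (use openin_subset[OF W(1)] q in \<open>auto simp: f_def\<close>)
  qed
  have "(\<lambda>q. f q *\<^sub>R X q) = (\<lambda>q. f q *\<^sub>R Y q)" using eq by (auto simp: f_def)
  then show ?thesis
    using tensorial_scale[OF W X f] tensorial_scale[OF W vf_cong[OF W(1) eq X] f] W(2) by (simp add: f_def)
qed

lemma tensorial_expand:
  assumes c: "(U, c) \<in> charts M" "p \<in> U" and V: "openin (mtop M) V" "p \<in> V" and X: "X \<in> VF V"
  shows "B X = (\<Sum>b\<in>Basis. X p (\<lambda>r. c r \<bullet> b) *\<^sub>R B (cvec M U c b))"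
proof -
  have W: "openin (mtop M) (U \<inter> V)" "p \<in> U \<inter> V" using chart_open[OF c(1)] c V by auto
  have s: "SF (U \<inter> V) (\<lambda>q. X q (\<lambda>r. c r \<bullet> b))" for b
    using vf_smooth[OF X] smooth_at_coord[OF c(1)] by blast
  note e = vf_subset[OF vf_cvec[OF c(1)], of "U \<inter> V"]
  have "B X = B (\<lambda>q. \<Sum>b\<in>Basis. X q (\<lambda>r. c r \<bullet> b) *\<^sub>R cvec M U c b q)"
    by (rule tensorial_local[OF W vf_subset[OF X]]) (auto intro!: vf_expand[OF c(1) _ _ X])
  also have "\<dots> = (\<Sum>b\<in>Basis. B (\<lambda>q. X q (\<lambda>r. c r \<bullet> b) *\<^sub>R cvec M U c b q))"
    by (rule tensorial_sum[OF W vf_scale[OF s e]]) auto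
  also have "\<dots> = (\<Sum>b\<in>Basis. X p (\<lambda>r. c r \<bullet> b) *\<^sub>R B (cvec M U c b))"
    using tensorial_scale[OF W e s] by simp
  finally show ?thesis .
qed

text \<open>The coordinate expansion of a tensorial expression contains the field only through its
  value at \<open>p\<close>.\<close>

lemma tensorial_cong:
  assumes V: "openin (mtop M) V" "p \<in> V" "X \<in> VF V" and W: "openin (mtop M) W" "p \<in> W" "Y \<in> VF W"
    and eq: "X p = Y p"
  shows "B X = B Y"
proof -
  obtain U c where c: "(U, c) \<in> charts M" "p \<in> U" using ex_chart openin_subset[OF V(1)] V(2) by blast
  show ?thesis unfolding tensorial_expand[OF c V] tensorial_expand[OF c W] eq ..
qed

lemma tensorial_cvec:
  assumes c: "(U, c) \<in> charts M" "p \<in> U" and V: "openin (mtop M) V" "p \<in> V" "X \<in> VF V"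
  shows "B (cvec M U c (vcomp c (X p))) = B X"
  by (rule tensorial_cong[OF chart_open[OF c(1)] c(2) vf_cvec[OF c(1)] V])
    (rule cvec_vcomp[OF c vf_tangent[OF V(3,2)]])

lemma tensorial_linear:
  assumes c: "(U, c) \<in> charts M" "p \<in> U"
  shows "linear (\<lambda>w. B (cvec M U c w))"
proof -
  have "(\<lambda>w. B (cvec M U c w)) = (\<lambda>w. \<Sum>b\<in>Basis. (w \<bullet> b) *\<^sub>R B (cvec M U c b))"
    using tensorial_expand[OF c chart_open[OF c(1)] c(2) vf_cvec[OF c(1)], unfolded cvec_coord[OF c]] by (rule ext)
  moreover have "linear (\<lambda>w. \<Sum>b\<in>Basis. (w \<bullet> b) *\<^sub>R B (cvec M U c b))"
    by (intro linearI) (simp_all add: inner_add_left scaleR_left_distrib sum.distrib scaleR_sum_right)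
  ultimately show ?thesis by (rule ssubst[where P = linear])
qed

end

end

section \<open>Affine connections and their curvature\<close>

locale connection = manifold M for M :: "('a, 'e::euclidean_space) mfd" +
  fixes D :: "'a connection"
  assumes affine_connection: "affine_connection M D"
begin

context
  fixes V X Y
  assumes V: "openin (mtop M) V" and X: "X \<in> VF V" and Y: "Y \<in> VF V"
begin

lemma conn_vf: "D X Y \<in> VF V"
  and conn_add1: "Z \<in> VF V \<Longrightarrow> p \<in> V \<Longrightarrow> D (\<lambda>q. X q + Z q) Y p = D X Y p + D Z Y p"
  and conn_add2: "Z \<in> VF V \<Longrightarrow> p \<in> V \<Longrightarrow> D X (\<lambda>q. Y q + Z q) p = D X Y p + D X Z p"
  and conn_scale1: "SF V f \<Longrightarrow> p \<in> V \<Longrightarrow> D (\<lambda>q. f q *\<^sub>R X q) Y p = f p *\<^sub>R D X Y p"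
  and conn_scale2: "SF V f \<Longrightarrow> p \<in> V \<Longrightarrow> D X (\<lambda>q. f q *\<^sub>R Y q) p = X p f *\<^sub>R Y p + f p *\<^sub>R D X Y p"
  using affine_connection[unfolded affine_connection_def tscale_eq_scaleR, rule_format, of V X Y] V X Y
  by blast+

end

lemma tensorial_conn:
  assumes V: "openin (mtop M) V" "p \<in> V" and Y: "Y \<in> VF V"
  shows "tensorial M p (\<lambda>X. D X Y p)"
  unfolding tensorial_def
proof (intro conjI allI impI; elim conjE)
  fix W X Z assume W: "openin (mtop M) W" "p \<in> W" "X \<in> VF W" "Z \<in> VF W"
  show "D (\<lambda>q. X q + Z q) Y p = D X Y p + D Z Y p"
    by (rule conn_add1[of "V \<inter> W"]) (use V W Y vf_subset in auto)
next
  fix W X f assume W: "openin (mtop M) W" "p \<in> W" "X \<in> VF W" "SF W f"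
  show "D (\<lambda>q. f q *\<^sub>R X q) Y p = f p *\<^sub>R D X Y p"
    by (rule conn_scale1[of "V \<inter> W"]) (use V W Y vf_subset in auto)
qed

lemma conn_cong1:
  assumes "openin (mtop M) V" "p \<in> V" "X \<in> VF V" "Y \<in> VF V" "Z \<in> VF V" "X p = Z p"
  shows "D X Y p = D Z Y p"
  by (rule tensorial_cong[OF tensorial_conn[OF assms(1,2,4)] assms(1,2,3) assms(1,2,5,6)])

text \<open>In the differentiated argument only locality is available. Multiplying both fields by
  the indicator function of \<open>V\<close> makes them equal as functions, and the indicator
  function has derivative 0 inside \<open>V\<close>.\<close>

lemma conn_cong2:
  assumes V: "openin (mtop M) V" "p \<in> V" and X: "X \<in> VF V" and Y: "Y \<in> VF V"
    and eq: "\<And>q. q \<in> V \<Longrightarrow> Y q = Z q"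
  shows "D X Y p = D X Z p"
proof -
  define f where "f q = (if q \<in> V then 1 else 0 :: real)" for q
  have f: "SF V f"
  proof
    fix q assume q: "q \<in> V"
    show "smooth_at M q f"
      by (rule smooth_at_cong[OF V(1) q _ smooth_at_const[of q 1]])
        (use openin_subset[OF V(1)] q in \<open>auto simp: f_def\<close>)
  qed
  have Xf: "X p f = 0"
    using tv_cong[OF vf_tangent[OF X V(2)] V, of f "\<lambda>_. 1"] tv_const[OF vf_tangent[OF X V(2)]] by (simp add: f_def)
  have "(\<lambda>q. f q *\<^sub>R Y q) = (\<lambda>q. f q *\<^sub>R Z q)" using eq by (auto simp: f_def)
  then show ?thesis
    using conn_scale2[OF V(1) X Y f V(2)] conn_scale2[OF V(1) X vf_cong[OF V(1) eq Y] f V(2)] V(2) Xf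
    by (simp add: f_def)
qed

lemma conn_zero1:
  assumes V: "openin (mtop M) V" "p \<in> V" and Y: "Y \<in> VF V"
  shows "D (\<lambda>q. 0) Y p = 0"
  by (rule tensorial_zero[OF tensorial_conn[OF assms] V])

lemma conn_zero2:
  assumes V: "openin (mtop M) V" "p \<in> V" and X: "X \<in> VF V"
  shows "D X (\<lambda>q. 0) p = 0"
  using conn_add2[OF V(1) X vf_zero[OF openin_subset[OF V(1)]] vf_zero[OF openin_subset[OF V(1)]] V(2)] by simp

lemma conn_sum2:
  assumes V: "openin (mtop M) V" "p \<in> V" and X: "X \<in> VF V" and Y: "\<And>i. i \<in> I \<Longrightarrow> Y i \<in> VF V"
  shows "D X (\<lambda>q. \<Sum>i\<in>I. Y i q) p = (\<Sum>i\<in>I. D X (Y i) p)"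
  using Y
proof (induction I rule: infinite_finite_induct)
  case (insert i I)
  have Y: "Y i \<in> VF V" "\<And>j. j \<in> I \<Longrightarrow> Y j \<in> VF V" using insert.prems by auto
  show ?case
    using conn_add2[OF V(1) X Y(1) vf_sum[OF openin_subset[OF V(1)], of I Y, OF Y(2)] V(2)] insert.IH[OF Y(2)]
    by (simp only: sum.insert[OF insert.hyps] simp_thms)
qed (use conn_zero2[OF V X] in auto)

abbreviation "Riem \<equiv> curvature M D"

lemma curvature_swap:
  assumes V: "openin (mtop M) V" "p \<in> V" and X: "X \<in> VF V" and Y: "Y \<in> VF V" and Z: "Z \<in> VF V"
  shows "Riem Y X Z p = - Riem X Y Z p"
proof -
  have "D (lie_bracket M Y X) Z p = D (\<lambda>q. - 1 *\<^sub>R lie_bracket M X Y q) Z p"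
    by (rule conn_cong1[OF V vf_bracket[OF V(1) Y X] Z])
      (use vf_scale[OF _ vf_bracket[OF V(1) X Y], of "\<lambda>_. - 1"] smooth_at_const openin_subset[OF V(1)]
        lie_bracket_swap[of Y X] in auto)
  also have "\<dots> = - D (lie_bracket M X Y) Z p"
    using conn_scale1[OF V(1) vf_bracket[OF V(1) X Y] Z, of "\<lambda>_. - 1" p] V smooth_at_const openin_subset[OF V(1)] by auto
  finally show ?thesis by (simp add: curvature_def)
qed

text \<open>For f X the second covariant derivative yields an extra term with Y f, which is
  cancelled by the one in [f X, Y] = f [X, Y] - (Y f) X.\<close>

lemma tensorial_curvature1:
  assumes V: "openin (mtop M) V" "p \<in> V" and Y: "Y \<in> VF V" and Z: "Z \<in> VF V"
  shows "tensorial M p (\<lambda>X. Riem X Y Z p)"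
  unfolding tensorial_def
proof (intro conjI allI impI; elim conjE)
  fix W X X' assume W: "openin (mtop M) W" "p \<in> W" "X \<in> VF W" "X' \<in> VF W"
  define A where "A = V \<inter> W"
  have A: "openin (mtop M) A" "p \<in> A" "X \<in> VF A" "X' \<in> VF A" "Y \<in> VF A" "Z \<in> VF A"
    using V W Y Z vf_subset by (auto simp: A_def)
  note i = conn_vf[OF A(1)] vf_bracket[OF A(1)] vf_add vf_diff A
  have 1: "D Y (D (\<lambda>q. X q + X' q) Z) p = D Y (D X Z) p + D Y (D X' Z) p"
    using conn_cong2[OF A(1,2,5) conn_vf[OF A(1) vf_add[OF A(3,4)] A(6)], of "\<lambda>q. D X Z q + D X' Z q"]
      conn_add1[OF A(1,3,6,4)] conn_add2[OF A(1,5) conn_vf[OF A(1,3,6)] conn_vf[OF A(1,4,6)] A(2)] by simp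
  have "lie_bracket M (\<lambda>q. X q + X' q) Y p = lie_bracket M X Y p + lie_bracket M X' Y p"
    using tv_add[OF vf_tangent[OF A(5,2)] vf_smooth[OF A(3,2)] vf_smooth[OF A(4,2)]]
    by (auto simp: lie_bracket_def fun_eq_iff)
  then have 2: "D (lie_bracket M (\<lambda>q. X q + X' q) Y) Z p = D (lie_bracket M X Y) Z p + D (lie_bracket M X' Y) Z p"
    using conn_cong1[OF A(1,2) _ A(6), of "lie_bracket M (\<lambda>q. X q + X' q) Y" "\<lambda>q. lie_bracket M X Y q + lie_bracket M X' Y q"]
      conn_add1[OF A(1) _ A(6) _ A(2), of "lie_bracket M X Y" "lie_bracket M X' Y"] i by simp
  show "Riem (\<lambda>q. X q + X' q) Y Z p = Riem X Y Z p + Riem X' Y Z p"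
    using conn_add1[OF A(1,3) _ A(4,2), of "D Y Z"] i by (simp add: curvature_def 1 2)
next
  fix W X f assume W: "openin (mtop M) W" "p \<in> W" "X \<in> VF W" "SF W f"
  define A where "A = V \<inter> W"
  have A: "openin (mtop M) A" "p \<in> A" "X \<in> VF A" "SF A f" "Y \<in> VF A" "Z \<in> VF A"
    using V W Y Z vf_subset by (auto simp: A_def)
  have nYf: "SF A (\<lambda>q. - Y q f)" using vf_smooth[OF A(5)] A(4) smooth_at_minus by blast
  have 1: "D Y (D (\<lambda>q. f q *\<^sub>R X q) Z) p = Y p f *\<^sub>R D X Z p + f p *\<^sub>R D Y (D X Z) p"
    using conn_cong2[OF A(1,2,5) conn_vf[OF A(1) vf_scale[OF A(4,3)] A(6)], of "\<lambda>q. f q *\<^sub>R D X Z q"]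
      conn_scale1[OF A(1,3,6,4)] conn_scale2[OF A(1,5) conn_vf[OF A(1,3,6)] A(4,2)] by simp
  have b: "(\<lambda>q. f q *\<^sub>R lie_bracket M X Y q) \<in> VF A" "(\<lambda>q. (- Y q f) *\<^sub>R X q) \<in> VF A"
    by (rule vf_scale[OF A(4) vf_bracket[OF A(1,3,5)]], rule vf_scale[OF nYf A(3)])
  have "D (lie_bracket M (\<lambda>q. f q *\<^sub>R X q) Y) Z p
      = D (\<lambda>q. f q *\<^sub>R lie_bracket M X Y q + (- Y q f) *\<^sub>R X q) Z p"
    by (rule conn_cong1[OF A(1,2) vf_bracket[OF A(1) vf_scale[OF A(4,3)] A(5)] A(6) vf_add[OF b]])
      (simp add: lie_bracket_scale[OF A(1,2,3,5,4)])
  also have "\<dots> = f p *\<^sub>R D (lie_bracket M X Y) Z p + (- Y p f) *\<^sub>R D X Z p"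
    using conn_add1[OF A(1) b(1) A(6) b(2) A(2)]
      conn_scale1[OF A(1) vf_bracket[OF A(1,3,5)] A(6,4,2)] conn_scale1[OF A(1,3,6) nYf A(2)] by simp
  finally show "Riem (\<lambda>q. f q *\<^sub>R X q) Y Z p = f p *\<^sub>R Riem X Y Z p"
    using conn_scale1[OF A(1,3) conn_vf[OF A(1,5,6)] A(4,2)] by (simp add: curvature_def 1 algebra_simps)
qed

lemma tensorial_curvature2:
  assumes V: "openin (mtop M) V" "p \<in> V" and X: "X \<in> VF V" and Z: "Z \<in> VF V"
  shows "tensorial M p (\<lambda>Y. Riem X Y Z p)"
proof -
  have *: "Riem X Y Z p = - Riem Y X Z p" if "openin (mtop M) W" "p \<in> W" "Y \<in> VF W" for W Y
    by (rule curvature_swap[of "V \<inter> W"]) (use V X Z that vf_subset in auto)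
  note t = tensorial_curvature1[OF V X Z]
  show ?thesis
    unfolding tensorial_def
  proof (intro conjI allI impI; elim conjE)
    fix W Y Y' assume W: "openin (mtop M) W" "p \<in> W" "Y \<in> VF W" "Y' \<in> VF W"
    show "Riem X (\<lambda>q. Y q + Y' q) Z p = Riem X Y Z p + Riem X Y' Z p"
      using *[OF W(1,2)] vf_add[OF W(3,4)] W(3,4) tensorial_add[OF t W] by simp
  next
    fix W Y f assume W: "openin (mtop M) W" "p \<in> W" "Y \<in> VF W" "SF W f"
    show "Riem X (\<lambda>q. f q *\<^sub>R Y q) Z p = f p *\<^sub>R Riem X Y Z p"
      using *[OF W(1,2)] vf_scale[OF W(4,3)] W(3) tensorial_scale[OF t W] by simp
  qed
qed

lemma conn_conn_scale2:
  assumes V: "openin (mtop M) V" "p \<in> V" and X: "X \<in> VF V" and Y: "Y \<in> VF V" and Z: "Z \<in> VF V" and f: "SF V f"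
  shows "D X (D Y (\<lambda>q. f q *\<^sub>R Z q)) p
    = X p (\<lambda>q. Y q f) *\<^sub>R Z p + Y p f *\<^sub>R D X Z p + X p f *\<^sub>R D Y Z p + f p *\<^sub>R D X (D Y Z) p"
proof -
  have Yf: "SF V (\<lambda>q. Y q f)" using vf_smooth[OF Y] f by blast
  have "D X (D Y (\<lambda>q. f q *\<^sub>R Z q)) p = D X (\<lambda>q. Y q f *\<^sub>R Z q + f q *\<^sub>R D Y Z q) p"
    by (rule conn_cong2[OF V X conn_vf[OF V(1) Y vf_scale[OF f Z]]]) (rule conn_scale2[OF V(1) Y Z f])
  then show ?thesis
    using conn_add2[OF V(1) X vf_scale[OF Yf Z] vf_scale[OF f conn_vf[OF V(1) Y Z]] V(2)]
      conn_scale2[OF V(1) X Z Yf V(2)] conn_scale2[OF V(1) X conn_vf[OF V(1) Y Z] f V(2)] by simp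
qed

text \<open>For f Z the mixed first-order terms are symmetric in \<open>X\<close> and
  \<open>Y\<close> and drop out; the second derivatives of f leave [X, Y] f, which the bracket term
  removes.\<close>

lemma tensorial_curvature3:
  assumes V: "openin (mtop M) V" "p \<in> V" and X: "X \<in> VF V" and Y: "Y \<in> VF V"
  shows "tensorial M p (\<lambda>Z. Riem X Y Z p)"
  unfolding tensorial_def
proof (intro conjI allI impI; elim conjE)
  fix W Z Z' assume W: "openin (mtop M) W" "p \<in> W" "Z \<in> VF W" "Z' \<in> VF W"
  define A where "A = V \<inter> W"
  have A: "openin (mtop M) A" "p \<in> A" "Z \<in> VF A" "Z' \<in> VF A" "X \<in> VF A" "Y \<in> VF A"
    using V W Y X vf_subset by (auto simp: A_def)
  have 1: "D X (D Y (\<lambda>q. Z q + Z' q)) p = D X (D Y Z) p + D X (D Y Z') p" if "X \<in> VF A" "Y \<in> VF A" for X Y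
    using conn_cong2[OF A(1,2) that(1) conn_vf[OF A(1) that(2) vf_add[OF A(3,4)]], of "\<lambda>q. D Y Z q + D Y Z' q"]
      conn_add2[OF A(1) that(2) A(3,4)] conn_add2[OF A(1) that(1) conn_vf[OF A(1) that(2) A(3)] conn_vf[OF A(1) that(2) A(4)] A(2)]
    by simp
  show "Riem X Y (\<lambda>q. Z q + Z' q) p = Riem X Y Z p + Riem X Y Z' p"
    using conn_add2[OF A(1) vf_bracket[OF A(1,5,6)] A(3,4,2)] 1[OF A(5,6)] 1[OF A(6,5)] by (simp add: curvature_def)
next
  fix W Z f assume W: "openin (mtop M) W" "p \<in> W" "Z \<in> VF W" "SF W f"
  define A where "A = V \<inter> W"
  have A: "openin (mtop M) A" "p \<in> A" "Z \<in> VF A" "SF A f" "X \<in> VF A" "Y \<in> VF A"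
    using V W Y X vf_subset by (auto simp: A_def)
  show "Riem X Y (\<lambda>q. f q *\<^sub>R Z q) p = f p *\<^sub>R Riem X Y Z p"
    using conn_conn_scale2[OF A(1,2,5,6,3,4)] conn_conn_scale2[OF A(1,2,6,5,3,4)]
      conn_scale2[OF A(1) vf_bracket[OF A(1,5,6)] A(3,4,2)] lie_bracket_apply[of p f X Y] A(2,4)
    by (simp add: curvature_def algebra_simps)
qed

end

section \<open>Constant totally real sectional curvatures\<close>

text \<open>Linearity is stated in one slot; the symmetries carry it to the other three.\<close>

definition curvature_like :: "('v::real_vector \<Rightarrow> 'v \<Rightarrow> 'v \<Rightarrow> 'v \<Rightarrow> real) \<Rightarrow> bool" where
  "curvature_like R \<longleftrightarrow>
     (\<forall>y z u. linear (\<lambda>x. R x y z u)) \<and>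
     (\<forall>x y z u. R y x z u = - R x y z u \<and> R x y u z = - R x y z u \<and>
        R x y z u + R y z x u + R z x y u = 0)"

lemma curvature_likeD:
  assumes "curvature_like R"
  shows curvature_like_swap12: "R y x z u = - R x y z u"
    and curvature_like_swap34: "R x y u z = - R x y z u"
    and curvature_like_bianchi: "R x y z u + R y z x u + R z x y u = 0"
    and curvature_like_linear1: "linear (\<lambda>x. R x y z u)"
  using assms unfolding curvature_like_def by blast+

text \<open>The octahedron argument: the four Bianchi identities on the faces, combined through the
  two skew symmetries.\<close>

lemma curvature_like_pair:
  assumes "curvature_like R"
  shows "R z u x y = R x y z u"
proof -
  note s = curvature_like_swap12[OF assms] curvature_like_swap34[OF assms]
  have "R x y z u + R y z x u + R z x y u = 0" "R y z u x + R z u y x + R u y z x = 0"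
    "R z u x y + R u x z y + R x z u y = 0" "R u x y z + R x y u z + R y u x z = 0"
    by (rule curvature_like_bianchi[OF assms])+
  then show ?thesis
    using s(2)[of y z x u] s(1)[of x z u y] s(2)[of z x y u] s(2)[of z u x y] s(1)[of y u z x] s(2)[of u x z y]
      s(2)[of x y z u] s(2)[of y u x z] s(1)[of y u x z] s(2)[of u y x z] s(1)[of x z y u] s(2)[of x z y u] by linarith
qed

lemma curvature_like_add:
  assumes R: "curvature_like R"
  shows "R (x + x') y z u = R x y z u + R x' y z u" "R x (y + y') z u = R x y z u + R x y' z u"
    "R x y (z + z') u = R x y z u + R x y z' u" "R x y z (u + u') = R x y z u + R x y z u'"
proof -
  show 1: "R (x + x') y z u = R x y z u + R x' y z u" for x x' y z u
    using linear_add[OF curvature_like_linear1[OF R]] by blast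
  show 2: "R x (y + y') z u = R x y z u + R x y' z u" for y y' x z u
    using 1[of y y' x z u] curvature_like_swap12[OF R, of x] by simp
  show "R x y (z + z') u = R x y z u + R x y z' u" 
    using 1[of z z' u x y] curvature_like_pair[OF R, of x y] by simp
  show "R x y z (u + u') = R x y z u + R x y z u'"
    using 2[of z u u' x y] curvature_like_pair[OF R, of x y] by simp
qed

lemma curvature_like_scale:
  assumes R: "curvature_like R"
  shows "R (a *\<^sub>R x) y z u = a * R x y z u" "R x (a *\<^sub>R y) z u = a * R x y z u"
    "R x y (a *\<^sub>R z) u = a * R x y z u" "R x y z (a *\<^sub>R u) = a * R x y z u"
proof -
  show 1: "R (a *\<^sub>R x) y z u = a * R x y z u" for x y z u
    using linear_cmul[OF curvature_like_linear1[OF R]] by simp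
  show 2: "R x (a *\<^sub>R y) z u = a * R x y z u" for x y z u
    using 1[of y x z u] curvature_like_swap12[OF R, of x] by simp
  show "R x y (a *\<^sub>R z) u = a * R x y z u"
    using 1[of z u x y] curvature_like_pair[OF R, of x y] by simp
  show "R x y z (a *\<^sub>R u) = a * R x y z u"
    using 2[of z u x y] curvature_like_pair[OF R, of x y] by simp
qed

text \<open>Polarizing first the inner and then the outer pair makes the tensor skew in its two
  middle arguments. With the skewness in the first pair it becomes invariant under cyclic
  permutation of the first three, so the Bianchi sum is three times one term.\<close>

lemma curvature_like_eq_0:
  assumes R: "curvature_like R" and 0: "\<And>x y. R x y y x = 0"
  shows "R x y z u = 0"
proof -
  note p = curvature_like_pair[OF R] and s = curvature_like_swap12[OF R] curvature_like_swap34[OF R]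
  note a = curvature_like_add[OF R]
  have 1: "R x y z x = 0" for x y z
  proof -
    have "R x y z x + R x z y x = 0" using 0[of x "y + z"] 0[of x y] 0[of x z] unfolding a by simp
    moreover have "R x z y x = R x y z x" using p[of x z y x] s(1)[of x y x z] s(2)[of x y x z] by simp
    ultimately show ?thesis by simp
  qed
  have 2: "R x y z u = - R x z y u" for x y z u
  proof -
    have "R x y z u + R u y z x = 0" using 1[of "x + u" y z] 1[of x y z] 1[of u y z] unfolding a by simp
    moreover have "R u y z x = R x z y u" using p[of u y z x] s(1)[of z x u y] s(2)[of x z u y] by simp
    ultimately show ?thesis by simp
  qed
  have "R x y z u = R z x y u" for x y z u using 2[of x y z u] s(1)[of x z y u] by simp
  from this[of x y z u] this[of z x y u] show ?thesis
    using curvature_like_bianchi[OF R, of x y z u] by linarith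
qed

section \<open>Algebra of a Norden metric at one point\<close>

locale norden_space =
  fixes g :: "'v::real_vector \<Rightarrow> 'v \<Rightarrow> real" and J :: "'v \<Rightarrow> 'v"
  assumes g_linear: "\<And>y. linear (\<lambda>x. g x y)" and g_sym: "\<And>x y. g x y = g y x"
    and J_linear: "linear J" and J_J: "\<And>x. J (J x) = - x" and g_J_J: "\<And>x y. g (J x) (J y) = - g x y"
begin

lemma g_add: "g (x + y) z = g x z + g y z" "g z (x + y) = g z x + g z y"
proof -
  show *: "g (x + y) z = g x z + g y z" for x y z using linear_add[OF g_linear] .
  show "g z (x + y) = g z x + g z y"
    using *[of x y z] unfolding g_sym[of "x + y" z] g_sym[of x z] g_sym[of y z] .
qed

lemma g_scale: "g (a *\<^sub>R x) z = a * g x z" "g z (a *\<^sub>R x) = a * g z x"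
proof -
  show *: "g (a *\<^sub>R x) z = a * g x z" using linear_cmul[OF g_linear] by simp
  show "g z (a *\<^sub>R x) = a * g z x" using * unfolding g_sym[of "a *\<^sub>R x" z] g_sym[of x z] .
qed

lemma g_minus: "g (- x) z = - g x z" "g z (- x) = - g z x"
  using g_scale[where a = "- 1"] by simp_all

lemma J_add: "J (x + y) = J x + J y" and J_scale: "J (a *\<^sub>R x) = a *\<^sub>R J x" and J_minus: "J (- x) = - J x"
  using J_linear by (auto simp: linear_add linear_cmul linear_neg)

lemma g_J: "g (J x) y = g x (J y)"
  using g_J_J[of x "J y"] by (simp add: J_J g_minus)

abbreviation model where
  "model \<nu> \<nu>t x y z u \<equiv> \<nu> * (pi1 g x y z u - pi2 g J x y z u) + \<nu>t * pi3 g J x y z u"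

lemma curvature_like_model: "curvature_like (model \<nu> \<nu>t)"
  unfolding curvature_like_def
proof (intro conjI allI)
  fix x y z u
  show "linear (\<lambda>x. model \<nu> \<nu>t x y z u)"
    by (intro linearI) (simp_all add: pi1_def pi2_def pi3_def g_add g_scale algebra_simps)
  show "model \<nu> \<nu>t y x z u = - model \<nu> \<nu>t x y z u" "model \<nu> \<nu>t x y u z = - model \<nu> \<nu>t x y z u"
    by (simp_all add: pi1_def pi2_def pi3_def algebra_simps)
  show "model \<nu> \<nu>t x y z u + model \<nu> \<nu>t y z x u + model \<nu> \<nu>t z x y u = 0"
    using g_sym[of x y] g_sym[of y z] g_sym[of x z] g_J[of x y] g_J[of y z] g_J[of x z]
      g_sym[of "J x" y] g_sym[of "J y" z] g_sym[of "J x" z]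
    by (simp add: pi1_def pi2_def pi3_def algebra_simps)
qed

lemma model_J: "model \<nu> \<nu>t x y (J z) u = model \<nu> \<nu>t x y z (J u)"
  by (simp add: pi1_def pi2_def pi3_def J_J g_minus algebra_simps)

text \<open>\<open>G\<close> is bilinear over the complex numbers, which act through \<open>cs\<close>. A plane is totally real
  iff \<open>G\<close> is real on it.\<close>

definition cs :: "complex \<Rightarrow> 'v \<Rightarrow> 'v" where "cs a x = Re a *\<^sub>R x + Im a *\<^sub>R J x"
definition G :: "'v \<Rightarrow> 'v \<Rightarrow> complex" where "G x y = Complex (g x y) (- g x (J y))"

lemma G_sym: "G x y = G y x"
  unfolding G_def g_sym[of x y] by (metis g_J g_sym)

lemma G_add: "G (x + y) z = G x z + G y z" "G z (x + y) = G z x + G z y"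
  by (simp_all add: G_def complex_eq_iff g_add J_add)

lemma G_cs: "G (cs a x) y = a * G x y" "G y (cs a x) = a * G y x"
proof -
  show "G (cs a x) y = a * G x y" for x y
    by (simp add: G_def cs_def complex_eq_iff g_add g_scale g_J J_J g_minus algebra_simps)
  from this[of x y] show "G y (cs a x) = a * G y x"
    unfolding G_sym[of "cs a x" y] G_sym[of x y] .
qed

lemma G_scale: "G (a *\<^sub>R x) y = a * G x y" "G y (a *\<^sub>R x) = a * G y x"
  using G_cs[where a = "of_real a"] by (simp_all add: cs_def)

context
  fixes S :: "'v \<Rightarrow> 'v \<Rightarrow> 'v \<Rightarrow> 'v \<Rightarrow> real"
  assumes S: "curvature_like S" and S_J: "\<And>x y z u. S x y (J z) u = S x y z (J u)"
begin

text \<open>By \<open>S_J\<close> the tensor with \<open>J\<close> in its last slot is again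
  curvature-like; its pair symmetry moves \<open>J\<close> from the last pair to the first.\<close>

lemma S_J1: "S (J x) y z u = S x y z (J u)"
proof -
  have T: "curvature_like (\<lambda>x y z u. S x y z (J u))"
    unfolding curvature_like_def
  proof (intro conjI allI)
    fix x y z u
    show "S x y u (J z) = - S x y z (J u)"
      using S_J[of x y u z] curvature_like_swap34[OF S, of x y "J u" z] by simp
    show "S x y z (J u) + S y z x (J u) + S z x y (J u) = 0"
      by (rule curvature_like_bianchi[OF S])
  qed (rule curvature_like_linear1[OF S] curvature_like_swap12[OF S])+
  show ?thesis
    using curvature_like_pair[OF T, of x y z u] S_J[of z u x y] curvature_like_pair[OF S, of "J x" y z u] by simp
qed

text \<open>The complex tensor with real part \<open>S\<close>. The sign of the imaginary part is
  chosen as in \<open>G\<close>, which makes \<open>Q\<close> complex linear in every slot for the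
  action \<open>cs\<close>.\<close>

definition Q where "Q x y z u = Complex (S x y z u) (- S x y z (J u))"

lemma Q_add: "Q (x + x') y z u = Q x y z u + Q x' y z u" "Q x (y + y') z u = Q x y z u + Q x y' z u"
    "Q x y (z + z') u = Q x y z u + Q x y z' u" "Q x y z (u + u') = Q x y z u + Q x y z u'"
  by (simp_all add: Q_def curvature_like_add[OF S] J_add complex_eq_iff)

lemma Q_cs: "Q (cs a x) y z u = a * Q x y z u" "Q x (cs a y) z u = a * Q x y z u"
    "Q x y (cs a z) u = a * Q x y z u" "Q x y z (cs a u) = a * Q x y z u"
proof -
  have J2: "S x (J y) z u = S x y z (J u)" for x y z u
    using S_J1[of y x z u] curvature_like_swap12[OF S] by metis
  have m: "S x y z (- u) = - S x y z u" for x y z u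
    using curvature_like_scale(4)[OF S, of x y z "- 1" u] by simp
  have d: "S x y z (u - v) = S x y z u - S x y z v" for x y z u v
    using curvature_like_add(4)[OF S, of x y z "u - v" v] by simp
  show "Q (cs a x) y z u = a * Q x y z u" "Q x (cs a y) z u = a * Q x y z u"
    "Q x y (cs a z) u = a * Q x y z u" "Q x y z (cs a u) = a * Q x y z u"
    by (simp_all add: Q_def d cs_def curvature_like_add[OF S] curvature_like_scale[OF S] complex_eq_iff
        J_add J_scale J_J m S_J1 J2 S_J algebra_simps)
qed

lemma Q_scale: "Q (a *\<^sub>R x) y z u = a * Q x y z u" "Q x (a *\<^sub>R y) z u = a * Q x y z u"
    "Q x y (a *\<^sub>R z) u = a * Q x y z u" "Q x y z (a *\<^sub>R u) = a * Q x y z u"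
  using Q_cs[where a = "of_real a"] by (simp_all add: cs_def)

lemma Q_alt: "Q x x z u = 0" "Q x y z z = 0"
proof -
  have "S x x z u = 0" for u using curvature_like_swap12[OF S, of x x z u] by simp
  then show "Q x x z u = 0" by (simp add: Q_def complex_eq_iff)
  have "S x y z (J z) = - S x y z (J z)" using S_J[of x y z z] curvature_like_swap34[OF S, of x y "J z" z] by simp
  then show "Q x y z z = 0" using curvature_like_swap34[OF S, of x y z z] by (simp add: Q_def complex_eq_iff)
qed

text \<open>A \<open>G\<close>-orthonormal complex basis spans a totally real plane over the reals,
  on which \<open>S\<close> is flat. By complex multilinearity \<open>Q\<close> then vanishes on all
  complex combinations, hence on generic pairs; the remaining pairs are limits along polynomial
  lines.\<close>

lemma totally_real_flat_imp_0:
  assumes flat: "\<And>x y. g x (J x) = 0 \<Longrightarrow> g x (J y) = 0 \<Longrightarrow> g y (J y) = 0 \<Longrightarrow> pi1 g x y y x \<noteq> 0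
      \<Longrightarrow> S x y y x = 0 \<and> S x y y (J x) = 0"
    and x0: "G x0 x0 \<noteq> 0" and y0: "G y0 y0 \<noteq> 0" and x0y0: "G x0 y0 = 0"
  shows "S x y z u = 0"
proof -
  have 1: "Q x y y x = 0" if x: "G x x \<noteq> 0" and xy: "G x x * G y y - G x y * G x y \<noteq> 0" for x y
  proof -
    \<comment> \<open>Gram-Schmidt over the complex numbers, with coefficients acting through
      \<open>cs\<close>.\<close>
    define y' where "y' = y + cs (- G x y / G x x) x"
    have y': "G x y' = 0" "G y' y' * G x x = G x x * G y y - G x y * G x y"
      using x by (simp_all add: y'_def G_add G_cs G_sym[of y x] field_simps)
    then have ny': "G y' y' \<noteq> 0" using xy by auto
    \<comment> \<open>A complex square root exists whatever the sign or phase, so both vectors can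
      be normalized to \<open>G\<close> = 1 irrespective of the signature.\<close>
    define a where "a = inverse (csqrt (G x x))"
    define b where "b = inverse (csqrt (G y' y'))"
    have a: "a \<noteq> 0" "a * a * G x x = 1"
      using x power2_csqrt[of "G x x"] by (auto simp: a_def power2_eq_square field_simps)
    have b: "b \<noteq> 0" "b * b * G y' y' = 1"
      using ny' power2_csqrt[of "G y' y'"] by (auto simp: b_def power2_eq_square field_simps)
    define x1 where "x1 = cs a x"
    define y1 where "y1 = cs b y'"
    have "G x1 x1 = 1" "G x1 y1 = 0" "G y1 y1 = 1"
      using a b y' by (simp_all add: x1_def y1_def G_cs mult.assoc)
    then have g1: "g x1 (J x1) = 0" "g x1 (J y1) = 0" "g y1 (J y1) = 0" "g x1 x1 = 1" "g x1 y1 = 0" "g y1 y1 = 1"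
      by (simp_all add: G_def complex_eq_iff)
    have "Q x1 y1 y1 x1 = 0"
      using flat[OF g1(1-3)] g1(4-6) by (simp add: pi1_def Q_def complex_eq_iff)
    then have "Q x y' y' x = 0" using a b by (simp add: x1_def y1_def Q_cs)
    \<comment> \<open>Adding a multiple of \<open>x\<close> to \<open>y\<close> does not change the
      value, since \<open>Q\<close> is alternating in each pair.\<close>
    then show ?thesis by (simp add: y'_def Q_add Q_cs Q_alt)
  qed
  \<comment> \<open>The exceptional pairs are removed along the line \<open>(x + s x0, y + s y0)\<close>, on which both the
    curvature and the degeneracy conditions are polynomials in \<open>s\<close>.\<close>
  have 2: "Q x y y x = 0" for x y
  proof -
    define p where "p = [: Q x y y x, Q x0 y y x + Q x y0 y x + Q x y y0 x + Q x y y x0,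
      Q x0 y0 y x + Q x0 y y0 x + Q x0 y y x0 + Q x y0 y0 x + Q x y0 y x0 + Q x y y0 x0,
      Q x0 y0 y0 x + Q x0 y0 y x0 + Q x0 y y0 x0 + Q x y0 y0 x0, Q x0 y0 y0 x0 :]"
    define A where "A = [: G x x, 2 * G x x0, G x0 x0 :]"
    \<comment> \<open>The quadratic coefficient is absent because
      \<open>G x0 y0 = 0\<close>.\<close>
    define B where "B = [: G x y, G x0 y + G x y0 :]"
    define C where "C = [: G y y, 2 * G y y0, G y0 y0 :]"
    have "poly (p * (A * (A * C - B * B))) (of_real s) = 0" for s :: real
    proof -
      let ?x = "x + s *\<^sub>R x0" and ?y = "y + s *\<^sub>R y0"
      have *: "poly p (of_real s) = Q ?x ?y ?y ?x" "poly A (of_real s) = G ?x ?x"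
        "poly B (of_real s) = G ?x ?y" "poly C (of_real s) = G ?y ?y"
        using x0y0 G_sym[of x x0] G_sym[of y y0]
        by (simp_all add: p_def A_def B_def C_def Q_add Q_scale G_add G_scale algebra_simps)
      show ?thesis using 1[of ?x ?y] by (auto simp: *)
    qed
    then have "range of_real \<subseteq> {z. poly (p * (A * (A * C - B * B))) z = 0}" by auto
    moreover have "infinite (range (of_real :: real \<Rightarrow> complex))"
      using infinite_UNIV_char_0 by (simp add: finite_image_iff inj_of_real)
    ultimately have "p * (A * (A * C - B * B)) = 0"
      using poly_roots_finite finite_subset by blast
    moreover have "A \<noteq> 0" using x0 by (simp add: A_def)
    \<comment> \<open>The Gram determinant has leading coefficient \<open>G x0 x0 * G y0 y0\<close>;
      the square of the linear polynomial \<open>B\<close> cannot reach degree 4.\<close>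
    moreover have "A * C - B * B \<noteq> 0" 
    proof
      assume "A * C - B * B = 0"
      then have "coeff (A * C - B * B) 4 = 0" by simp
      moreover have "coeff (A * C - B * B) 4 = G x0 x0 * G y0 y0"
        by (simp add: A_def B_def C_def numeral_eq_Suc)
      ultimately show False using x0 y0 by simp
    qed
    \<comment> \<open>Complex polynomials have no zero divisors, and the constant coefficient of
      \<open>p\<close> is the value sought.\<close>
    ultimately have "p = 0" by simp
    then show ?thesis by (simp add: p_def)
  qed
  show ?thesis
    by (rule curvature_like_eq_0[OF S]) (use 2 in \<open>simp add: Q_def complex_eq_iff\<close>)
qed

end

text \<open>The model has the prescribed values on totally real planes and the same symmetries, so
  the difference is flat there. The vectors \<open>x0\<close> and \<open>y0\<close> witness that the
  complex dimension is at least two.\<close>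

theorem totally_real_const_imp_model:
  assumes R: "curvature_like R" and R_J: "\<And>x y z u. R x y (J z) u = R x y z (J u)"
    and const: "\<And>x y. g x (J x) = 0 \<Longrightarrow> g x (J y) = 0 \<Longrightarrow> g y (J y) = 0 \<Longrightarrow> pi1 g x y y x \<noteq> 0
      \<Longrightarrow> R x y y x = \<nu> * pi1 g x y y x \<and> R x y y (J x) = \<nu>t * pi1 g x y y x"
    and 0: "G x0 x0 \<noteq> 0" "G y0 y0 \<noteq> 0" "G x0 y0 = 0"
  shows "R x y z u = model \<nu> \<nu>t x y z u"
proof -
  define S where "S x y z u = R x y z u - model \<nu> \<nu>t x y z u" for x y z u
  have "curvature_like S"
    unfolding curvature_like_def
  proof (intro conjI allI)
    note m = curvature_like_model[of \<nu> \<nu>t]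
    fix x y z u
    show "linear (\<lambda>x. S x y z u)"
      unfolding S_def
      by (intro linear_compose_sub curvature_like_linear1[OF R] curvature_like_linear1[OF m])
    show "S y x z u = - S x y z u"
      unfolding S_def curvature_like_swap12[OF R, of y x] curvature_like_swap12[OF m, of y x] by simp
    show "S x y u z = - S x y z u"
      unfolding S_def curvature_like_swap34[OF R, of x y u z] curvature_like_swap34[OF m, of x y u z] by simp
    show "S x y z u + S y z x u + S z x y u = 0"
      using curvature_like_bianchi[OF R, of x y z u] curvature_like_bianchi[OF m, of x y z u]
      unfolding S_def by linarith
  qed
  moreover have "S x y (J z) u = S x y z (J u)" for x y z u
    by (simp only: S_def R_J model_J)
  moreover have "S x y y x = 0 \<and> S x y y (J x) = 0"
    if "g x (J x) = 0" "g x (J y) = 0" "g y (J y) = 0" "pi1 g x y y x \<noteq> 0" for x y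
    using const[OF that] that g_J[of y x] g_sym[of "J y" x]
    by (simp add: S_def pi1_def pi2_def pi3_def J_J g_minus g_sym[of y x])
  ultimately have "S x y z u = 0"
    by (rule totally_real_flat_imp_0[OF _ _ _ 0])
  then show ?thesis by (simp add: S_def)
qed

end

section \<open>Curvature of a Kaehler manifold with Norden metric\<close>

locale kaehler_norden_mfd = connection M D for M :: "('a, 'e::euclidean_space) mfd" and D +
  fixes g :: "'a metric" and J :: "'a endo"
  assumes kaehler: "kaehler_norden M J g D"
begin

lemma metric: "pseudo_riemannian_metric M g" and lc: "levi_civita M g D"
  using kaehler by (auto simp: kaehler_norden_def)

context
  fixes p
  assumes p: "p \<in> topspace (mtop M)"
begin

lemma g_sym: "x \<in> T p \<Longrightarrow> y \<in> T p \<Longrightarrow> g p x y = g p y x"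
  and g_scale1: "x \<in> T p \<Longrightarrow> y \<in> T p \<Longrightarrow> g p (a *\<^sub>R x) y = a * g p x y"
  and g_add1: "x \<in> T p \<Longrightarrow> y \<in> T p \<Longrightarrow> z \<in> T p \<Longrightarrow> g p (x + z) y = g p x y + g p z y"
  and g_nondegenerate: "x \<in> T p \<Longrightarrow> (\<And>y. y \<in> T p \<Longrightarrow> g p x y = 0) \<Longrightarrow> x = 0"
  using metric p unfolding pseudo_riemannian_metric_def tscale_eq_scaleR by blast+

lemma g_scale2: "x \<in> T p \<Longrightarrow> y \<in> T p \<Longrightarrow> g p y (a *\<^sub>R x) = a * g p y x"
  using g_scale1[of x y a] g_sym[of y "a *\<^sub>R x"] g_sym[of y x] by auto

lemma g_add2: "x \<in> T p \<Longrightarrow> y \<in> T p \<Longrightarrow> z \<in> T p \<Longrightarrow> g p y (x + z) = g p y x + g p y z"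
  using g_add1[of x y z] g_sym[of y "x + z"] g_sym[of y x] g_sym[of y z] by auto

lemma g_minus1: "x \<in> T p \<Longrightarrow> y \<in> T p \<Longrightarrow> g p (- x) y = - g p x y"
  and g_minus2: "x \<in> T p \<Longrightarrow> y \<in> T p \<Longrightarrow> g p y (- x) = - g p y x"
  using g_scale1[of x y "- 1"] g_scale2[of x y "- 1"] by simp_all

lemma g_diff1: "x \<in> T p \<Longrightarrow> y \<in> T p \<Longrightarrow> z \<in> T p \<Longrightarrow> g p (x - z) y = g p x y - g p z y"
  and g_diff2: "x \<in> T p \<Longrightarrow> y \<in> T p \<Longrightarrow> z \<in> T p \<Longrightarrow> g p y (x - z) = g p y x - g p y z"
  using g_add1[of x y "- z"] g_add2[of x y "- z"] g_minus1[of z y] g_minus2[of z y] by auto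

lemma g_zero [simp]: "x \<in> T p \<Longrightarrow> g p 0 x = 0" "x \<in> T p \<Longrightarrow> g p x 0 = 0"
  using g_scale1[of x x 0] g_scale2[of x x 0] by simp_all

lemma J_tangent: "x \<in> T p \<Longrightarrow> J p x \<in> T p"
  and J_J: "x \<in> T p \<Longrightarrow> J p (J p x) = - x"
  and J_scale: "x \<in> T p \<Longrightarrow> J p (a *\<^sub>R x) = a *\<^sub>R J p x"
  and J_add: "x \<in> T p \<Longrightarrow> y \<in> T p \<Longrightarrow> J p (x + y) = J p x + J p y"
  and g_J_J: "x \<in> T p \<Longrightarrow> y \<in> T p \<Longrightarrow> g p (J p x) (J p y) = - g p x y"
  using kaehler p unfolding kaehler_norden_def tscale_eq_scaleR by blast+

lemma J_minus: "x \<in> T p \<Longrightarrow> J p (- x) = - J p x"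
  using J_scale[of x "- 1"] by simp

lemma J_diff: "x \<in> T p \<Longrightarrow> y \<in> T p \<Longrightarrow> J p (x - y) = J p x - J p y"
  using J_add[of x "- y"] J_minus[of y] by auto

lemma J_zero: "J p 0 = 0"
  using J_scale[of 0 0] by simp

lemma g_J: "x \<in> T p \<Longrightarrow> y \<in> T p \<Longrightarrow> g p (J p x) y = g p x (J p y)"
  using g_J_J[of x "J p y"] J_J[of y] J_tangent[of y] J_tangent[of x] g_minus2[of y "J p x"] by auto

end

lemma vf_J: "openin (mtop M) V \<Longrightarrow> X \<in> VF V \<Longrightarrow> (\<lambda>q. J q (X q)) \<in> VF V"
  using kaehler unfolding kaehler_norden_def by blast

lemma conn_J:
  "openin (mtop M) V \<Longrightarrow> X \<in> VF V \<Longrightarrow> Y \<in> VF V \<Longrightarrow> p \<in> V \<Longrightarrow> D X (\<lambda>q. J q (Y q)) p = J p (D X Y p)"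
  using kaehler unfolding kaehler_norden_def nabla_endo_def right_minus_eq by blast

lemma smooth_g:
  "openin (mtop M) V \<Longrightarrow> X \<in> VF V \<Longrightarrow> Y \<in> VF V \<Longrightarrow> p \<in> V \<Longrightarrow> smooth_at M p (\<lambda>q. g q (X q) (Y q))"
  using metric[unfolded pseudo_riemannian_metric_def, THEN conjunct2, rule_format, of V X Y p] by simp

lemma torsion_free:
  "openin (mtop M) V \<Longrightarrow> X \<in> VF V \<Longrightarrow> Y \<in> VF V \<Longrightarrow> p \<in> V \<Longrightarrow> D X Y p - D Y X p = lie_bracket M X Y p"
  using lc unfolding levi_civita_def by blast

lemma metric_compatible:
  "openin (mtop M) V \<Longrightarrow> X \<in> VF V \<Longrightarrow> Y \<in> VF V \<Longrightarrow> Z \<in> VF V \<Longrightarrow> p \<in> V \<Longrightarrow>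
    X p (\<lambda>q. g q (Y q) (Z q)) = g p (D X Y p) (Z p) + g p (Y p) (D X Z p)"
  using lc unfolding levi_civita_def by blast

lemma Riem_tangent:
  assumes "openin (mtop M) V" "p \<in> V" "X \<in> VF V" "Y \<in> VF V" "Z \<in> VF V"
  shows "Riem X Y Z p \<in> T p"
proof -
  have *: "A p \<in> T p" if "A \<in> VF V" for A using vf_tangent[OF that assms(2)] .
  show ?thesis unfolding curvature_def
    using assms by (intro tangent_diff * conn_vf vf_bracket)
qed

section \<open>The curvature tensor in a coordinate frame\<close>

context
  fixes U c p
  assumes c: "(U, c) \<in> charts M" and pU: "p \<in> U"
begin

abbreviation "E \<equiv> cvec M U c"

lemma p_top: "p \<in> topspace (mtop M)"
  using openin_subset[OF chart_open[OF c]] pU by auto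

lemmas U_open = chart_open[OF c]
lemmas E_vf = vf_cvec[OF c]
lemmas E_lin = linear_cvec[OF c pU]
lemmas E_tan = cvec_tangent[OF c pU]

text \<open>The pointwise algebra is about a whole type, a tangent space is only a set. The
  isomorphism \<open>w \<mapsto> E w p\<close> transports metric and complex structure to the model
  space.\<close>

lemma norden_space: "norden_space (\<lambda>u v. g p (E u p) (E v p)) (\<lambda>u. vcomp c (J p (E u p)))"
proof (rule norden_space.intro)
  note t = E_tan J_tangent[OF p_top E_tan]
  have EJ: "E (vcomp c (J p (E u p))) p = J p (E u p)" for u
    by (rule cvec_vcomp[OF c pU t(2)])
  show "linear (\<lambda>x. g p (E x p) (E y p))" for y
    by (intro linearI) (simp_all add: linear_add[OF E_lin] linear_cmul[OF E_lin] g_add1[OF p_top] g_scale1[OF p_top] E_tan)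
  show "g p (E x p) (E y p) = g p (E y p) (E x p)" for x y
    by (rule g_sym[OF p_top E_tan E_tan])
  show "linear (\<lambda>u. vcomp c (J p (E u p)))"
    by (intro linearI) (simp_all add: linear_add[OF E_lin] linear_cmul[OF E_lin] J_add[OF p_top] J_scale[OF p_top]
        E_tan linear_add[OF linear_vcomp] linear_cmul[OF linear_vcomp])
  show "vcomp c (J p (E (vcomp c (J p (E x p))) p)) = - x" for x
    unfolding EJ J_J[OF p_top E_tan] linear_neg[OF linear_vcomp] vcomp_cvec[OF c pU] ..
  show "g p (E (vcomp c (J p (E x p))) p) (E (vcomp c (J p (E y p))) p) = - g p (E x p) (E y p)" for x y
    unfolding EJ by (rule g_J_J[OF p_top E_tan E_tan])
qed

definition RE where "RE x y z u = g p (Riem (E x) (E y) (E z) p) (E u p)"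

lemma Riem_E: 
  assumes "q \<in> U"
  shows "Riem (E x) (E y) (E z) q = D (E x) (D (E y) (E z)) q - D (E y) (D (E x) (E z)) q"
proof -
  have "D (lie_bracket M (E x) (E y)) (E z) q = D (\<lambda>q. 0) (E z) q"
    by (rule conn_cong1[OF U_open assms vf_bracket[OF U_open E_vf E_vf] E_vf vf_zero[OF openin_subset[OF U_open]]])
      (rule lie_bracket_cvec[OF c assms])
  then show ?thesis using conn_zero1[OF U_open assms E_vf] by (simp add: curvature_def)
qed

lemma conn_E_sym: "q \<in> U \<Longrightarrow> D (E x) (E y) q = D (E y) (E x) q"
  using torsion_free[OF U_open E_vf E_vf, of q x y] lie_bracket_cvec[OF c, of q x y] by simp

text \<open>For coordinate fields the bracket term disappears. Skewness in the last pair comes from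
  the equality of mixed second derivatives of a metric coefficient, the Bianchi identity from the
  symmetry of \<open>D (E x) (E y)\<close> in \<open>x\<close> and \<open>y\<close>.\<close>

lemma curvature_like_RE: "curvature_like RE"
  unfolding curvature_like_def
proof (intro conjI allI)
  fix x y z u
  note R_tan = Riem_tangent[OF U_open pU E_vf E_vf E_vf]
  have lin: "linear (\<lambda>x. Riem (E x) (E y) (E z) p)"
    by (rule tensorial_linear[OF tensorial_curvature1[OF U_open pU E_vf E_vf] c pU])
  show "linear (\<lambda>x. RE x y z u)"
    unfolding RE_def
    by (intro linearI) (simp_all add: linear_add[OF lin] linear_cmul[OF lin] g_add1[OF p_top] g_scale1[OF p_top] E_tan R_tan)
  show "RE y x z u = - RE x y z u"
    unfolding RE_def curvature_swap[OF U_open pU E_vf E_vf E_vf, of y x]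
    by (rule g_minus1[OF p_top R_tan E_tan])
  note D_vf = conn_vf[OF U_open E_vf E_vf] conn_vf[OF U_open E_vf conn_vf[OF U_open E_vf E_vf]]
  note D_tan = vf_tangent[OF D_vf(1)] vf_tangent[OF D_vf(2) pU]
  show "RE x y u z = - RE x y z u"
  proof -
    let ?f = "\<lambda>q. g q (E z q) (E u q)"
    have 1: "E x p (\<lambda>q. E y q ?f) = g p (D (E x) (D (E y) (E z)) p) (E u p) + g p (D (E y) (E z) p) (D (E x) (E u) p)
        + (g p (D (E x) (E z) p) (D (E y) (E u) p) + g p (E z p) (D (E x) (D (E y) (E u)) p))" for x y
    proof -
      have "E x p (\<lambda>q. E y q ?f) = E x p (\<lambda>q. g q (D (E y) (E z) q) (E u q) + g q (E z q) (D (E y) (E u) q))"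
        by (rule tv_cong[OF E_tan U_open pU]) (rule metric_compatible[OF U_open E_vf E_vf E_vf])
      then show ?thesis
        using tv_add[OF E_tan smooth_g[OF U_open D_vf(1) E_vf pU] smooth_g[OF U_open E_vf D_vf(1) pU]]
          metric_compatible[OF U_open E_vf D_vf(1) E_vf pU] metric_compatible[OF U_open E_vf E_vf D_vf(1) pU] by simp
    qed
    have sf: "smooth_at M p ?f" by (rule smooth_g[OF U_open E_vf E_vf pU])
    have 2: "E x p (\<lambda>q. E y q ?f) = E y p (\<lambda>q. E x q ?f)"
      using lie_bracket_apply[OF sf, of "E x" "E y"] lie_bracket_cvec[OF c pU, of x y] by simp
    note gs = g_sym[OF p_top D_tan(1)[OF pU] D_tan(1)[OF pU]] g_sym[OF p_top E_tan D_tan(2)]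
    from 2 show ?thesis
      unfolding 1 RE_def Riem_E[OF pU] g_diff1[OF p_top D_tan(2) E_tan D_tan(2)] gs(2)
      using gs(1)[of x z y u] gs(1)[of x u y z] by linarith
  qed
  show "RE x y z u + RE y z x u + RE z x y u = 0"
  proof -
    have s: "D (E x) (D (E y) (E z)) p = D (E x) (D (E z) (E y)) p" for x y z
      by (rule conn_cong2[OF U_open pU E_vf D_vf(1)]) (rule conn_E_sym)
    have "Riem (E x) (E y) (E z) p + Riem (E y) (E z) (E x) p + Riem (E z) (E x) (E y) p = 0"
      unfolding Riem_E[OF pU] s[of x z y] s[of y x z] s[of z y x] by simp
    moreover have "RE x y z u + RE y z x u + RE z x y u
      = g p (Riem (E x) (E y) (E z) p + Riem (E y) (E z) (E x) p + Riem (E z) (E x) (E y) p) (E u p)"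
      unfolding RE_def by (simp only: g_add1[OF p_top] R_tan E_tan tangent_add)
    ultimately show ?thesis using g_zero[OF p_top E_tan] by simp
  qed
qed

text \<open>As \<open>J\<close> is parallel, it commutes with the curvature operator; as it is
  self-adjoint for the metric, it moves to the last slot.\<close>

lemma RE_J: "RE x y (vcomp c (J p (E z p))) u = RE x y z (vcomp c (J p (E u p)))"
proof -
  note D_vf = conn_vf[OF U_open E_vf E_vf] conn_vf[OF U_open E_vf conn_vf[OF U_open E_vf E_vf]]
  note J_vf = vf_J[OF U_open E_vf]
  have DDJ: "D (E x) (D (E y) (\<lambda>q. J q (E z q))) p = J p (D (E x) (D (E y) (E z)) p)" for x y
    using conn_cong2[OF U_open pU E_vf conn_vf[OF U_open E_vf J_vf] conn_J[OF U_open E_vf E_vf]]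
      conn_J[OF U_open E_vf D_vf(1) pU] by metis
  have "Riem (E x) (E y) (E (vcomp c (J p (E z p)))) p = Riem (E x) (E y) (\<lambda>q. J q (E z q)) p"
    by (rule tensorial_cong[OF tensorial_curvature3[OF U_open pU E_vf E_vf] U_open pU E_vf U_open pU J_vf])
      (rule cvec_vcomp[OF c pU J_tangent[OF p_top E_tan]])
  also have "\<dots> = J p (Riem (E x) (E y) (E z) p)"
  proof -
    note B_vf = vf_bracket[OF U_open E_vf E_vf]
    have t: "D (E a) (D (E b) (E z)) p \<in> T p" for a b using vf_tangent[OF D_vf(2) pU] .
    have t': "D (lie_bracket M (E x) (E y)) (E z) p \<in> T p" using vf_tangent[OF conn_vf[OF U_open B_vf E_vf] pU] .
    show ?thesis
      unfolding curvature_def DDJ conn_J[OF U_open B_vf E_vf pU]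
      by (simp only: J_diff[OF p_top] t t' tangent_diff)
  qed
  finally show ?thesis
    unfolding RE_def cvec_vcomp[OF c pU J_tangent[OF p_top E_tan]]
    using g_J[OF p_top Riem_tangent[OF U_open pU E_vf E_vf E_vf] E_tan] by simp
qed

text \<open>Tensoriality replaces the given fields, slot by slot, by coordinate fields with the same
  value at \<open>p\<close>.\<close>

lemma Riem_RE:
  assumes V: "openin (mtop M) V" "p \<in> V" and X: "X \<in> VF V" and Y: "Y \<in> VF V" and Z: "Z \<in> VF V" and u: "u \<in> T p"
  shows "g p (Riem X Y Z p) u = RE (vcomp c (X p)) (vcomp c (Y p)) (vcomp c (Z p)) (vcomp c u)"
proof -
  note t = tensorial_cvec[OF _ c pU V]
  have W: "openin (mtop M) (U \<inter> V)" "p \<in> U \<inter> V" using U_open V pU by auto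
  note e = vf_subset[OF E_vf, of "U \<inter> V"] vf_subset[OF X, of "U \<inter> V"] vf_subset[OF Y, of "U \<inter> V"] vf_subset[OF Z, of "U \<inter> V"]
  have "Riem (E (vcomp c (X p))) (E (vcomp c (Y p))) (E (vcomp c (Z p))) p
      = Riem (E (vcomp c (X p))) (E (vcomp c (Y p))) Z p"
    by (rule t[OF tensorial_curvature3[OF W] Z]) (rule e, simp)+
  also have "\<dots> = Riem (E (vcomp c (X p))) Y Z p"
    by (rule t[OF tensorial_curvature2[OF W] Y]) (rule e, simp)+
  also have "\<dots> = Riem X Y Z p"
    by (rule t[OF tensorial_curvature1[OF W] X]) (rule e, simp)+
  finally show ?thesis unfolding RE_def cvec_vcomp[OF c pU u] by simp
qed

end

text \<open>The curvature hypothesis speaks of planes in a tangent space; its premises are verified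
  from the values on a basis, and then the algebraic theorem applies in chart coordinates.\<close>

theorem totally_real_curvature:
  assumes const: "const_totally_real_curvatures M J g D \<nu> \<nu>t"
    and V: "openin (mtop M) V" "p \<in> V" and X: "X \<in> VF V" and Y: "Y \<in> VF V" and Z: "Z \<in> VF V" and u: "u \<in> T p"
    and x0: "x0 \<in> T p" "g p x0 x0 \<noteq> 0" and y0: "y0 \<in> T p" "g p y0 y0 \<noteq> 0"
    and xy0: "g p x0 y0 = 0" "g p x0 (J p y0) = 0"
  shows "g p (Riem X Y Z p) u =
    \<nu> p * (pi1 (g p) (X p) (Y p) (Z p) u - pi2 (g p) (J p) (X p) (Y p) (Z p) u) + \<nu>t p * pi3 (g p) (J p) (X p) (Y p) (Z p) u"
proof -
  have p: "p \<in> topspace (mtop M)" using openin_subset[OF V(1)] V(2) by blast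
  obtain U c where c: "(U, c) \<in> charts M" and pU: "p \<in> U" using ex_chart[OF p] .
  let ?E = "\<lambda>w. cvec M U c w p" and ?v = "vcomp c"
  let ?g = "\<lambda>u v. g p (?E u) (?E v)" and ?J = "\<lambda>u. ?v (J p (?E u))"
  note Ev = cvec_vcomp[OF c pU] and Et = cvec_tangent[OF c pU]
  interpret N: norden_space ?g ?J by (rule norden_space[OF c pU])
  have EJ: "?E (?J u) = J p (?E u)" for u by (rule Ev[OF J_tangent[OF p Et]])
  let ?R = "RE U c p"
  have "?R x y z u = N.model (\<nu> p) (\<nu>t p) x y z u" for x y z u
  proof (rule N.totally_real_const_imp_model[OF curvature_like_RE[OF c pU] RE_J[OF c pU]])
    fix x y
    assume a: "?g x (?J x) = 0" "?g x (?J y) = 0" "?g y (?J y) = 0" "pi1 ?g x y y x \<noteq> 0"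
    have pi1: "pi1 (g p) (?E x) (?E y) (?E y) (?E x) = pi1 ?g x y y x" by (simp add: pi1_def)
    have ind: "\<forall>a b. a *\<^sub>t ?E x + b *\<^sub>t ?E y = 0 \<longrightarrow> a = 0 \<and> b = 0"
    proof (intro allI impI)
      fix \<alpha> \<beta> assume "\<alpha> *\<^sub>t ?E x + \<beta> *\<^sub>t ?E y = 0"
      then have "g p (\<alpha> *\<^sub>R ?E x + \<beta> *\<^sub>R ?E y) (?E x) = 0" "g p (\<alpha> *\<^sub>R ?E x + \<beta> *\<^sub>R ?E y) (?E y) = 0"
        using g_zero[OF p Et] by simp_all
      then have e: "\<alpha> * ?g x x + \<beta> * ?g y x = 0" "\<alpha> * ?g x y + \<beta> * ?g y y = 0"
        by (simp_all add: g_add1[OF p] g_scale1[OF p] Et tangent_scaleR)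
      \<comment> \<open>Cramer's rule for the system obtained by pairing with \<open>x\<close> and
        \<open>y\<close>: its determinant is \<open>pi1 ?g x y y x\<close>.\<close>
      have "\<alpha> * pi1 ?g x y y x = ?g y y * (\<alpha> * ?g x x + \<beta> * ?g y x) - ?g y x * (\<alpha> * ?g x y + \<beta> * ?g y y)"
        using N.g_sym[of x y] by (simp add: pi1_def algebra_simps)
      moreover have "\<beta> * pi1 ?g x y y x = ?g x x * (\<alpha> * ?g x y + \<beta> * ?g y y) - ?g x y * (\<alpha> * ?g x x + \<beta> * ?g y x)"
        using N.g_sym[of x y] by (simp add: pi1_def algebra_simps)
      ultimately show "\<alpha> = 0 \<and> \<beta> = 0" using a(4) unfolding e by simp
    qed
    have tr: "g p (J p v) w = 0" if v: "v \<in> plane (?E x) (?E y)" and w: "w \<in> plane (?E x) (?E y)" for v w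
    proof -
      obtain a1 b1 a2 b2 where vw: "v = a1 *\<^sub>R ?E x + b1 *\<^sub>R ?E y" "w = a2 *\<^sub>R ?E x + b2 *\<^sub>R ?E y"
        using v w by (auto simp: plane_def)
      have z: "g p (?E x) (J p (?E x)) = 0" "g p (?E x) (J p (?E y)) = 0" "g p (?E y) (J p (?E y)) = 0" "g p (?E y) (J p (?E x)) = 0"
        using a(1-3) g_J[OF p Et Et, of y x] g_sym[OF p J_tangent[OF p Et] Et, of y x] unfolding EJ by auto
      show ?thesis
        unfolding vw
        by (simp add: J_add[OF p] J_scale[OF p] g_add1[OF p] g_add2[OF p] g_scale1[OF p] g_scale2[OF p] Et
            tangent_scaleR tangent_add J_tangent[OF p] g_J[OF p Et Et] z)
    qed
    have vx: "\<exists>V. openin (mtop M) V \<and> p \<in> V \<and> vext M p (?E x) \<in> VF V \<and> vext M p (?E y) \<in> VF V"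
    proof -
      obtain V1 V2 where "openin (mtop M) V1" "p \<in> V1" "vext M p (?E x) \<in> VF V1"
        "openin (mtop M) V2" "p \<in> V2" "vext M p (?E y) \<in> VF V2"
        using ex_vext[OF p Et] by metis
      then show ?thesis by (intro exI[of _ "V1 \<inter> V2"]) (auto intro: vf_subset)
    qed
    then obtain V' where V': "openin (mtop M) V'" "p \<in> V'" "vext M p (?E x) \<in> VF V'" "vext M p (?E y) \<in> VF V'" by blast
    have R: "curvature4 M g D p (?E x) (?E y) (?E y) u = ?R x y y (?v u)" if u: "u \<in> T p" for u
      unfolding curvature4_def Riem_RE[OF c pU V'(1,2,3,4,4) u] vext_eq[OF p Et] vcomp_cvec[OF c pU] ..
    have "curvature4 M g D p (?E x) (?E y) (?E y) (?E x) / pi1 ?g x y y x = \<nu> p \<and>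
      curvature4 M g D p (?E x) (?E y) (?E y) (J p (?E x)) / pi1 ?g x y y x = \<nu>t p"
      using const p Et ind a(4) tr unfolding const_totally_real_curvatures_def pi1[symmetric] by blast
    then show "?R x y y x = \<nu> p * pi1 ?g x y y x \<and> ?R x y y (?J x) = \<nu>t p * pi1 ?g x y y x"
      using a(4) by (auto simp: R[OF Et] R[OF J_tangent[OF p Et]] vcomp_cvec[OF c pU] nonzero_divide_eq_eq)
  next
    show "N.G (?v x0) (?v x0) \<noteq> 0" "N.G (?v y0) (?v y0) \<noteq> 0" "N.G (?v x0) (?v y0) = 0"
      using x0 y0 xy0 by (simp_all add: N.G_def EJ Ev J_tangent[OF p] complex_eq_iff)
  qed
  then show ?thesis
    unfolding Riem_RE[OF c pU V X Y Z u]
    using vf_tangent[OF X V(2)] vf_tangent[OF Y V(2)] vf_tangent[OF Z V(2)] u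
    by (simp add: pi1_def pi2_def pi3_def EJ Ev)
qed

end

section \<open>Vector fields along a map\<close>

context manifold
begin

lemma smooth_at_nonzero:
  assumes "smooth_at M p f" "f p \<noteq> 0"
  obtains V where "openin (mtop M) V" "p \<in> V" "\<And>q. q \<in> V \<Longrightarrow> f q \<noteq> 0"
proof -
  obtain U c where c: "(U, c) \<in> charts M" "p \<in> U" using ex_chart[OF smooth_at_topspace[OF assms(1)]] .
  obtain S where S: "open S" "c p \<in> S" "S \<subseteq> c ` U" "smooth_on S (f \<circ> inv_into U c)"
    using assms(1) unfolding smooth_at_chart[OF c] by blast
  have "continuous_on S (f \<circ> inv_into U c)"
    using S(4) Ck_on.simps(1) unfolding smooth_on_def by blast
  then have R: "open (S \<inter> (f \<circ> inv_into U c) -` (- {0}))"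
    using S(1) by (rule continuous_open_preimage) auto
  show ?thesis
    by (rule that[OF chart_open_preimage[OF c(1) R]]) (use c S assms(2) chart_inv[OF c(1)] in auto)
qed

text \<open>Gaussian elimination: the solution of a linear system with smooth coefficients is smooth where
  the coefficient matrix has full rank.\<close>

lemma smooth_at_linear_system:
  fixes G :: "'i \<Rightarrow> 'j \<Rightarrow> 'a \<Rightarrow> real"
  assumes "finite I" and V: "openin (mtop M) V" "p \<in> V"
    and eq: "\<And>q j. q \<in> V \<Longrightarrow> j \<in> K \<Longrightarrow> (\<Sum>i\<in>I. w i q * G i j q) = k j q"
    and G: "\<And>i j. i \<in> I \<Longrightarrow> j \<in> K \<Longrightarrow> smooth_at M p (G i j)"
    and k: "\<And>j. j \<in> K \<Longrightarrow> smooth_at M p (k j)"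
    and inj: "\<And>a. (\<And>j. j \<in> K \<Longrightarrow> (\<Sum>i\<in>I. a i * G i j p) = 0) \<Longrightarrow> \<forall>i\<in>I. a i = 0"
    and i: "i \<in> I"
  shows "smooth_at M p (w i)"
  using assms
proof (induction I arbitrary: V G k i rule: finite_induct)
  case (insert i0 I)
  note V = insert.prems(1,2) and eq = insert.prems(3) and G = insert.prems(4) and k = insert.prems(5)
    and inj = insert.prems(6)
  \<comment> \<open>The pivot: \<open>inj\<close> applied to the unit vector at \<open>i0\<close>
    shows that some coefficient of the unknown \<open>i0\<close> is nonzero at \<open>p\<close>,
    hence near \<open>p\<close>.\<close>
  obtain j0 where j0: "j0 \<in> K" "G i0 j0 p \<noteq> 0"
  proof -
    have "\<exists>j\<in>K. (\<Sum>i\<in>insert i0 I. (if i = i0 then 1 else 0) * G i j p) \<noteq> 0"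
      using inj[of "\<lambda>i. if i = i0 then 1 else 0"] by auto
    moreover have "(\<Sum>i\<in>insert i0 I. (if i = i0 then 1 else 0) * G i j p) = G i0 j p" for j
    proof -
      have "(\<Sum>i\<in>I. (if i = i0 then 1 else 0) * G i j p) = 0"
        using insert.hyps by (intro sum.neutral) auto
      then show ?thesis using insert.hyps by simp
    qed
    ultimately show ?thesis using that by auto
  qed
  obtain W where W: "openin (mtop M) W" "p \<in> W" "\<And>q. q \<in> W \<Longrightarrow> G i0 j0 q \<noteq> 0"
    using smooth_at_nonzero[OF G[of i0 j0] j0(2)] j0(1) by auto
  have VW: "openin (mtop M) (V \<inter> W)" "p \<in> V \<inter> W" using V W by auto
  have e: "w i0 q * G i0 j q + (\<Sum>i\<in>I. w i q * G i j q) = k j q" if "q \<in> V" "j \<in> K" for q j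
    using eq[OF that] insert.hyps by simp
  have smI: "smooth_at M p (w i)" if "i \<in> I" for i
  proof (rule insert.IH[where G = "\<lambda>i j q. G i j q - G i j0 q * G i0 j q / G i0 j0 q"
        and k = "\<lambda>j q. k j q - k j0 q * G i0 j q / G i0 j0 q", OF VW])
    fix q j assume q: "q \<in> V \<inter> W" and j: "j \<in> K"
    have "(\<Sum>i\<in>I. w i q * (G i j q - G i j0 q * G i0 j q / G i0 j0 q))
      = (\<Sum>i\<in>I. w i q * G i j q) - (\<Sum>i\<in>I. w i q * G i j0 q) * (G i0 j q / G i0 j0 q)"
      by (simp add: sum_subtractf sum_distrib_right right_diff_distrib sum_divide_distrib mult.assoc)
    also have "\<dots> = (k j q - w i0 q * G i0 j q) - (k j0 q - w i0 q * G i0 j0 q) * (G i0 j q / G i0 j0 q)"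
    proof -
      have "(\<Sum>i\<in>I. w i q * G i j q) = k j q - w i0 q * G i0 j q"
        "(\<Sum>i\<in>I. w i q * G i j0 q) = k j0 q - w i0 q * G i0 j0 q"
        using e[of q j] e[of q j0] q j j0(1) by auto
      then show ?thesis by (simp only:)
    qed
    also have "\<dots> = k j q - k j0 q * G i0 j q / G i0 j0 q"
      using W(3)[of q] q by (simp add: field_simps)
    finally show "(\<Sum>i\<in>I. w i q * (G i j q - G i j0 q * G i0 j q / G i0 j0 q)) = k j q - k j0 q * G i0 j q / G i0 j0 q" .
  next
    fix i j assume "i \<in> I" "j \<in> K"
    then show "smooth_at M p (\<lambda>q. G i j q - G i j0 q * G i0 j q / G i0 j0 q)"
      using j0 by (intro smooth_at_diff smooth_at_divide smooth_at_mult G) auto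
  next
    fix j assume "j \<in> K"
    then show "smooth_at M p (\<lambda>q. k j q - k j0 q * G i0 j q / G i0 j0 q)"
      using j0 by (intro smooth_at_diff smooth_at_divide smooth_at_mult G k) auto
  next
    fix a :: "'i \<Rightarrow> real"
    assume a: "\<And>j. j \<in> K \<Longrightarrow> (\<Sum>i\<in>I. a i * (G i j p - G i j0 p * G i0 j p / G i0 j0 p)) = 0"
    \<comment> \<open>A relation for the reduced system extends to the full system once its
      \<open>i0\<close>-component is solved from the pivot equation; this transfers the full
      rank.\<close>
    define a' where "a' i = (if i = i0 then - (\<Sum>i\<in>I. a i * G i j0 p) / G i0 j0 p else a i)" for i
    have "\<forall>i\<in>insert i0 I. a' i = 0"
    proof (rule inj)
      fix j assume j: "j \<in> K"
      have "(\<Sum>i\<in>I. a' i * G i j p) = (\<Sum>i\<in>I. a i * G i j p)"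
        using insert.hyps by (intro sum.cong) (auto simp: a'_def)
      then have "(\<Sum>i\<in>insert i0 I. a' i * G i j p)
        = (\<Sum>i\<in>I. a i * G i j p) - (\<Sum>i\<in>I. a i * G i j0 p) * (G i0 j p / G i0 j0 p)"
        using insert.hyps by (simp add: a'_def)
      also have "\<dots> = (\<Sum>i\<in>I. a i * (G i j p - G i j0 p * G i0 j p / G i0 j0 p))"
        by (simp add: sum_subtractf sum_distrib_right right_diff_distrib sum_divide_distrib mult.assoc)
      finally show "(\<Sum>i\<in>insert i0 I. a' i * G i j p) = 0" using a[OF j] by simp
    qed
    then have a': "a' i = 0" if "i \<in> I" for i using that by blast
    show "\<forall>i\<in>I. a i = 0"
    proof
      fix i assume "i \<in> I"
      moreover from this have "i \<noteq> i0" using insert.hyps by blast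
      ultimately show "a i = 0" using a'[of i] by (simp add: a'_def)
    qed
  qed (use that in auto)
  have "smooth_at M p (\<lambda>q. (k j0 q - (\<Sum>i\<in>I. w i q * G i j0 q)) / G i0 j0 q)"
    using j0 openin_subset[OF V(1)] V(2)
    by (intro smooth_at_divide smooth_at_diff smooth_at_sum smooth_at_mult G k smI) auto
  then have "smooth_at M p (w i0)"
  proof (rule smooth_at_cong[OF VW, rotated])
    fix q assume "q \<in> V \<inter> W"
    then show "(k j0 q - (\<Sum>i\<in>I. w i q * G i j0 q)) / G i0 j0 q = w i0 q"
      using e[of q j0] j0(1) W(3)[of q] by (simp add: field_simps)
  qed
  then show ?case using insert.prems(7) smI by auto
qed simp

end

locale smooth_map = manifold M + A: manifold M'
  for M :: "('a, 'e::euclidean_space) mfd" and M' :: "('b, 'f::euclidean_space) mfd" +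
  fixes \<iota> :: "'a \<Rightarrow> 'b"
  assumes continuous_map: "continuous_map (mtop M) (mtop M') \<iota>"
    and smooth_at_pullback: "\<And>p h. p \<in> topspace (mtop M) \<Longrightarrow> smooth_at M' (\<iota> p) h \<Longrightarrow> smooth_at M p (\<lambda>q. h (\<iota> q))"
begin

abbreviation "d\<iota> \<equiv> differential M' \<iota>"

lemma d_apply: "smooth_at M' (\<iota> p) h \<Longrightarrow> d\<iota> p v h = v (\<lambda>q. h (\<iota> q))"
  by (simp add: differential_def o_def)

lemma linear_d: "linear (d\<iota> p)"
  by (intro linearI) (auto simp: differential_def scaleR_fun_apply)

lemma d_tangent:
  assumes "p \<in> topspace (mtop M)" "v \<in> T p"
  shows "d\<iota> p v \<in> A.T (\<iota> p)"
proof -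
  note s = smooth_at_pullback[OF assms(1)]
  show ?thesis
    unfolding tangent_space_def
    by (auto simp: d_apply A.smooth_at_add A.smooth_at_mult A.smooth_at_cmult s
        tv_add[OF assms(2)] tv_mult[OF assms(2)] tv_cmult[OF assms(2)]) (simp add: differential_def)
qed

lemma open_preimage: "openin (mtop M') W \<Longrightarrow> openin (mtop M) {q \<in> topspace (mtop M). \<iota> q \<in> W}"
  using continuous_map by (rule openin_continuous_map_preimage)

text \<open>Sections of the pulled-back tangent bundle. At each point smoothness is tested on
  ambient functions that are smooth near its image.\<close>

definition vfields_along :: "'a set \<Rightarrow> ('a \<Rightarrow> 'b tvec) set" where
  "vfields_along V = {W. \<forall>q\<in>V. W q \<in> A.T (\<iota> q) \<and> (\<forall>h. smooth_at M' (\<iota> q) h \<longrightarrow> smooth_at M q (\<lambda>r. W r h))}"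

lemma af_tangent: "W \<in> vfields_along V \<Longrightarrow> q \<in> V \<Longrightarrow> W q \<in> A.T (\<iota> q)"
  and af_smooth: "W \<in> vfields_along V \<Longrightarrow> q \<in> V \<Longrightarrow> smooth_at M' (\<iota> q) h \<Longrightarrow> smooth_at M q (\<lambda>r. W r h)"
  and af_subset: "W \<in> vfields_along V \<Longrightarrow> V' \<subseteq> V \<Longrightarrow> W \<in> vfields_along V'"
  by (auto simp: vfields_along_def)

lemma af_add: "W \<in> vfields_along V \<Longrightarrow> Z \<in> vfields_along V \<Longrightarrow> (\<lambda>q. W q + Z q) \<in> vfields_along V"
  by (auto simp: vfields_along_def intro!: smooth_at_add)

lemma af_scale: "SF V f \<Longrightarrow> W \<in> vfields_along V \<Longrightarrow> (\<lambda>q. f q *\<^sub>R W q) \<in> vfields_along V"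
  by (auto simp: vfields_along_def scaleR_fun_apply intro!: smooth_at_mult)

lemma af_diff: "W \<in> vfields_along V \<Longrightarrow> Z \<in> vfields_along V \<Longrightarrow> (\<lambda>q. W q - Z q) \<in> vfields_along V"
  by (auto simp: vfields_along_def intro!: smooth_at_diff)

lemma af_zero: "V \<subseteq> topspace (mtop M) \<Longrightarrow> (\<lambda>q. 0) \<in> vfields_along V"
  by (auto simp: vfields_along_def intro!: smooth_at_const)

lemma af_sum:
  assumes "V \<subseteq> topspace (mtop M)" "\<And>i. i \<in> I \<Longrightarrow> W i \<in> vfields_along V"
  shows "(\<lambda>q. \<Sum>i\<in>I. W i q) \<in> vfields_along V"
  using assms(2)
  by (induction I rule: infinite_finite_induct) (auto intro: af_zero[OF assms(1)] af_add)

lemma af_cong: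
  assumes "openin (mtop M) V" "\<And>q. q \<in> V \<Longrightarrow> W q = Z q" "W \<in> vfields_along V"
  shows "Z \<in> vfields_along V"
  unfolding vfields_along_def
proof (intro CollectI ballI conjI allI impI)
  fix q f assume q: "q \<in> V" and f: "smooth_at M' (\<iota> q) f"
  show "smooth_at M q (\<lambda>r. Z r f)"
    by (rule smooth_at_cong[OF assms(1) q _ af_smooth[OF assms(3) q f]]) (simp add: assms(2))
qed (use assms af_tangent in force)

lemma af_push:
  assumes V: "openin (mtop M) V" and X: "X \<in> VF V"
  shows "(\<lambda>q. d\<iota> q (X q)) \<in> vfields_along V"
  unfolding vfields_along_def
proof (intro CollectI ballI conjI allI impI)
  fix q assume q: "q \<in> V"
  then have qt: "q \<in> topspace (mtop M)" using openin_subset[OF V] by blast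
  show "d\<iota> q (X q) \<in> A.T (\<iota> q)" by (rule d_tangent[OF qt vf_tangent[OF X q]])
  fix h assume h: "smooth_at M' (\<iota> q) h"
  obtain W where W: "openin (mtop M') W" "\<iota> q \<in> W" "\<And>r. r \<in> W \<Longrightarrow> smooth_at M' r h"
    using A.smooth_at_open[OF h] by blast
  show "smooth_at M q (\<lambda>r. d\<iota> r (X r) h)"
    by (rule smooth_at_cong[OF open_preimage[OF W(1)] _ _ vf_smooth[OF X q smooth_at_pullback[OF qt h]]])
      (use qt W in \<open>auto simp: d_apply\<close>)
qed

lemma af_compose:
  assumes "V \<subseteq> topspace (mtop M)" "\<iota> ` V \<subseteq> V'" "Z \<in> A.VF V'"
  shows "(\<lambda>q. Z (\<iota> q)) \<in> vfields_along V"
  using assms A.vf_tangent[OF assms(3)] smooth_at_pullback A.vf_smooth[OF assms(3)]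
  unfolding vfields_along_def by blast

end

section \<open>The pulled-back connection\<close>

locale pullback_conn = smooth_map M M' \<iota> + A: connection M' D'
  for M :: "('a, 'e::euclidean_space) mfd" and M' :: "('b, 'f::euclidean_space) mfd" and \<iota> and D' +
  fixes U' c' V
  assumes chart': "(U', c') \<in> charts M'" and V_open: "openin (mtop M) V" and V_U': "\<iota> ` V \<subseteq> U'"
begin

abbreviation "E' \<equiv> cvec M' U' c'"
abbreviation "co b \<equiv> (\<lambda>r. c' r \<bullet> b)"

lemma V_top: "V \<subseteq> topspace (mtop M)" by (rule openin_subset[OF V_open])
lemma \<iota>_U': "q \<in> V \<Longrightarrow> \<iota> q \<in> U'" using V_U' by blast
lemmas U'_open = A.chart_open[OF chart']
lemmas E'_vf = A.vf_cvec[OF chart']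
lemmas E'_tan = A.cvec_tangent[OF chart' \<iota>_U']
lemmas E'_lin = A.linear_cvec[OF chart' \<iota>_U']
lemmas co_smooth = A.smooth_at_coord[OF chart' \<iota>_U']

lemma af_expand: "W \<in> vfields_along V \<Longrightarrow> q \<in> V \<Longrightarrow> W q = (\<Sum>b\<in>Basis. W q (co b) *\<^sub>R E' b (\<iota> q))"
  by (rule A.tangent_expand[OF chart' \<iota>_U' af_tangent])

lemma af_co: "W \<in> vfields_along V \<Longrightarrow> SF V (\<lambda>q. W q (co b))"
  using af_smooth co_smooth by blast

lemma af_comp: "Z \<in> A.VF U' \<Longrightarrow> (\<lambda>q. Z (\<iota> q)) \<in> vfields_along V"
  by (rule af_compose[OF V_top V_U'])

text \<open>Since \<open>V\<close> is mapped into one ambient chart, the coordinate fields frame the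
  pulled-back bundle. Hence sections over \<open>V\<close> are generated from restricted ambient
  fields by sums and smooth factors, up to their values off \<open>V\<close>.\<close>

lemma af_induct [consumes 1, case_names compose zero add scale cong]:
  assumes W: "W \<in> vfields_along V"
    and compose: "\<And>Z. Z \<in> A.VF U' \<Longrightarrow> P (\<lambda>q. Z (\<iota> q))"
    and zero: "P (\<lambda>q. 0)"
    and add: "\<And>W Z. W \<in> vfields_along V \<Longrightarrow> Z \<in> vfields_along V \<Longrightarrow> P W \<Longrightarrow> P Z \<Longrightarrow> P (\<lambda>q. W q + Z q)"
    and scale: "\<And>W f. W \<in> vfields_along V \<Longrightarrow> SF V f \<Longrightarrow> P W \<Longrightarrow> P (\<lambda>q. f q *\<^sub>R W q)"
    and cong: "\<And>W Z. W \<in> vfields_along V \<Longrightarrow> P W \<Longrightarrow> (\<And>q. q \<in> V \<Longrightarrow> W q = Z q) \<Longrightarrow> P Z"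
  shows "P W"
proof -
  have t: "(\<lambda>q. W q (co b) *\<^sub>R E' b (\<iota> q)) \<in> vfields_along V" "P (\<lambda>q. W q (co b) *\<^sub>R E' b (\<iota> q))" for b
    using af_scale[OF af_co[OF W] af_comp[OF E'_vf]] scale[OF af_comp[OF E'_vf] af_co[OF W] compose[OF E'_vf]] by auto
  have "(\<lambda>q. \<Sum>b\<in>B. W q (co b) *\<^sub>R E' b (\<iota> q)) \<in> vfields_along V \<and> P (\<lambda>q. \<Sum>b\<in>B. W q (co b) *\<^sub>R E' b (\<iota> q))"
    if "finite B" for B
    using that
  proof (induction B)
    case empty
    then show ?case using zero af_zero[OF V_top] by (simp only: sum.empty simp_thms)
  next
    case (insert b B)
    then show ?case using af_add[OF t(1)] add[OF t(1) _ t(2)] by (simp only: sum.insert simp_thms)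
  qed
  from this[OF finite_Basis] show ?thesis
    using cong[of "\<lambda>q. \<Sum>b\<in>Basis. W q (co b) *\<^sub>R E' b (\<iota> q)" W] af_expand[OF W] by simp
qed

text \<open>The pull-back of \<open>D'\<close> along \<open>\<iota>\<close>, computed in the coordinate frame of the chart \<open>c'\<close>.\<close>

definition Lv :: "'a \<Rightarrow> 'a tvec \<Rightarrow> ('a \<Rightarrow> 'b tvec) \<Rightarrow> 'b tvec" where
  "Lv q x W = (\<Sum>b\<in>Basis. x (\<lambda>r. W r (co b)) *\<^sub>R E' b (\<iota> q)
      + W q (co b) *\<^sub>R D' (E' (vcomp c' (d\<iota> q x))) (E' b) (\<iota> q))"

definition L :: "'a vfield \<Rightarrow> ('a \<Rightarrow> 'b tvec) \<Rightarrow> 'a \<Rightarrow> 'b tvec" where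
  "L X W q = Lv q (X q) W"

lemma D'_tan: "q \<in> V \<Longrightarrow> X \<in> A.VF U' \<Longrightarrow> Y \<in> A.VF U' \<Longrightarrow> D' X Y (\<iota> q) \<in> A.T (\<iota> q)"
  using A.vf_tangent[OF A.conn_vf[OF U'_open] \<iota>_U'] .

lemma Lv_tangent: "q \<in> V \<Longrightarrow> Lv q x W \<in> A.T (\<iota> q)"
  unfolding Lv_def by (intro A.tangent_sum A.tangent_add A.tangent_scaleR E'_tan D'_tan E'_vf)

lemma L_add2:
  assumes q: "q \<in> V" and x: "x \<in> T q" and W: "W \<in> vfields_along V" and Z: "Z \<in> vfields_along V"
  shows "Lv q x (\<lambda>q. W q + Z q) = Lv q x W + Lv q x Z"
proof -
  have "x (\<lambda>r. (W r + Z r) (co b)) = x (\<lambda>r. W r (co b)) + x (\<lambda>r. Z r (co b))" for b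
    using tv_add[OF x] af_co[OF W] af_co[OF Z] q by simp
  then show ?thesis
    unfolding Lv_def by (simp add: sum.distrib scaleR_left_distrib algebra_simps)
qed

lemma L_scale2:
  assumes q: "q \<in> V" and x: "x \<in> T q" and W: "W \<in> vfields_along V" and f: "SF V f"
  shows "Lv q x (\<lambda>q. f q *\<^sub>R W q) = x f *\<^sub>R W q + f q *\<^sub>R Lv q x W"
proof -
  have "x (\<lambda>r. (f r *\<^sub>R W r) (co b)) = f q * x (\<lambda>r. W r (co b)) + W q (co b) * x f" for b
    using tv_mult[OF x, of f "\<lambda>r. W r (co b)"] af_co[OF W] f q by (simp add: scaleR_fun_apply)
  then have "Lv q x (\<lambda>q. f q *\<^sub>R W q) = (\<Sum>b\<in>Basis. x f *\<^sub>R W q (co b) *\<^sub>R E' b (\<iota> q)) + f q *\<^sub>R Lv q x W"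
    unfolding Lv_def
    by (simp add: sum.distrib scaleR_left_distrib scaleR_right_distrib scaleR_sum_right scaleR_fun_apply algebra_simps)
  then show ?thesis
    using arg_cong[OF af_expand[OF W q], of "(*\<^sub>R) (x f)"] by (simp only: scaleR_sum_right)
qed

lemma L_cong2:
  assumes q: "q \<in> V" and x: "x \<in> T q" and eq: "\<And>r. r \<in> V \<Longrightarrow> W r = Z r"
  shows "Lv q x W = Lv q x Z"
proof -
  have "x (\<lambda>r. W r (co b)) = x (\<lambda>r. Z r (co b))" for b
    by (rule tv_cong[OF x V_open q]) (simp add: eq)
  then show ?thesis unfolding Lv_def eq[OF q] by simp
qed

lemma L_zero2: "q \<in> V \<Longrightarrow> x \<in> T q \<Longrightarrow> Lv q x (\<lambda>q. 0) = 0"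
  using L_add2[OF _ _ af_zero[OF V_top] af_zero[OF V_top], of q x] by simp

lemma L_diff2:
  assumes "q \<in> V" "x \<in> T q" "W \<in> vfields_along V" "Z \<in> vfields_along V"
  shows "Lv q x (\<lambda>q. W q - Z q) = Lv q x W - Lv q x Z"
  using L_add2[OF assms(1,2) af_diff[OF assms(3,4)] assms(4)] by simp

text \<open>The characteristic property of a pull-back: on restricted ambient fields the frame
  formula reproduces \<open>D'\<close>.\<close>

lemma L_compose:
  assumes q: "q \<in> V" and x: "x \<in> T q" and Z: "Z \<in> A.VF U'"
  shows "Lv q x (\<lambda>q. Z (\<iota> q)) = D' (E' (vcomp c' (d\<iota> q x))) Z (\<iota> q)"
proof -
  have qt: "q \<in> topspace (mtop M)" using V_top q by blast
  let ?X = "E' (vcomp c' (d\<iota> q x))"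
  note r = \<iota>_U'[OF q]
  have s: "A.SF U' (\<lambda>r. Z r (co b))" for b
    using A.vf_smooth[OF Z] A.smooth_at_coord[OF chart'] by blast
  have X: "?X (\<iota> q) = d\<iota> q x" by (rule A.cvec_vcomp[OF chart' r d_tangent[OF qt x]])
  have "D' ?X Z (\<iota> q) = D' ?X (\<lambda>r. \<Sum>b\<in>Basis. Z r (co b) *\<^sub>R E' b r) (\<iota> q)"
    by (rule A.conn_cong2[OF U'_open r E'_vf Z]) (rule A.vf_expand[OF chart' _ _ Z])
  also have "\<dots> = (\<Sum>b\<in>Basis. D' ?X (\<lambda>r. Z r (co b) *\<^sub>R E' b r) (\<iota> q))"
    by (rule A.conn_sum2[OF U'_open r E'_vf]) (rule A.vf_scale[OF s E'_vf])
  also have "\<dots> = (\<Sum>b\<in>Basis. x (\<lambda>r. Z (\<iota> r) (co b)) *\<^sub>R E' b (\<iota> q) + Z (\<iota> q) (co b) *\<^sub>R D' ?X (E' b) (\<iota> q))"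
    using A.conn_scale2[OF U'_open E'_vf E'_vf s r] X d_apply[of q _ x] s r by (intro sum.cong) auto
  finally show ?thesis unfolding Lv_def by simp
qed

lemma L_af:
  assumes X: "X \<in> VF V" and W: "W \<in> vfields_along V"
  shows "L X W \<in> vfields_along V"
proof -
  define dX where "dX q = d\<iota> q (X q)" for q
  have dX: "dX \<in> vfields_along V" unfolding dX_def by (rule af_push[OF V_open X])
  \<comment> \<open>The direction is expanded in the frame as well, which exhibits the result as a
    combination of restricted ambient fields with smooth coefficients.\<close>
  have e: "L X W q = (\<Sum>b\<in>Basis. X q (\<lambda>r. W r (co b)) *\<^sub>R E' b (\<iota> q)
      + W q (co b) *\<^sub>R (\<Sum>a\<in>Basis. dX q (co a) *\<^sub>R D' (E' a) (E' b) (\<iota> q)))" if q: "q \<in> V" for q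
    unfolding L_def Lv_def dX_def[symmetric]
    using linear_basis_expansion[OF A.tensorial_linear[OF A.tensorial_conn[OF U'_open \<iota>_U'[OF q] E'_vf] chart' \<iota>_U'[OF q]], of "vcomp c' (dX q)"]
    by (simp add: vcomp_inner)
  have "SF V (\<lambda>q. X q (\<lambda>r. W r (co b)))" for b
    using vf_smooth[OF X] af_co[OF W] by blast
  then have "(\<lambda>q. \<Sum>b\<in>Basis. X q (\<lambda>r. W r (co b)) *\<^sub>R E' b (\<iota> q)
      + W q (co b) *\<^sub>R (\<Sum>a\<in>Basis. dX q (co a) *\<^sub>R D' (E' a) (E' b) (\<iota> q))) \<in> vfields_along V"
    by (intro af_sum[OF V_top] af_add af_scale af_co[OF W] af_co[OF dX] af_comp E'_vf A.conn_vf[OF U'_open])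
  then show ?thesis
    by (rule af_cong[OF V_open e[symmetric], rotated])
qed

text \<open>The Christoffel parts agree by symmetry and cancel; the remaining second derivatives of
  the coordinates along \<open>\<iota>\<close> are the components of the pushed-forward
  bracket.\<close>

lemma L_torsion:
  assumes tor: "\<And>X Y p. X \<in> A.VF U' \<Longrightarrow> Y \<in> A.VF U' \<Longrightarrow> p \<in> U' \<Longrightarrow> D' X Y p - D' Y X p = lie_bracket M' X Y p"
    and X: "X \<in> VF V" and Y: "Y \<in> VF V" and q: "q \<in> V"
  shows "L X (\<lambda>q. d\<iota> q (Y q)) q - L Y (\<lambda>q. d\<iota> q (X q)) q = d\<iota> q (lie_bracket M X Y q)"
proof -
  have qt: "q \<in> topspace (mtop M)" using V_top q by blast
  note r = \<iota>_U'[OF q]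
  have sym: "D' (E' u) (E' v) (\<iota> q) = D' (E' v) (E' u) (\<iota> q)" for u v
    using tor[OF E'_vf E'_vf r, of u v] A.lie_bracket_cvec[OF chart' r, of u v] by simp
  have e: "L X (\<lambda>q. d\<iota> q (Y q)) q = (\<Sum>b\<in>Basis. X q (\<lambda>r. Y r (\<lambda>s. co b (\<iota> s))) *\<^sub>R E' b (\<iota> q))
      + D' (E' (vcomp c' (d\<iota> q (X q)))) (E' (vcomp c' (d\<iota> q (Y q)))) (\<iota> q)" if X: "X \<in> VF V" for X Y
  proof -
    have 1: "X q (\<lambda>r. d\<iota> r (Y r) (co b)) = X q (\<lambda>r. Y r (\<lambda>s. co b (\<iota> s)))" for b
      by (rule tv_cong[OF vf_tangent[OF X q] V_open q]) (rule d_apply[OF co_smooth])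
    have "D' (E' u) (E' v) (\<iota> q) = (\<Sum>b\<in>Basis. (v \<bullet> b) *\<^sub>R D' (E' u) (E' b) (\<iota> q))" for u v
      unfolding sym[of u] 
      by (rule linear_basis_expansion[OF A.tensorial_linear[OF A.tensorial_conn[OF U'_open r E'_vf] chart' r]])
    from this[of _ "vcomp c' (d\<iota> q (Y q))"] show ?thesis
      unfolding L_def Lv_def 1 by (simp add: sum.distrib vcomp_inner)
  qed
  have "L X (\<lambda>q. d\<iota> q (Y q)) q - L Y (\<lambda>q. d\<iota> q (X q)) q
      = (\<Sum>b\<in>Basis. lie_bracket M X Y q (\<lambda>s. co b (\<iota> s)) *\<^sub>R E' b (\<iota> q))"
    unfolding e[OF X] e[OF Y] sym[of "vcomp c' (d\<iota> q (X q))"]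
    by (simp add: lie_bracket_apply[OF smooth_at_pullback[OF qt co_smooth[OF q]]] scaleR_left_diff_distrib sum_subtractf)
  also have "\<dots> = d\<iota> q (lie_bracket M X Y q)"
    using A.tangent_expand[OF chart' r d_tangent[OF qt vf_tangent[OF vf_bracket[OF V_open X Y] q]]]
      d_apply[OF co_smooth[OF q]] by simp
  finally show ?thesis .
qed

lemma L_compose_vf:
  assumes q: "q \<in> V" and Y: "Y \<in> VF V" and Z: "Z \<in> A.VF U'"
  shows "L Y (\<lambda>q. Z (\<iota> q)) q = (\<Sum>a\<in>Basis. Y q (\<lambda>s. co a (\<iota> s)) *\<^sub>R D' (E' a) Z (\<iota> q))"
  unfolding L_def L_compose[OF q vf_tangent[OF Y q] Z]
    linear_basis_expansion[OF A.tensorial_linear[OF A.tensorial_conn[OF U'_open \<iota>_U'[OF q] Z] chart' \<iota>_U'[OF q]], of "vcomp c' (d\<iota> q (Y q))"]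
  using d_apply[OF co_smooth[OF q]] by (intro sum.cong) (simp_all add: vcomp_inner)

text \<open>Both sides are linear over smooth functions in \<open>W\<close>, so the induction
  reduces to restricted ambient fields. There the derivatives of the frame coefficients produce
  exactly the bracket term.\<close>

lemma L_curvature:
  assumes X: "X \<in> VF V" and Y: "Y \<in> VF V" and W: "W \<in> vfields_along V" and q: "q \<in> V"
  shows "L X (L Y W) q - L Y (L X W) q - L (lie_bracket M X Y) W q =
    A.Riem (E' (vcomp c' (d\<iota> q (X q)))) (E' (vcomp c' (d\<iota> q (Y q)))) (E' (vcomp c' (W q))) (\<iota> q)"
proof (rule af_induct[where P = "\<lambda>W. L X (L Y W) q - L Y (L X W) q - L (lie_bracket M X Y) W q =
    A.Riem (E' (vcomp c' (d\<iota> q (X q)))) (E' (vcomp c' (d\<iota> q (Y q)))) (E' (vcomp c' (W q))) (\<iota> q)", OF W],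
    goal_cases compose zero add scale cong)
  let ?X = "vcomp c' (d\<iota> q (X q))" and ?Y = "vcomp c' (d\<iota> q (Y q))"
  have qt: "q \<in> topspace (mtop M)" using V_top q by blast
  note r = \<iota>_U'[OF q]
  note XY = vf_bracket[OF V_open X Y]
  note Xq = vf_tangent[OF X q] and Yq = vf_tangent[OF Y q] and XYq = vf_tangent[OF XY q]
  note lin = A.tensorial_linear[OF A.tensorial_curvature3[OF U'_open r E'_vf E'_vf] chart' r]
  {
    case (compose Z)
    have Yc: "SF V (\<lambda>q. Y q (\<lambda>s. co a (\<iota> s)))" if Y: "Y \<in> VF V" for Y a
      using vf_smooth[OF Y] smooth_at_pullback co_smooth V_top by blast
    have DZ: "D' (E' a) Z \<in> A.VF U'" for a by (rule A.conn_vf[OF U'_open E'_vf compose])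
    have LL: "L X (L Y (\<lambda>q. Z (\<iota> q))) q = (\<Sum>a\<in>Basis. X q (\<lambda>q. Y q (\<lambda>s. co a (\<iota> s))) *\<^sub>R D' (E' a) Z (\<iota> q)
        + Y q (\<lambda>s. co a (\<iota> s)) *\<^sub>R D' (E' (vcomp c' (d\<iota> q (X q)))) (D' (E' a) Z) (\<iota> q))"
      if X: "X \<in> VF V" and Y: "Y \<in> VF V" for X Y
    proof -
      have t: "(\<lambda>q. Y q (\<lambda>s. co a (\<iota> s)) *\<^sub>R D' (E' a) Z (\<iota> q)) \<in> vfields_along V" for a
        by (rule af_scale[OF Yc[OF Y] af_comp[OF DZ]])
      have s: "(\<lambda>q. \<Sum>a\<in>B. Y q (\<lambda>s. co a (\<iota> s)) *\<^sub>R D' (E' a) Z (\<iota> q)) \<in> vfields_along V" for B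
        by (rule af_sum[OF V_top t])
      have sum: "Lv q (X q) (\<lambda>q. \<Sum>a\<in>B. Y q (\<lambda>s. co a (\<iota> s)) *\<^sub>R D' (E' a) Z (\<iota> q))
        = (\<Sum>a\<in>B. Lv q (X q) (\<lambda>q. Y q (\<lambda>s. co a (\<iota> s)) *\<^sub>R D' (E' a) Z (\<iota> q)))" if "finite B" for B
        using that
      proof (induction B)
        case empty
        then show ?case using L_zero2[OF q vf_tangent[OF X q]] by (simp only: sum.empty)
      next
        case (insert b B)
        then show ?case
          using L_add2[OF q vf_tangent[OF X q] t[of b] s[of B]] by (simp only: sum.insert[OF insert.hyps])
      qed
      have "L X (L Y (\<lambda>q. Z (\<iota> q))) q = Lv q (X q) (\<lambda>q. \<Sum>a\<in>Basis. Y q (\<lambda>s. co a (\<iota> s)) *\<^sub>R D' (E' a) Z (\<iota> q))"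
        unfolding L_def[of X] by (rule L_cong2[OF q vf_tangent[OF X q] L_compose_vf[OF _ Y compose]])
      then show ?thesis
        unfolding sum[OF finite_Basis] L_scale2[OF q vf_tangent[OF X q] af_comp[OF DZ] Yc[OF Y]] L_compose[OF q vf_tangent[OF X q] DZ] .
    qed
    \<comment> \<open>The coefficients are frozen at \<open>q\<close>; being constant on
      \<open>U'\<close>, they may be moved through the outer derivative.\<close>
    have R: "(\<Sum>a\<in>Basis. Y q (\<lambda>s. co a (\<iota> s)) *\<^sub>R D' (E' u) (D' (E' a) Z) (\<iota> q)) 
       = D' (E' u) (D' (E' (vcomp c' (d\<iota> q (Y q)))) Z) (\<iota> q)" if Y: "Y \<in> VF V" for Y u
    proof -
      let ?y = "vcomp c' (d\<iota> q (Y q))"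
      have k: "A.SF U' (\<lambda>_. a)" for a using A.smooth_at_const openin_subset[OF U'_open] by blast
      have "D' (E' u) (D' (E' ?y) Z) (\<iota> q) = D' (E' u) (\<lambda>r. \<Sum>a\<in>Basis. (?y \<bullet> a) *\<^sub>R D' (E' a) Z r) (\<iota> q)"
        by (rule A.conn_cong2[OF U'_open r E'_vf DZ])
          (rule linear_basis_expansion[OF A.tensorial_linear[OF A.tensorial_conn[OF U'_open _ compose] chart']])
      also have "\<dots> = (\<Sum>a\<in>Basis. D' (E' u) (\<lambda>r. (?y \<bullet> a) *\<^sub>R D' (E' a) Z r) (\<iota> q))"
        by (rule A.conn_sum2[OF U'_open r E'_vf A.vf_scale[OF k DZ]])
      also have "\<dots> = (\<Sum>a\<in>Basis. (?y \<bullet> a) *\<^sub>R D' (E' u) (D' (E' a) Z) (\<iota> q))"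
        using A.conn_scale2[OF U'_open E'_vf DZ k r] A.tv_const[OF E'_tan[OF q]] by simp
      finally show ?thesis using d_apply[OF co_smooth[OF q]] by (simp add: vcomp_inner)
    qed
    have "L X (L Y (\<lambda>q. Z (\<iota> q))) q - L Y (L X (\<lambda>q. Z (\<iota> q))) q - L (lie_bracket M X Y) (\<lambda>q. Z (\<iota> q)) q
      = D' (E' ?X) (D' (E' ?Y) Z) (\<iota> q) - D' (E' ?Y) (D' (E' ?X) Z) (\<iota> q)"
      unfolding LL[OF X Y] LL[OF Y X] L_compose_vf[OF q XY compose] sum.distrib R[OF X] R[OF Y]
      by (simp add: lie_bracket_apply[OF smooth_at_pullback[OF qt co_smooth[OF q]]] scaleR_left_diff_distrib sum_subtractf)
    also have "\<dots> = A.Riem (E' ?X) (E' ?Y) Z (\<iota> q)"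
    proof -
      have "D' (lie_bracket M' (E' ?X) (E' ?Y)) Z (\<iota> q) = D' (\<lambda>q. 0) Z (\<iota> q)"
        by (rule A.conn_cong1[OF U'_open r A.vf_bracket[OF U'_open E'_vf E'_vf] compose A.vf_zero[OF openin_subset[OF U'_open]]])
          (rule A.lie_bracket_cvec[OF chart' r])
      then show ?thesis using A.conn_zero1[OF U'_open r compose] by (simp add: curvature_def)
    qed
    also have "\<dots> = A.Riem (E' ?X) (E' ?Y) (E' (vcomp c' (Z (\<iota> q)))) (\<iota> q)"
      by (rule A.tensorial_cvec[OF A.tensorial_curvature3[OF U'_open r E'_vf E'_vf] chart' r U'_open r compose, symmetric])
    finally show ?case .
  next
    case zero
    have "L X (L Y (\<lambda>q. 0)) q = 0" if "X \<in> VF V" "Y \<in> VF V" for X Y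
    proof -
      have "L X (L Y (\<lambda>q. 0)) q = L X (\<lambda>q. 0) q"
        unfolding L_def[of X] by (rule L_cong2[OF q vf_tangent[OF that(1) q]]) (simp add: L_def L_zero2 vf_tangent[OF that(2)])
      then show ?thesis using L_zero2[OF q vf_tangent[OF that(1) q]] by (simp add: L_def)
    qed
    moreover have "L (lie_bracket M X Y) (\<lambda>q. 0) q = 0" unfolding L_def by (rule L_zero2[OF q XYq])
    ultimately show ?case using X Y linear_0[OF lin] linear_0[OF linear_vcomp[of c']] by simp
  next
    case (add W Z)
    have "L X (L Y (\<lambda>q. W q + Z q)) q = L X (L Y W) q + L X (L Y Z) q" if X: "X \<in> VF V" and Y: "Y \<in> VF V" for X Y
    proof -
      have "L X (L Y (\<lambda>q. W q + Z q)) q = Lv q (X q) (\<lambda>q. L Y W q + L Y Z q)"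
        unfolding L_def[of X]
        by (rule L_cong2[OF q vf_tangent[OF X q]]) (simp add: L_def L_add2[OF _ vf_tangent[OF Y] add(1,2)])
      then show ?thesis using L_add2[OF q vf_tangent[OF X q] L_af[OF Y add(1)] L_af[OF Y add(2)]] by (simp add: L_def[of X])
    qed
    moreover have "L (lie_bracket M X Y) (\<lambda>q. W q + Z q) q = L (lie_bracket M X Y) W q + L (lie_bracket M X Y) Z q"
      unfolding L_def by (rule L_add2[OF q XYq add(1,2)])
    ultimately show ?case
      using add(3,4) X Y linear_add[OF lin] linear_add[OF linear_vcomp[of c']] by (simp add: algebra_simps)
  next
    case (scale W f)
    have f: "smooth_at M q f" using scale q by blast
    have "L X (L Y (\<lambda>q. f q *\<^sub>R W q)) q = X q (\<lambda>q. Y q f) *\<^sub>R W q + Y q f *\<^sub>R L X W q + X q f *\<^sub>R L Y W q + f q *\<^sub>R L X (L Y W) q"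
      if X: "X \<in> VF V" and Y: "Y \<in> VF V" for X Y
    proof -
      have Yf: "SF V (\<lambda>q. Y q f)" using vf_smooth[OF Y] scale by blast
      have "L X (L Y (\<lambda>q. f q *\<^sub>R W q)) q = Lv q (X q) (\<lambda>q. Y q f *\<^sub>R W q + f q *\<^sub>R L Y W q)"
        unfolding L_def[of X]
        by (rule L_cong2[OF q vf_tangent[OF X q]]) (simp add: L_def L_scale2[OF _ vf_tangent[OF Y] scale(1,2)])
      also have "\<dots> = Lv q (X q) (\<lambda>q. Y q f *\<^sub>R W q) + Lv q (X q) (\<lambda>q. f q *\<^sub>R L Y W q)"
        by (rule L_add2[OF q vf_tangent[OF X q] af_scale[OF Yf scale(1)] af_scale[OF scale(2) L_af[OF Y scale(1)]]])
      also have "\<dots> = X q (\<lambda>q. Y q f) *\<^sub>R W q + Y q f *\<^sub>R L X W q + X q f *\<^sub>R L Y W q + f q *\<^sub>R L X (L Y W) q"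
        unfolding L_scale2[OF q vf_tangent[OF X q] scale(1) Yf] L_scale2[OF q vf_tangent[OF X q] L_af[OF Y scale(1)] scale(2)]
        by (simp add: L_def[of X])
      finally show ?thesis .
    qed
    moreover have "L (lie_bracket M X Y) (\<lambda>q. f q *\<^sub>R W q) q
      = (X q (\<lambda>q. Y q f) - Y q (\<lambda>q. X q f)) *\<^sub>R W q + f q *\<^sub>R L (lie_bracket M X Y) W q"
      unfolding L_def using L_scale2[OF q XYq scale(1,2)] lie_bracket_apply[OF f] by simp
    ultimately have "L X (L Y (\<lambda>q. f q *\<^sub>R W q)) q - L Y (L X (\<lambda>q. f q *\<^sub>R W q)) q - L (lie_bracket M X Y) (\<lambda>q. f q *\<^sub>R W q) q
      = f q *\<^sub>R (L X (L Y W) q - L Y (L X W) q - L (lie_bracket M X Y) W q)"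
      using X Y by (simp add: algebra_simps)
    then show ?case using scale(3) linear_cmul[OF lin] linear_cmul[OF linear_vcomp[of c']] by simp
  next
    case (cong W Z)
    have "L X (L Y Z) q = L X (L Y W) q" if X: "X \<in> VF V" and Y: "Y \<in> VF V" for X Y
      unfolding L_def[of X]
      by (rule L_cong2[OF q vf_tangent[OF X q]]) (simp add: L_def L_cong2[OF _ vf_tangent[OF Y] cong(3), symmetric])
    moreover have "L (lie_bracket M X Y) Z q = L (lie_bracket M X Y) W q"
      unfolding L_def by (rule L_cong2[OF q XYq cong(3)[symmetric]])
    ultimately show ?case using cong(2) X Y cong(3)[OF q] by simp
  }
qed

end

section \<open>Real time-like hypersurfaces\<close>

locale hypersurface_chart = pullback_conn M M' \<iota> D' U' c' V + A: kaehler_norden_mfd M' D' g' J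
  for M :: "('a, 'e::euclidean_space) mfd" and M' :: "('b, 'f::euclidean_space) mfd" and \<iota> D' U' c' V g' J +
  fixes U c N
  assumes chart: "(U, c) \<in> charts M" and V_U: "V \<subseteq> U"
    and dim: "DIM('f) = DIM('e) + 1" "DIM('e) \<ge> 2"
    and inj_d: "\<And>q. q \<in> V \<Longrightarrow> inj_on (d\<iota> q) (T q)"
    and normal: "timelike_unit_normal M M' \<iota> g' N"
begin

abbreviation "E \<equiv> cvec M U c"
abbreviation "G \<equiv> \<lambda>q. g' (\<iota> q)"
abbreviation "JJ \<equiv> \<lambda>q. J (\<iota> q)"
abbreviation "TT \<equiv> \<lambda>q. A.T (\<iota> q)"

lemma q_top: "q \<in> V \<Longrightarrow> q \<in> topspace (mtop M)" using V_top by blast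
lemma \<iota>_top: "q \<in> V \<Longrightarrow> \<iota> q \<in> topspace (mtop M')"
  using \<iota>_U' openin_subset[OF U'_open] by blast
lemma E_vf: "E w \<in> VF V" by (rule vf_subset[OF vf_cvec[OF chart] V_U])
lemma q_U: "q \<in> V \<Longrightarrow> q \<in> U" using V_U by blast
lemma d_tan: "q \<in> V \<Longrightarrow> x \<in> T q \<Longrightarrow> d\<iota> q x \<in> TT q" using d_tangent q_top by blast

lemmas G_sym = A.g_sym[OF \<iota>_top]
  and G_add1 = A.g_add1[OF \<iota>_top] and G_add2 = A.g_add2[OF \<iota>_top]
  and G_scale1 = A.g_scale1[OF \<iota>_top] and G_scale2 = A.g_scale2[OF \<iota>_top]
  and G_minus1 = A.g_minus1[OF \<iota>_top] and G_minus2 = A.g_minus2[OF \<iota>_top]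
  and G_diff1 = A.g_diff1[OF \<iota>_top] and G_diff2 = A.g_diff2[OF \<iota>_top]
  and G_zero1 = A.g_zero(1)[OF \<iota>_top] and G_zero2 = A.g_zero(2)[OF \<iota>_top]
  and G_J = A.g_J[OF \<iota>_top] and G_J_J = A.g_J_J[OF \<iota>_top]
  and J_tan = A.J_tangent[OF \<iota>_top] and J_J = A.J_J[OF \<iota>_top]
  and J_add = A.J_add[OF \<iota>_top] and J_scale = A.J_scale[OF \<iota>_top]
  and J_diff = A.J_diff[OF \<iota>_top] and J_minus = A.J_minus[OF \<iota>_top] and J_zero = A.J_zero[OF \<iota>_top]

lemmas G_lin = G_add1 G_add2 G_scale1 G_scale2 G_minus1 G_minus2 G_diff1 G_diff2 G_zero1 G_zero2

lemma TT_closed [intro]: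
  "v \<in> TT q \<Longrightarrow> w \<in> TT q \<Longrightarrow> v + w \<in> TT q" "v \<in> TT q \<Longrightarrow> w \<in> TT q \<Longrightarrow> v - w \<in> TT q"
  "v \<in> TT q \<Longrightarrow> a *\<^sub>R v \<in> TT q" "v \<in> TT q \<Longrightarrow> - v \<in> TT q"
  by (rule A.tangent_add A.tangent_diff A.tangent_scaleR A.tangent_minus; assumption)+

section \<open>Metric compatibility and parallel complex structure along the map\<close>

definition compat :: "('a \<Rightarrow> 'b tvec) \<Rightarrow> ('a \<Rightarrow> 'b tvec) \<Rightarrow> bool" where
  "compat W Z \<longleftrightarrow> (\<forall>q\<in>V. smooth_at M q (\<lambda>r. G r (W r) (Z r)) \<and>
     (\<forall>x\<in>T q. x (\<lambda>r. G r (W r) (Z r)) = G q (Lv q x W) (Z q) + G q (W q) (Lv q x Z)))"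

lemma compatD:
  assumes "compat W Z" "q \<in> V"
  shows "smooth_at M q (\<lambda>r. G r (W r) (Z r))"
    and "x \<in> T q \<Longrightarrow> x (\<lambda>r. G r (W r) (Z r)) = G q (Lv q x W) (Z q) + G q (W q) (Lv q x Z)"
  using assms unfolding compat_def by blast+

lemma compat_sym:
  assumes W: "W \<in> vfields_along V" and Z: "Z \<in> vfields_along V" and "compat W Z"
  shows "compat Z W"
  unfolding compat_def
proof (intro ballI conjI)
  fix q assume q: "q \<in> V"
  have s: "G r (Z r) (W r) = G r (W r) (Z r)" if "r \<in> V" for r
    by (rule G_sym[OF that af_tangent[OF Z that] af_tangent[OF W that]])
  show "smooth_at M q (\<lambda>r. G r (Z r) (W r))"
    by (rule smooth_at_cong[OF V_open q s[symmetric]]) (use assms(3) q in \<open>auto simp: compat_def\<close>)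
  fix x assume x: "x \<in> T q"
  have "x (\<lambda>r. G r (Z r) (W r)) = x (\<lambda>r. G r (W r) (Z r))" by (rule tv_cong[OF x V_open q s])
  then show "x (\<lambda>r. G r (Z r) (W r)) = G q (Lv q x Z) (W q) + G q (Z q) (Lv q x W)"
    using compatD(2)[OF assms(3) q x] G_sym[OF q Lv_tangent[OF q] af_tangent[OF W q], of x Z]
      G_sym[OF q Lv_tangent[OF q] af_tangent[OF Z q], of x W] by linarith
qed

text \<open>Smoothness of the inner product is part of \<open>compat\<close> because the sum and
  product rules in the induction steps require it.\<close>

lemma compat_induct:
  assumes Z: "Z \<in> vfields_along V" and W: "W \<in> vfields_along V" and c: "\<And>Y. Y \<in> A.VF U' \<Longrightarrow> compat (\<lambda>q. Y (\<iota> q)) Z"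
  shows "compat W Z"
proof (rule af_induct[where P = "\<lambda>W. compat W Z", OF W], goal_cases compose zero add scale cong)
  note Zq = af_tangent[OF Z]
  {
    case (compose Y)
    then show ?case by (rule c)
  next
    case zero
    have 0: "G r 0 (Z r) = 0" if "r \<in> V" for r by (rule G_zero1[OF that Zq[OF that]])
    show ?case
      unfolding compat_def
    proof (intro ballI conjI)
      fix q assume q: "q \<in> V"
      show "smooth_at M q (\<lambda>r. G r 0 (Z r))"
        by (rule smooth_at_cong[OF V_open q 0[symmetric] smooth_at_const[OF q_top[OF q]]])
      fix x assume x: "x \<in> T q"
      have "x (\<lambda>r. G r 0 (Z r)) = x (\<lambda>r. 0)" by (rule tv_cong[OF x V_open q 0])
      then show "x (\<lambda>r. G r 0 (Z r)) = G q (Lv q x (\<lambda>q. 0)) (Z q) + G q 0 (Lv q x Z)"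
        by (simp add: tv_const[OF x] L_zero2[OF q x] G_zero1[OF q] Zq[OF q] Lv_tangent[OF q])
    qed
  next
    case (add W Y)
    note Wt = af_tangent[OF add(1)] and Yt = af_tangent[OF add(2)]
    have e: "G r (W r + Y r) (Z r) = G r (W r) (Z r) + G r (Y r) (Z r)" if "r \<in> V" for r
      by (rule G_add1[OF that Wt[OF that] Zq[OF that] Yt[OF that]])
    show ?case
      unfolding compat_def
    proof (intro ballI conjI)
      fix q assume q: "q \<in> V"
      note s = compatD[OF add(3) q] compatD[OF add(4) q]
      show "smooth_at M q (\<lambda>r. G r (W r + Y r) (Z r))"
        by (rule smooth_at_cong[OF V_open q e[symmetric] smooth_at_add[OF s(1,3)]])
      fix x assume x: "x \<in> T q"
      have "x (\<lambda>r. G r (W r + Y r) (Z r)) = x (\<lambda>r. G r (W r) (Z r) + G r (Y r) (Z r))"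
        by (rule tv_cong[OF x V_open q e])
      also have "\<dots> = x (\<lambda>r. G r (W r) (Z r)) + x (\<lambda>r. G r (Y r) (Z r))"
        by (rule tv_add[OF x s(1,3)])
      finally show "x (\<lambda>r. G r (W r + Y r) (Z r)) = G q (Lv q x (\<lambda>q. W q + Y q)) (Z q) + G q (W q + Y q) (Lv q x Z)"
        using s(2)[OF x] s(4)[OF x] Wt[OF q] Yt[OF q] Zq[OF q] Lv_tangent[OF q]
        by (simp add: L_add2[OF q x add(1,2)] G_add1[OF q])
    qed
  next
    case (scale W f)
    note Wt = af_tangent[OF scale(1)]
    have e: "G r (f r *\<^sub>R W r) (Z r) = f r * G r (W r) (Z r)" if "r \<in> V" for r
      by (rule G_scale1[OF that Wt[OF that] Zq[OF that]])
    show ?case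
      unfolding compat_def
    proof (intro ballI conjI)
      fix q assume q: "q \<in> V"
      note s = compatD[OF scale(3) q]
      have f: "smooth_at M q f" using scale(2) q by blast
      show "smooth_at M q (\<lambda>r. G r (f r *\<^sub>R W r) (Z r))"
        by (rule smooth_at_cong[OF V_open q e[symmetric] smooth_at_mult[OF f s(1)]])
      fix x assume x: "x \<in> T q"
      have "x (\<lambda>r. G r (f r *\<^sub>R W r) (Z r)) = x (\<lambda>r. f r * G r (W r) (Z r))"
        by (rule tv_cong[OF x V_open q e])
      also have "\<dots> = f q * x (\<lambda>r. G r (W r) (Z r)) + G q (W q) (Z q) * x f"
        by (rule tv_mult[OF x f s(1)])
      finally show "x (\<lambda>r. G r (f r *\<^sub>R W r) (Z r)) = G q (Lv q x (\<lambda>q. f q *\<^sub>R W q)) (Z q) + G q (f q *\<^sub>R W q) (Lv q x Z)"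
        using s(2)[OF x] Wt[OF q] Zq[OF q] Lv_tangent[OF q]
        by (simp add: L_scale2[OF q x scale(1,2)] G_add1[OF q] G_scale1[OF q] A.tangent_scaleR algebra_simps)
    qed
  next
    case (cong W Y)
    show ?case
      unfolding compat_def
    proof (intro ballI conjI)
      fix q assume q: "q \<in> V"
      note s = compatD[OF cong(2) q]
      show "smooth_at M q (\<lambda>r. G r (Y r) (Z r))"
        by (rule smooth_at_cong[OF V_open q _ s(1)]) (simp add: cong(3))
      fix x assume x: "x \<in> T q"
      have "x (\<lambda>r. G r (Y r) (Z r)) = x (\<lambda>r. G r (W r) (Z r))"
        by (rule tv_cong[OF x V_open q]) (simp add: cong(3))
      moreover have "Lv q x Y = Lv q x W" by (rule L_cong2[OF q x cong(3)[symmetric]])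
      ultimately show "x (\<lambda>r. G r (Y r) (Z r)) = G q (Lv q x Y) (Z q) + G q (Y q) (Lv q x Z)"
        using s(2)[OF x] cong(3)[OF q] by simp
    qed
  }
qed

lemma compat_compose:
  assumes Y: "Y \<in> A.VF U'" and Z: "Z \<in> A.VF U'"
  shows "compat (\<lambda>q. Y (\<iota> q)) (\<lambda>q. Z (\<iota> q))"
  unfolding compat_def
proof (intro ballI conjI)
  fix q assume q: "q \<in> V"
  note s = A.smooth_g[OF U'_open Y Z \<iota>_U'[OF q]]
  show "smooth_at M q (\<lambda>r. G r (Y (\<iota> r)) (Z (\<iota> r)))"
    by (rule smooth_at_pullback[OF q_top[OF q] s])
  fix x assume x: "x \<in> T q"
  have "x (\<lambda>r. G r (Y (\<iota> r)) (Z (\<iota> r))) = d\<iota> q x (\<lambda>r. g' r (Y r) (Z r))"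
    by (rule d_apply[OF s, symmetric])
  also have "\<dots> = E' (vcomp c' (d\<iota> q x)) (\<iota> q) (\<lambda>r. g' r (Y r) (Z r))"
    unfolding A.cvec_vcomp[OF chart' \<iota>_U'[OF q] d_tan[OF q x]] ..
  finally show "x (\<lambda>r. G r (Y (\<iota> r)) (Z (\<iota> r))) = G q (Lv q x (\<lambda>q. Y (\<iota> q))) (Z (\<iota> q)) + G q (Y (\<iota> q)) (Lv q x (\<lambda>q. Z (\<iota> q)))"
    using A.metric_compatible[OF U'_open E'_vf Y Z \<iota>_U'[OF q]] by (simp add: L_compose[OF q x Y] L_compose[OF q x Z])
qed

text \<open>Induction on the first section reduces it to a restricted ambient field; by symmetry a
  second induction reduces the other one.\<close>

lemma compat: "W \<in> vfields_along V \<Longrightarrow> Z \<in> vfields_along V \<Longrightarrow> compat W Z"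
  by (rule compat_induct) (auto intro: compat_sym[OF _ _ compat_induct] af_comp compat_compose)

lemma G_smooth: "W \<in> vfields_along V \<Longrightarrow> Z \<in> vfields_along V \<Longrightarrow> SF V (\<lambda>r. G r (W r) (Z r))"
  and L_metric: "W \<in> vfields_along V \<Longrightarrow> Z \<in> vfields_along V \<Longrightarrow> q \<in> V \<Longrightarrow> x \<in> T q \<Longrightarrow>
    x (\<lambda>r. G r (W r) (Z r)) = G q (Lv q x W) (Z q) + G q (W q) (Lv q x Z)"
  using compat[of W Z] by (simp_all add: compat_def)

lemma J_af_L:
  assumes "W \<in> vfields_along V"
  shows "(\<lambda>q. JJ q (W q)) \<in> vfields_along V \<and> (\<forall>q\<in>V. \<forall>x\<in>T q. Lv q x (\<lambda>q. JJ q (W q)) = JJ q (Lv q x W))"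
proof (rule af_induct[where P = "\<lambda>W. (\<lambda>q. JJ q (W q)) \<in> vfields_along V \<and> (\<forall>q\<in>V. \<forall>x\<in>T q. Lv q x (\<lambda>q. JJ q (W q)) = JJ q (Lv q x W))", OF assms],
    goal_cases compose zero add scale cong)
  case (compose Z)
  note JZ = A.vf_J[OF U'_open compose]
  show ?case
    using af_comp[OF JZ] L_compose[OF _ _ JZ] L_compose[OF _ _ compose] A.conn_J[OF U'_open E'_vf compose \<iota>_U'] by simp
next
  case zero
  have e: "0 = JJ q 0" if "q \<in> V" for q using J_zero[OF that] by simp
  show ?case
    using af_cong[OF V_open e af_zero[OF V_top]] L_cong2[OF _ _ e] L_zero2 by (auto simp: e[symmetric])
next
  case (add W Z)
  have e: "JJ q (W q) + JJ q (Z q) = JJ q (W q + Z q)" if "q \<in> V" for q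
    using J_add[OF that af_tangent[OF add(1) that] af_tangent[OF add(2) that]] by simp
  have J: "(\<lambda>q. JJ q (W q)) \<in> vfields_along V" "(\<lambda>q. JJ q (Z q)) \<in> vfields_along V" using add by auto
  have "Lv q x (\<lambda>q. JJ q (W q + Z q)) = JJ q (Lv q x (\<lambda>q. W q + Z q))" if q: "q \<in> V" and x: "x \<in> T q" for q x
    using L_cong2[OF q x e] L_add2[OF q x J] L_add2[OF q x add(1,2)] add(3,4) q x J_add[OF q Lv_tangent[OF q] Lv_tangent[OF q]] by simp
  then show ?case using af_cong[OF V_open e af_add[OF J]] by blast
next
  case (scale W f)
  have e: "f q *\<^sub>R JJ q (W q) = JJ q (f q *\<^sub>R W q)" if "q \<in> V" for q
    using J_scale[OF that af_tangent[OF scale(1) that]] by simp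
  have J: "(\<lambda>q. JJ q (W q)) \<in> vfields_along V" using scale by auto
  have "Lv q x (\<lambda>q. JJ q (f q *\<^sub>R W q)) = JJ q (Lv q x (\<lambda>q. f q *\<^sub>R W q))" if q: "q \<in> V" and x: "x \<in> T q" for q x
    using L_cong2[OF q x e] L_scale2[OF q x J scale(2)] L_scale2[OF q x scale(1,2)] scale(3) q x
      J_add[OF q A.tangent_scaleR[OF af_tangent[OF scale(1) q]] A.tangent_scaleR[OF Lv_tangent[OF q]]]
      J_scale[OF q af_tangent[OF scale(1) q]] J_scale[OF q Lv_tangent[OF q]] by simp
  then show ?case using af_cong[OF V_open e af_scale[OF scale(2) J]] by blast
next
  case (cong W Z)
  have e: "JJ q (W q) = JJ q (Z q)" if "q \<in> V" for q using cong(3)[OF that] by simp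
  have "Lv q x (\<lambda>q. JJ q (Z q)) = JJ q (Lv q x Z)" if q: "q \<in> V" and x: "x \<in> T q" for q x
    using L_cong2[OF q x, of "\<lambda>q. JJ q (W q)" "\<lambda>q. JJ q (Z q)"] L_cong2[OF q x, of W Z] e cong(2,3) q x by simp
  moreover have "(\<lambda>q. JJ q (Z q)) \<in> vfields_along V"
    by (rule af_cong[OF V_open, of "\<lambda>q. JJ q (W q)"]) (use e cong(2) in auto)
  ultimately show ?case by blast
qed

lemma af_J: "W \<in> vfields_along V \<Longrightarrow> (\<lambda>q. JJ q (W q)) \<in> vfields_along V"
  and L_J: "W \<in> vfields_along V \<Longrightarrow> q \<in> V \<Longrightarrow> x \<in> T q \<Longrightarrow> Lv q x (\<lambda>q. JJ q (W q)) = JJ q (Lv q x W)"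
  using J_af_L by blast+

section \<open>The unit normal and the tangential vectors\<close>

lemma N_tan: "q \<in> V \<Longrightarrow> N q \<in> TT q"
  and N_N: "q \<in> V \<Longrightarrow> G q (N q) (N q) = - 1"
  and d_N: "q \<in> V \<Longrightarrow> x \<in> T q \<Longrightarrow> G q (d\<iota> q x) (N q) = 0"
  and N_af: "N \<in> vfields_along V"
  using normal q_top unfolding timelike_unit_normal_def vfields_along_def by blast+

text \<open>A dimension count: the image of the injective differential lies in the orthogonal
  complement of \<open>N\<close>, which is a proper subspace because \<open>g(N, N) = -1\<close>. In
  codimension one the two coincide.\<close>

lemma ex_tangent:
  assumes q: "q \<in> V" and w: "w \<in> TT q" "G q w (N q) = 0"
  shows "\<exists>x\<in>T q. d\<iota> q x = w"
proof -
  note cv = A.cvec_vcomp[OF chart' \<iota>_U'[OF q]]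
  define \<psi> where "\<psi> v = vcomp c' (d\<iota> q (E v q))" for v
  note El = linear_cvec[OF chart q_U[OF q]] and Et = cvec_tangent[OF chart q_U[OF q]]
  have lin: "linear \<psi>"
    unfolding \<psi>_def
    by (intro linearI) (simp_all add: linear_add[OF El] linear_cmul[OF El] linear_add[OF linear_d] linear_cmul[OF linear_d]
        linear_add[OF linear_vcomp] linear_cmul[OF linear_vcomp])
  have inj: "inj \<psi>"
  proof (rule injI)
    fix v w assume "\<psi> v = \<psi> w"
    then have "E' (\<psi> v) (\<iota> q) = E' (\<psi> w) (\<iota> q)" by simp
    then have "d\<iota> q (E v q) = d\<iota> q (E w q)" unfolding \<psi>_def cv[OF d_tan[OF q Et]] .
    then have "E v q = E w q" using inj_d[OF q] Et by (auto dest: inj_onD)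
    then show "v = w" using vcomp_cvec[OF chart q_U[OF q]] by metis
  qed
  define H where "H = {v. G q (E' v (\<iota> q)) (N q) = 0}"
  note E't = E'_tan[OF q] and E'l = E'_lin[OF q]
  have H: "subspace H"
    unfolding subspace_def H_def
    by (auto simp: linear_0[OF E'l] linear_add[OF E'l] linear_cmul[OF E'l] G_lin q E't N_tan[OF q])
  have "\<psi> ` UNIV \<subseteq> H" by (auto simp: H_def \<psi>_def cv[OF d_tan[OF q Et]] d_N[OF q Et])
  moreover have "subspace (\<psi> ` UNIV)" by (rule linear_subspace_image[OF lin subspace_UNIV])
  moreover have "dim H \<le> dim (\<psi> ` UNIV)"
  proof -
    have "dim (\<psi> ` UNIV) = DIM('e)" using dim_image_eq[OF lin, of UNIV] inj by simp
    moreover have "vcomp c' (N q) \<notin> H" by (simp add: H_def cv[OF N_tan[OF q]] N_N[OF q])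
    then have "H \<noteq> UNIV" by blast
    then have "dim H \<noteq> DIM('f)" using dim_eq_full[of H] H by (metis span_eq_iff)
    then have "dim H < DIM('f)" using dim_subset_UNIV[of H] by simp
    ultimately show ?thesis using dim by simp
  qed
  ultimately have "\<psi> ` UNIV = H" using subspace_dim_equal H by blast
  moreover have "vcomp c' w \<in> H" using w by (simp add: H_def cv)
  ultimately obtain v where "vcomp c' w = \<psi> v" by blast
  then have "w = d\<iota> q (E v q)" unfolding \<psi>_def using cv[OF w(1)] cv[OF d_tan[OF q Et]] by metis
  then show ?thesis using Et by blast
qed

lemma TT_eq_0:
  assumes q: "q \<in> V" and v: "v \<in> TT q" "G q v (N q) = 0" and d: "\<And>y. y \<in> T q \<Longrightarrow> G q v (d\<iota> q y) = 0"
  shows "v = 0"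
proof (rule A.g_nondegenerate[OF \<iota>_top[OF q] v(1)])
  fix w assume w: "w \<in> TT q"
  note N = N_tan[OF q]
  \<comment> \<open>The plus sign in the tangential projection comes from
    \<open>g(N, N) = -1\<close>.\<close>
  have "G q (w + G q w (N q) *\<^sub>R N q) (N q) = 0"
    using w N by (simp add: G_lin q A.tangent_scaleR N_N[OF q])
  then obtain y where y: "y \<in> T q" "d\<iota> q y = w + G q w (N q) *\<^sub>R N q"
    using ex_tangent[OF q, of "w + G q w (N q) *\<^sub>R N q"] w N by blast
  then show "G q v w = 0"
    using d[OF y(1)] w N v by (simp add: G_lin q A.tangent_scaleR)
qed

definition pb :: "'a \<Rightarrow> 'b tvec \<Rightarrow> 'a tvec" where
  "pb = tangent_pullback M M' \<iota>"

lemma pb: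
  assumes "q \<in> V" "w \<in> TT q" "G q w (N q) = 0"
  shows pb_tangent: "pb q w \<in> T q" and d_pb: "d\<iota> q (pb q w) = w"
proof -
  have "w \<in> d\<iota> q ` T q" using ex_tangent[OF assms] by blast
  then show "pb q w \<in> T q" "d\<iota> q (pb q w) = w"
    unfolding pb_def tangent_pullback_def by (rule inv_into_into, rule f_inv_into_f)
qed

lemma pb_d: "q \<in> V \<Longrightarrow> x \<in> T q \<Longrightarrow> pb q (d\<iota> q x) = x"
  unfolding pb_def tangent_pullback_def using inj_d by simp

lemma d_inj: "q \<in> V \<Longrightarrow> x \<in> T q \<Longrightarrow> y \<in> T q \<Longrightarrow> d\<iota> q x = d\<iota> q y \<Longrightarrow> x = y"
  using inj_d by (auto dest: inj_onD)

text \<open>The components of the pulled-back field solve a linear system with the Gram matrix of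
  the pushed coordinate frame. This matrix is smooth, and invertible because the induced metric is
  nondegenerate, so elimination shows the components smooth.\<close>

lemma vf_pb:
  assumes W: "W \<in> vfields_along V" and WN: "\<And>q. q \<in> V \<Longrightarrow> G q (W q) (N q) = 0"
  shows "(\<lambda>q. pb q (W q)) \<in> VF V"
proof -
  define X where "X q = pb q (W q)" for q
  have X: "X q \<in> T q" "d\<iota> q (X q) = W q" if "q \<in> V" for q
    unfolding X_def using pb[OF that af_tangent[OF W that] WN[OF that]] by auto
  define w where "w b q = X q (\<lambda>r. c r \<bullet> b)" for b q
  define dE where "dE a q = d\<iota> q (E a q)" for a q
  have dE: "dE a \<in> vfields_along V" for a unfolding dE_def by (rule af_push[OF V_open E_vf])
  have Xe: "X q = (\<Sum>b\<in>Basis. w b q *\<^sub>R E b q)" if "q \<in> V" for q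
    unfolding w_def by (rule tangent_expand[OF chart q_U[OF that] X(1)[OF that]])
  have sum: "G q (\<Sum>b\<in>B. f b *\<^sub>R dE b q) v = (\<Sum>b\<in>B. f b * G q (dE b q) v)"
    if q: "q \<in> V" and v: "v \<in> TT q" and "finite B" for B f q v
    using that(3)
  proof (induction B)
    case empty
    show ?case by (simp only: sum.empty G_zero1[OF q v])
  next
    case (insert b B)
    have "(\<Sum>b\<in>B. f b *\<^sub>R dE b q) \<in> TT q" by (intro A.tangent_sum A.tangent_scaleR af_tangent[OF dE q])
    then show ?case using insert af_tangent[OF dE q] v
      by (simp only: sum.insert[OF insert.hyps] G_add1[OF q] G_scale1[OF q] A.tangent_scaleR)
  qed
  have sw: "SF V (w b)" if b: "b \<in> Basis" for b
  proof
    fix q assume q: "q \<in> V"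
    show "smooth_at M q (w b)"
    proof (rule smooth_at_linear_system[OF finite_Basis V_open q, where K = Basis
          and G = "\<lambda>b a q. G q (dE b q) (dE a q)" and k = "\<lambda>a q. G q (W q) (dE a q)"])
      fix r a :: _ assume r: "r \<in> V"
      have "W r = (\<Sum>b\<in>Basis. w b r *\<^sub>R dE b r)"
        using X(2)[OF r] Xe[OF r] by (simp add: linear_sum[OF linear_d] linear_cmul[OF linear_d] dE_def)
      then show "(\<Sum>b\<in>Basis. w b r * G r (dE b r) (dE a r)) = G r (W r) (dE a r)"
        using sum[OF r af_tangent[OF dE r] finite_Basis] by simp
    next
      fix f :: "'e \<Rightarrow> real"
      assume f: "\<And>a. a \<in> Basis \<Longrightarrow> (\<Sum>b\<in>Basis. f b * G q (dE b q) (dE a q)) = 0"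
      define v where "v = (\<Sum>b\<in>Basis. f b *\<^sub>R b)"
      note Et = cvec_tangent[OF chart q_U[OF q]] and El = linear_cvec[OF chart q_U[OF q]]
      have dv: "d\<iota> q (E v q) = (\<Sum>b\<in>Basis. f b *\<^sub>R dE b q)"
        by (simp add: v_def linear_sum[OF El] linear_cmul[OF El] linear_sum[OF linear_d] linear_cmul[OF linear_d] dE_def)
      have 0: "G q (d\<iota> q (E v q)) (dE a q) = 0" if "a \<in> Basis" for a
        unfolding dv using sum[OF q af_tangent[OF dE q] finite_Basis] f[OF that] by simp
      have "d\<iota> q (E v q) = 0"
      proof (rule TT_eq_0[OF q d_tan[OF q Et] d_N[OF q Et]])
        fix y assume y: "y \<in> T q"
        have "d\<iota> q y = (\<Sum>b\<in>Basis. y (\<lambda>r. c r \<bullet> b) *\<^sub>R dE b q)"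
          using arg_cong[OF tangent_expand[OF chart q_U[OF q] y], of "d\<iota> q"]
          by (simp add: linear_sum[OF linear_d] linear_cmul[OF linear_d] dE_def)
        then have "G q (d\<iota> q y) (d\<iota> q (E v q)) = 0"
          using sum[OF q d_tan[OF q Et] finite_Basis] 0 G_sym[OF q af_tangent[OF dE q] d_tan[OF q Et]] by simp
        then show "G q (d\<iota> q (E v q)) (d\<iota> q y) = 0" using G_sym[OF q d_tan[OF q y] d_tan[OF q Et]] by simp
      qed
      then have "E v q = 0" using d_inj[OF q Et tangent_0] linear_0[OF linear_d] by metis
      then have "v = 0" using vcomp_cvec[OF chart q_U[OF q], of v] linear_0[OF linear_vcomp] by metis
      then show "\<forall>b\<in>Basis. f b = 0" by (simp add: v_def flip: euclidean_eq_iff[of v 0]) (metis inner_sum_left_Basis inner_zero_left v_def)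
    qed (use G_smooth[OF W dE] G_smooth[OF dE dE] q b in auto)
  qed
  have "(\<lambda>q. \<Sum>b\<in>Basis. w b q *\<^sub>R E b q) \<in> VF V"
    using sw E_vf by (intro vf_sum[OF V_top] vf_scale) auto
  then have "X \<in> VF V" by (rule vf_cong[OF V_open Xe[symmetric], rotated])
  then show ?thesis by (simp add: X_def[abs_def])
qed

end

section \<open>The almost contact structure of the hypersurface\<close>

context hypersurface_chart
begin

abbreviation "tt \<equiv> normal_angle \<iota> J g' N"
abbreviation "ct q \<equiv> cos (tt q)"
abbreviation "st q \<equiv> sin (tt q)"
abbreviation "JN q \<equiv> JJ q (N q)"
definition "xi' q = st q *\<^sub>R N q + ct q *\<^sub>R JN q"
abbreviation "xi \<equiv> hyp_xi M M' \<iota> J g' N"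
abbreviation "eta \<equiv> hyp_eta M' \<iota> J g' N"
abbreviation "phi \<equiv> hyp_phi M M' \<iota> J g' N"

lemma JN_af: "JN \<in> vfields_along V" by (rule af_J[OF N_af])

lemma tt_smooth: "SF V tt"
  using G_smooth[OF N_af JN_af] unfolding normal_angle_def by (auto intro: smooth_at_arctan)

lemma co_si_smooth: "SF V ct" "SF V st"
  using tt_smooth by (auto intro: smooth_at_cos smooth_at_sin)

lemma xi'_af: "xi' \<in> vfields_along V"
  unfolding xi'_def[abs_def] by (intro af_add af_scale co_si_smooth N_af JN_af)

context
  fixes q
  assumes q: "q \<in> V"
begin

lemma co_pos: "ct q > 0"
  unfolding normal_angle_def using arctan_ubound arctan_lbound by (intro cos_gt_zero_pi) auto

text \<open>This is tan t = g(N, JN), the definition of the angle, with the denominator cos t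
  cleared.\<close>

lemma G_N_JN: "ct q * G q (N q) (JN q) = st q" 
proof -
  have "tan (tt q) = G q (N q) (JN q)" unfolding normal_angle_def by (rule tan_arctan)
  then show ?thesis using co_pos by (simp add: tan_def field_simps)
qed

lemmas sc = sin_cos_squared_add[of "tt q", unfolded power2_eq_square]

lemma JN_tan: "JN q \<in> TT q" by (rule J_tan[OF q N_tan[OF q]])

lemma G_JN_N: "ct q * G q (JN q) (N q) = st q"
  using G_N_JN G_sym[OF q JN_tan N_tan[OF q]] by simp

lemma G_JN_JN: "G q (JN q) (JN q) = 1"
  using G_J_J[OF q N_tan[OF q] N_tan[OF q]] N_N[OF q] by simp

lemma xi'_tan: "xi' q \<in> TT q"
  by (rule af_tangent[OF xi'_af q])

lemma xi'_N: "G q (xi' q) (N q) = 0"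
  unfolding xi'_def using G_JN_N N_tan[OF q] JN_tan N_N[OF q] by (simp add: G_lin q A.tangent_scaleR)

lemma N_xi': "G q (N q) (xi' q) = 0"
  using xi'_N G_sym[OF q xi'_tan N_tan[OF q]] by simp

lemma JN_xi': "ct q * G q (JN q) (xi' q) = 1"
proof -
  have "ct q * G q (JN q) (xi' q) = st q * (ct q * G q (JN q) (N q)) + ct q * ct q * G q (JN q) (JN q)"
    unfolding xi'_def using N_tan[OF q] JN_tan by (simp add: G_lin q A.tangent_scaleR algebra_simps)
  then show ?thesis unfolding G_JN_N G_JN_JN using sc by simp
qed

lemma xi'_xi': "G q (xi' q) (xi' q) = 1"
proof -
  have "G q (xi' q) (xi' q) = st q * G q (N q) (xi' q) + ct q * G q (JN q) (xi' q)"
    using N_tan[OF q] JN_tan xi'_tan by (subst xi'_def) (simp add: G_lin q A.tangent_scaleR)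
  then show ?thesis unfolding N_xi' JN_xi' by simp
qed

lemma J_xi': "JJ q (xi' q) = st q *\<^sub>R JN q - ct q *\<^sub>R N q"
  unfolding xi'_def using N_tan[OF q] JN_tan by (simp add: J_add[OF q] J_scale[OF q] A.tangent_scaleR J_J[OF q])

lemma xi: shows xi_tangent: "xi q \<in> T q" and d_xi: "d\<iota> q (xi q) = xi' q"
proof -
  have "xi q = pb q (xi' q)" by (simp add: hyp_xi_def pb_def xi'_def Let_def)
  then show "xi q \<in> T q" "d\<iota> q (xi q) = xi' q" using pb[OF q xi'_tan xi'_N] by simp_all
qed

context
  fixes x
  assumes x: "x \<in> T q"
begin

lemma dx: "d\<iota> q x \<in> TT q" by (rule d_tan[OF q x])

lemma eta_JN: "eta q x = ct q * G q (d\<iota> q x) (JN q)"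
  by (simp add: hyp_eta_def)

lemma eta_xi': "eta q x = G q (d\<iota> q x) (xi' q)"
  unfolding eta_JN xi'_def using dx N_tan[OF q] JN_tan d_N[OF q x] by (simp add: G_lin q A.tangent_scaleR)

definition "phi' = JJ q (d\<iota> q x) + eta q x *\<^sub>R (ct q *\<^sub>R N q - st q *\<^sub>R JN q)"

lemma phi'_tan: "phi' \<in> TT q"
  unfolding phi'_def using N_tan[OF q] JN_tan J_tan[OF q dx] by (intro A.tangent_add A.tangent_scaleR A.tangent_diff)

lemma phi'_N: "G q phi' (N q) = 0"
proof -
  have e: "G q phi' (N q) = G q (d\<iota> q x) (JN q) + eta q x * (ct q * G q (N q) (N q) - st q * G q (JN q) (N q))"
    unfolding phi'_def using N_tan[OF q] JN_tan J_tan[OF q dx] dx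
    by (simp add: G_lin q A.tangent_scaleR A.tangent_diff G_J[OF q])
  have "ct q * G q phi' (N q) = ct q * G q (d\<iota> q x) (JN q) - eta q x * (ct q * ct q + st q * (ct q * G q (JN q) (N q)))"
    unfolding e N_N[OF q] by (simp add: algebra_simps)
  also have "\<dots> = 0" unfolding G_JN_N using sc eta_JN by (simp add: algebra_simps)
  finally show ?thesis using co_pos by simp
qed

lemma phi: shows phi_tangent: "phi q x \<in> T q" and d_phi: "d\<iota> q (phi q x) = JJ q (d\<iota> q x) + eta q x *\<^sub>R (ct q *\<^sub>R N q - st q *\<^sub>R JN q)"
proof -
  have "phi q x = pb q phi'" by (simp add: hyp_phi_def pb_def phi'_def eta_JN Let_def)
  then show "phi q x \<in> T q" "d\<iota> q (phi q x) = JJ q (d\<iota> q x) + eta q x *\<^sub>R (ct q *\<^sub>R N q - st q *\<^sub>R JN q)"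
    using pb[OF q phi'_tan phi'_N] by (simp_all add: phi'_def)
qed

text \<open>Thus \<phi> is \<open>J\<close> applied to the horizontal part x - \<eta>(x) \<xi>. The
  almost contact identities below follow from this form.\<close>

lemma d_phi_xi': "d\<iota> q (phi q x) = JJ q (d\<iota> q x) - eta q x *\<^sub>R JJ q (xi' q)"
  unfolding d_phi J_xi' by (simp add: algebra_simps)

end

lemma eta_add: "x \<in> T q \<Longrightarrow> y \<in> T q \<Longrightarrow> eta q (x + y) = eta q x + eta q y"
  and eta_scale: "x \<in> T q \<Longrightarrow> eta q (a *\<^sub>R x) = a * eta q x"
  and eta_diff: "x \<in> T q \<Longrightarrow> y \<in> T q \<Longrightarrow> eta q (x - y) = eta q x - eta q y"
  by (simp_all add: eta_xi' tangent_add tangent_scaleR tangent_diff linear_add[OF linear_d] linear_cmul[OF linear_d]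
      linear_diff[OF linear_d] G_lin q dx xi'_tan)

lemma eta_xi: "eta q (xi q) = 1"
  using eta_xi'[OF xi_tangent] xi'_xi' by (simp add: d_xi)

lemma xi'_J_xi': "G q (xi' q) (JJ q (xi' q)) = st q / ct q"
proof -
  have "ct q * G q (xi' q) (JJ q (xi' q)) = st q * (ct q * G q (JN q) (xi' q)) - ct q * ct q * G q (N q) (xi' q)"
    unfolding J_xi' using xi'_tan N_tan[OF q] JN_tan
    by (simp add: G_lin q A.tangent_scaleR G_sym[OF q xi'_tan] algebra_simps)
  then show ?thesis unfolding JN_xi' N_xi' using co_pos by (simp add: field_simps)
qed

lemma G_d_J_xi': "x \<in> T q \<Longrightarrow> G q (d\<iota> q x) (JJ q (xi' q)) = st q / ct q * eta q x"
  unfolding J_xi' using N_tan[OF q] JN_tan co_pos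
  by (simp add: G_lin q A.tangent_scaleR dx d_N[OF q] eta_JN)

lemma eta_phi: 
  assumes x: "x \<in> T q"
  shows "eta q (phi q x) = 0"
  unfolding eta_xi'[OF phi_tangent[OF x]] d_phi_xi'[OF x]
  using dx[OF x] J_tan[OF q] xi'_tan G_d_J_xi'[OF x] xi'_J_xi'
  by (simp add: G_lin q A.tangent_scaleR G_J[OF q])

lemma phi_xi: "phi q (xi q) = 0"
proof (rule d_inj[OF q phi_tangent[OF xi_tangent] tangent_0])
  show "d\<iota> q (phi q (xi q)) = d\<iota> q 0"
    unfolding d_phi_xi'[OF xi_tangent] d_xi eta_xi linear_0[OF linear_d] by simp
qed

lemma phi_phi:
  assumes x: "x \<in> T q"
  shows "phi q (phi q x) = - x + eta q x *\<^sub>R xi q"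
proof (rule d_inj[OF q phi_tangent[OF phi_tangent[OF x]]])
  show "- x + eta q x *\<^sub>R xi q \<in> T q" using x xi_tangent by blast
  show "d\<iota> q (phi q (phi q x)) = d\<iota> q (- x + eta q x *\<^sub>R xi q)"
    unfolding d_phi_xi'[OF phi_tangent[OF x]] eta_phi[OF x] d_phi_xi'[OF x]
    using dx[OF x] J_tan[OF q] xi'_tan
    by (simp add: J_diff[OF q] J_scale[OF q] J_J[OF q] A.tangent_scaleR linear_add[OF linear_d] linear_neg[OF linear_d] linear_diff[OF linear_d] linear_cmul[OF linear_d] d_xi)
qed

lemma hor_split:
  assumes x: "x \<in> T q"
  shows "x - eta q x *\<^sub>R xi q \<in> T q" "eta q (x - eta q x *\<^sub>R xi q) = 0"
  using x xi_tangent by (auto simp: eta_diff eta_scale eta_xi tangent_scaleR)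

lemma TT_eq_0':
  assumes v: "v \<in> TT q" "G q v (N q) = 0" "G q v (xi' q) = 0"
    and d: "\<And>y. y \<in> T q \<Longrightarrow> eta q y = 0 \<Longrightarrow> G q v (d\<iota> q y) = 0"
  shows "v = 0"
proof (rule TT_eq_0[OF q v(1,2)])
  fix y assume y: "y \<in> T q"
  let ?z = "y - eta q y *\<^sub>R xi q"
  note z = hor_split[OF y]
  have "d\<iota> q y = d\<iota> q ?z + eta q y *\<^sub>R xi' q"
    by (simp add: linear_diff[OF linear_d] linear_cmul[OF linear_d] d_xi)
  then show "G q v (d\<iota> q y) = 0"
    using d[OF z] v dx[OF z(1)] xi'_tan by (simp add: G_lin q A.tangent_scaleR)
qed

lemma hor_JN: "x \<in> T q \<Longrightarrow> eta q x = 0 \<Longrightarrow> G q (d\<iota> q x) (JN q) = 0"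
  using eta_JN co_pos by simp

lemma d_phi_hor: "x \<in> T q \<Longrightarrow> eta q x = 0 \<Longrightarrow> d\<iota> q (phi q x) = JJ q (d\<iota> q x)"
  by (simp add: d_phi_xi')

text \<open>The kernel of the 1-form \<eta> is nonzero by dimension, and nondegeneracy pairs a
  nonzero \<open>y\<close> in it nontrivially with some horizontal \<open>u\<close>. By polarization
  one of \<open>y\<close>, \<open>u\<close>, \<open>y + u\<close> is not null.\<close>

lemma ex_hor: "\<exists>y\<in>T q. eta q y = 0 \<and> G q (d\<iota> q y) (d\<iota> q y) \<noteq> 0"
proof -
  note Et = cvec_tangent[OF chart q_U[OF q]] and El = linear_cvec[OF chart q_U[OF q]]
  have "\<exists>y\<in>T q. eta q y = 0 \<and> y \<noteq> 0"
  proof -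
    define f where "f w = eta q (E w q)" for w
    have f: "linear f"
      unfolding f_def by (intro linearI) (simp_all add: linear_add[OF El] linear_cmul[OF El] eta_add eta_scale Et)
    have "\<not> inj f"
    proof
      assume "inj f"
      then have "DIM('e) = dim (range f)" using dim_image_eq[OF f, of UNIV] by simp
      also have "\<dots> \<le> 1" using dim_subset_UNIV[of "range f"] by simp
      finally show False using dim by simp
    qed
    then obtain w where w: "f w = 0" "w \<noteq> 0" using linear_injective_0[OF f] by blast
    then have "E w q \<noteq> 0" using vcomp_cvec[OF chart q_U[OF q], of w] linear_0[OF linear_vcomp] by metis
    then show ?thesis using w Et by (auto simp: f_def)
  qed
  then obtain y where y: "y \<in> T q" "eta q y = 0" "y \<noteq> 0" by blast
  have dy: "d\<iota> q y \<noteq> 0" using d_inj[OF q y(1) tangent_0] y(3) linear_0[OF linear_d] by metis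
  have "\<exists>u\<in>T q. eta q u = 0 \<and> G q (d\<iota> q y) (d\<iota> q u) \<noteq> 0"
  proof (rule ccontr)
    assume "\<not> ?thesis"
    then have "d\<iota> q y = 0"
      by (intro TT_eq_0' dx y d_N[OF q]) (use eta_xi'[OF y(1)] y(2) in auto)
    then show False using dy by simp
  qed
  then obtain u where u: "u \<in> T q" "eta q u = 0" "G q (d\<iota> q y) (d\<iota> q u) \<noteq> 0" by blast
  show ?thesis
  proof (rule ccontr)
    assume n: "\<not> ?thesis"
    have "G q (d\<iota> q (y + u)) (d\<iota> q (y + u)) = G q (d\<iota> q y) (d\<iota> q y) + 2 * G q (d\<iota> q y) (d\<iota> q u) + G q (d\<iota> q u) (d\<iota> q u)"
      using dx[OF y(1)] dx[OF u(1)] G_sym[OF q dx[OF u(1)] dx[OF y(1)]]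
      by (simp add: linear_add[OF linear_d] G_lin q A.tangent_add)
    moreover have "y + u \<in> T q" "eta q (y + u) = 0" using y u by (auto simp: eta_add)
    ultimately show False using n y u by simp
  qed
qed

end

lemma xi_vf: "xi \<in> VF V"
proof -
  have "(\<lambda>q. pb q (xi' q)) \<in> VF V" by (rule vf_pb[OF xi'_af xi'_N])
  then show ?thesis
    by (rule vf_cong[OF V_open, rotated]) (use pb_d[OF _ xi_tangent] d_xi in metis)
qed

lemma d_af: "X \<in> VF V \<Longrightarrow> (\<lambda>q. d\<iota> q (X q)) \<in> vfields_along V"
  by (rule af_push[OF V_open])

lemma eta_smooth:
  assumes X: "X \<in> VF V"
  shows "SF V (\<lambda>q. eta q (X q))"
proof
  fix q assume q: "q \<in> V"
  show "smooth_at M q (\<lambda>q. eta q (X q))"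
    by (rule smooth_at_cong[OF V_open q _ G_smooth[OF d_af[OF X] xi'_af, rule_format, OF q]])
      (rule eta_xi'[OF _ vf_tangent[OF X], symmetric])
qed

lemma phi_vf:
  assumes X: "X \<in> VF V"
  shows "(\<lambda>q. phi q (X q)) \<in> VF V"
proof -
  define W where "W q = JJ q (d\<iota> q (X q)) + eta q (X q) *\<^sub>R (ct q *\<^sub>R N q - st q *\<^sub>R JN q)" for q
  have W: "W \<in> vfields_along V"
    unfolding W_def[abs_def]
    by (intro af_add af_scale af_diff af_J d_af X eta_smooth co_si_smooth N_af JN_af)
  have e: "W q = d\<iota> q (phi q (X q))" if "q \<in> V" for q
    unfolding W_def using d_phi[OF that vf_tangent[OF X that]] by simp
  have "(\<lambda>q. pb q (W q)) \<in> VF V"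
    by (rule vf_pb[OF W]) (simp add: e d_N phi_tangent vf_tangent[OF X])
  then show ?thesis
    by (rule vf_cong[OF V_open, rotated]) (simp add: e pb_d phi_tangent vf_tangent[OF X])
qed

section \<open>Second fundamental forms in the directions of the normal and of \<xi>\<close>

text \<open>In the notation of the Weingarten formula, \<open>sff q x (d\<iota> q u)\<close> is \<open>g (A x) u\<close>, and
  \<open>hff q x (d\<iota> q u)\<close> is \<open>g (\<nabla>\<^sub>x \<xi>) u\<close>.\<close>

definition "sff q x u = - G q (Lv q x N) u"
definition "hff q x u = G q (Lv q x xi') u"

lemma G_LN_N:
  assumes q: "q \<in> V" and x: "x \<in> T q"
  shows "G q (Lv q x N) (N q) = 0"
proof -
  have "x (\<lambda>r. G r (N r) (N r)) = x (\<lambda>r. - 1)" by (rule tv_cong[OF x V_open q N_N])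
  then show ?thesis
    using L_metric[OF N_af N_af q x] tv_const[OF x] G_sym[OF q Lv_tangent[OF q] N_tan[OF q], of x N] by simp
qed

lemma G_Lxi_xi:
  assumes q: "q \<in> V" and x: "x \<in> T q"
  shows "G q (Lv q x xi') (xi' q) = 0"
proof -
  have "x (\<lambda>r. G r (xi' r) (xi' r)) = x (\<lambda>r. 1)" by (rule tv_cong[OF x V_open q xi'_xi'])
  then show ?thesis
    using L_metric[OF xi'_af xi'_af q x] tv_const[OF x] G_sym[OF q Lv_tangent[OF q] xi'_tan[OF q], of x xi'] by simp
qed

lemma L_xi':
  assumes q: "q \<in> V" and x: "x \<in> T q"
  shows "Lv q x xi' = x st *\<^sub>R N q + st q *\<^sub>R Lv q x N + (x ct *\<^sub>R JN q + ct q *\<^sub>R JJ q (Lv q x N))"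
  unfolding xi'_def[abs_def]
    L_add2[OF q x af_scale[OF co_si_smooth(2) N_af] af_scale[OF co_si_smooth(1) JN_af]]
    L_scale2[OF q x N_af co_si_smooth(2)] L_scale2[OF q x JN_af co_si_smooth(1)] L_J[OF N_af q x] ..

text \<open>Differentiating \<xi> = sin t N + cos t JN, the derivatives of sin t and cos t multiply
  \<open>N\<close> and \<open>JN\<close>, which are orthogonal to horizontal vectors.\<close>

lemma hff_sff:
  assumes q: "q \<in> V" and x: "x \<in> T q" and u: "u \<in> T q" "eta q u = 0"
  shows "hff q x (d\<iota> q u) = - st q * sff q x (d\<iota> q u) - ct q * sff q x (JJ q (d\<iota> q u))"
  unfolding hff_def sff_def L_xi'[OF q x]
  using dx[OF q u(1)] Lv_tangent[OF q] N_tan[OF q] JN_tan[OF q] J_tan[OF q Lv_tangent[OF q]]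
    G_sym[OF q N_tan[OF q] dx[OF q u(1)]] G_sym[OF q JN_tan[OF q] dx[OF q u(1)]] d_N[OF q u(1)] hor_JN[OF q u]
  by (simp add: G_lin q A.tangent_scaleR A.tangent_add G_J[OF q])

text \<open>The derivative of the arctangent contributes 1 / (1 + tan^2 t) = cos^2 t. The factor 2
  appears because both terms in the derivative of g(N, JN) coincide, \<open>J\<close> being
  self-adjoint.\<close>

lemma x_tt:
  assumes q: "q \<in> V" and x: "x \<in> T q"
  shows "x tt = - 2 * ct q * sff q x (xi' q)"
proof -
  define f where "f r = G r (N r) (JN r)" for r
  have f: "smooth_at M q f" using G_smooth[OF N_af JN_af] q by (simp add: f_def[abs_def])
  have tt: "tt = (\<lambda>r. arctan (f r))" by (simp add: normal_angle_def[abs_def] f_def)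
  have "x (\<lambda>r. arctan (f r)) = inverse (1 + (f q)\<^sup>2) * x f"
    by (rule tv_chain_real[OF chart q_U[OF q] x f open_UNIV UNIV_I smooth_on_arctan DERIV_arctan])
  moreover have "inverse (1 + (f q)\<^sup>2) = ct q * ct q"
  proof -
    have "ct q * ct q = inverse (sqrt (1 + (f q)\<^sup>2) * sqrt (1 + (f q)\<^sup>2))"
      unfolding tt cos_arctan by (simp only: inverse_eq_divide times_divide_times_eq mult_1_left)
    also have "sqrt (1 + (f q)\<^sup>2) * sqrt (1 + (f q)\<^sup>2) = 1 + (f q)\<^sup>2"
      by (simp only: real_sqrt_mult_self) simp
    finally show ?thesis ..
  qed
  moreover have "x f = G q (Lv q x N) (JN q) + G q (N q) (JJ q (Lv q x N))"
    using L_metric[OF N_af JN_af q x] unfolding L_J[OF N_af q x] f_def[abs_def] by simp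
  moreover have "G q (N q) (JJ q (Lv q x N)) = G q (Lv q x N) (JN q)"
    using G_J[OF q N_tan[OF q] Lv_tangent[OF q]] G_sym[OF q JN_tan[OF q] Lv_tangent[OF q]] by simp
  moreover have "G q (Lv q x N) (xi' q) = ct q * G q (Lv q x N) (JN q)"
    unfolding xi'_def using Lv_tangent[OF q] N_tan[OF q] JN_tan[OF q] G_LN_N[OF q x]
    by (simp add: G_lin q A.tangent_scaleR)
  ultimately show ?thesis unfolding sff_def by (simp add: tt algebra_simps)
qed

lemma L_d_torsion:
  assumes "q \<in> V" "X \<in> VF V" "Y \<in> VF V"
  shows "L X (\<lambda>q. d\<iota> q (Y q)) q - L Y (\<lambda>q. d\<iota> q (X q)) q = d\<iota> q (lie_bracket M X Y q)"
  by (rule L_torsion[OF A.torsion_free[OF U'_open] assms(2,3,1)])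

lemma bracket_tan: "q \<in> V \<Longrightarrow> X \<in> VF V \<Longrightarrow> Y \<in> VF V \<Longrightarrow> lie_bracket M X Y q \<in> T q"
  by (rule vf_tangent[OF vf_bracket[OF V_open]])

text \<open>Differentiate g(W, N) = 0: the derivative of the normal is traded for the normal
  component of the derivative of \<open>W\<close>.\<close>

lemma sff_L:
  assumes q: "q \<in> V" and x: "x \<in> T q" and W: "W \<in> vfields_along V" and WN: "\<And>r. r \<in> V \<Longrightarrow> G r (W r) (N r) = 0"
  shows "sff q x (W q) = G q (Lv q x W) (N q)"
proof -
  have "x (\<lambda>r. G r (W r) (N r)) = x (\<lambda>r. 0)" by (rule tv_cong[OF x V_open q WN])
  then show ?thesis
    using L_metric[OF W N_af q x] tv_const[OF x] G_sym[OF q Lv_tangent[OF q] af_tangent[OF W q], of x N]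
    by (simp add: sff_def)
qed

lemma hff_L:
  assumes q: "q \<in> V" and x: "x \<in> T q" and W: "W \<in> vfields_along V" and WN: "\<And>r. r \<in> V \<Longrightarrow> G r (W r) (xi' r) = 0"
  shows "hff q x (W q) = - G q (Lv q x W) (xi' q)"
proof -
  have "x (\<lambda>r. G r (W r) (xi' r)) = x (\<lambda>r. 0)" by (rule tv_cong[OF x V_open q WN])
  then show ?thesis
    using L_metric[OF W xi'_af q x] tv_const[OF x] G_sym[OF q Lv_tangent[OF q] af_tangent[OF W q], of x xi']
    by (simp add: hff_def)
qed

lemma ex_vf:
  assumes q: "q \<in> V" and x: "x \<in> T q"
  obtains X where "X \<in> VF V" "X q = x"
  using that[OF E_vf cvec_vcomp[OF chart q_U[OF q] x]] by blast

lemma ex_hor_vf: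
  assumes q: "q \<in> V" and x: "x \<in> T q" "eta q x = 0"
  obtains X where "X \<in> VF V" "X q = x" "\<And>r. r \<in> V \<Longrightarrow> eta r (X r) = 0"
proof -
  obtain X where X: "X \<in> VF V" "X q = x" using ex_vf[OF q x(1)] .
  show ?thesis
  proof (rule that[of "\<lambda>r. X r - eta r (X r) *\<^sub>R xi r"])
    show "(\<lambda>r. X r - eta r (X r) *\<^sub>R xi r) \<in> VF V"
      by (rule vf_diff[OF X(1) vf_scale[OF eta_smooth[OF X(1)] xi_vf]])
    show "eta r (X r - eta r (X r) *\<^sub>R xi r) = 0" if "r \<in> V" for r
      by (rule hor_split(2)[OF that vf_tangent[OF X(1) that]])
  qed (simp add: X x)
qed

text \<open>The difference of both sides is the normal component of a pushed-forward bracket, which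
  is tangential.\<close>

lemma sff_sym:
  assumes q: "q \<in> V" and x: "x \<in> T q" and y: "y \<in> T q"
  shows "sff q x (d\<iota> q y) = sff q y (d\<iota> q x)"
proof -
  obtain X where X: "X \<in> VF V" "X q = x" using ex_vf[OF q x] .
  obtain Y where Y: "Y \<in> VF V" "Y q = y" using ex_vf[OF q y] .
  note e = sff_L[OF q _ d_af d_N[OF _ vf_tangent]]
  have "G q (L X (\<lambda>q. d\<iota> q (Y q)) q - L Y (\<lambda>q. d\<iota> q (X q)) q) (N q) = 0"
    unfolding L_d_torsion[OF q X(1) Y(1)] by (rule d_N[OF q bracket_tan[OF q X(1) Y(1)]])
  then show ?thesis
    using e[OF x Y(1) _ Y(1)] e[OF y X(1) _ X(1)] X(2) Y(2) Lv_tangent[OF q] N_tan[OF q]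
    by (simp add: L_def G_diff1[OF q])
qed

end

section \<open>The canonical connection\<close>

text \<open>The functions \<open>a\<close> and \<open>b\<close> stand for \<theta>(\<xi>) / 2n and
  \<theta>*(\<xi>) / 2n; the assumption \<open>F\<close> retains the pointwise form of the structure
  tensor with these coefficients.\<close>

locale hypersurface_F45 = hypersurface_chart M M' \<iota> D' U' c' V g' J U c N + B: connection M nabla
  for M :: "('a, 'e::euclidean_space) mfd" and M' :: "('b, 'f::euclidean_space) mfd" and \<iota> D' U' c' V g' J U c N nabla +
  fixes a b :: "'a \<Rightarrow> real"
  assumes levi_civita: "levi_civita M (induced_metric M' \<iota> g') nabla"
    and F: "\<And>q x y z. q \<in> V \<Longrightarrow> x \<in> T q \<Longrightarrow> y \<in> T q \<Longrightarrow> z \<in> T q \<Longrightarrow>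
      F_tensor M (induced_metric M' \<iota> g') nabla phi q x y z =
        - a q * (induced_metric M' \<iota> g' q (phi q x) (phi q y) * eta q z + induced_metric M' \<iota> g' q (phi q x) (phi q z) * eta q y)
        - b q * (induced_metric M' \<iota> g' q x (phi q y) * eta q z + induced_metric M' \<iota> g' q x (phi q z) * eta q y)"
begin

abbreviation "gI \<equiv> induced_metric M' \<iota> g'"

lemma gI: "gI q x y = G q (d\<iota> q x) (d\<iota> q y)"
  by (simp add: induced_metric_def)

section \<open>The induced Levi-Civita connection and the shape operator\<close>

lemma nabla_vf: "X \<in> VF V \<Longrightarrow> Y \<in> VF V \<Longrightarrow> nabla X Y \<in> VF V"
  by (rule B.conn_vf[OF V_open])

lemma nabla_tan: "q \<in> V \<Longrightarrow> X \<in> VF V \<Longrightarrow> Y \<in> VF V \<Longrightarrow> nabla X Y q \<in> T q"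
  by (rule vf_tangent[OF nabla_vf])

lemma nabla_torsion: "X \<in> VF V \<Longrightarrow> Y \<in> VF V \<Longrightarrow> q \<in> V \<Longrightarrow> nabla X Y q - nabla Y X q = lie_bracket M X Y q"
  using levi_civita V_open unfolding levi_civita_def by blast

lemma nabla_metric: "X \<in> VF V \<Longrightarrow> Y \<in> VF V \<Longrightarrow> Z \<in> VF V \<Longrightarrow> q \<in> V \<Longrightarrow>
    X q (\<lambda>r. gI r (Y r) (Z r)) = gI q (nabla X Y q) (Z q) + gI q (Y q) (nabla X Z q)"
  using levi_civita[unfolded levi_civita_def, THEN conjunct2, rule_format, of V X Y] V_open by simp

text \<open>Uniqueness of the Levi-Civita connection: the difference tensor is symmetric in the first two
  and skew in the last two arguments.\<close>

lemma nabla_L: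
  assumes q: "q \<in> V" and X: "X \<in> VF V" and Y: "Y \<in> VF V" and z: "z \<in> T q"
  shows "G q (d\<iota> q (nabla X Y q)) (d\<iota> q z) = G q (Lv q (X q) (\<lambda>r. d\<iota> r (Y r))) (d\<iota> q z)"
proof -
  obtain Z where Z: "Z \<in> VF V" "Z q = z" using ex_vf[OF q z] .
  define K where "K X Y Z = G q (d\<iota> q (nabla X Y q)) (d\<iota> q (Z q)) - G q (L X (\<lambda>r. d\<iota> r (Y r)) q) (d\<iota> q (Z q))" for X Y Z
  note t = d_tan[OF q nabla_tan[OF q]] dx[OF q vf_tangent[OF _ q]] Lv_tangent[OF q]
  have sym: "K X Y Z = K Y X Z" if "X \<in> VF V" "Y \<in> VF V" "Z \<in> VF V" for X Y Z
  proof -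
    have "G q (d\<iota> q (nabla X Y q - nabla Y X q)) (d\<iota> q (Z q)) = G q (L X (\<lambda>r. d\<iota> r (Y r)) q - L Y (\<lambda>r. d\<iota> r (X r)) q) (d\<iota> q (Z q))"
      unfolding nabla_torsion[OF that(1,2) q] L_d_torsion[OF q that(1,2)] ..
    then show ?thesis
      unfolding K_def linear_diff[OF linear_d] L_def using that by (simp add: G_diff1[OF q] t)
  qed
  have skew: "K X Y Z = - K X Z Y" if "X \<in> VF V" "Y \<in> VF V" "Z \<in> VF V" for X Y Z
    using nabla_metric[OF that q] L_metric[OF d_af[OF that(2)] d_af[OF that(3)] q vf_tangent[OF that(1) q]]
      G_sym[OF q t(2)[OF that(2)] t(1)[OF that(1,3)]] G_sym[OF q t(2)[OF that(2)] t(3)[of "X q" "\<lambda>r. d\<iota> r (Z r)"]]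
    unfolding K_def gI L_def by simp
  have "K X Y Z = - K X Y Z"
    using sym[OF X Y Z(1)] skew[OF Y X Z(1)] sym[OF Y Z(1) X] skew[OF Z(1) Y X] sym[OF Z(1) X Y] skew[OF X Z(1) Y] by simp
  then show ?thesis unfolding K_def L_def Z(2) by simp
qed

text \<open>Tensoriality is tested on fields over arbitrarily small neighbourhoods; restricting the
  locale makes the smoothness results available there.\<close>

lemma subset_locale:
  assumes "openin (mtop M) W" "W \<subseteq> V"
  shows "hypersurface_chart M M' \<iota> D' U' c' W g' J U c N"
  by unfold_locales (use assms V_U' chart' chart V_U dim inj_d normal in auto)

lemma phi_vf_sub:
  assumes "openin (mtop M) W" "W \<subseteq> V" "X \<in> VF W"
  shows "(\<lambda>q. phi q (X q)) \<in> VF W"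
  by (rule hypersurface_chart.phi_vf[OF subset_locale[OF assms(1,2)] assms(3)])

lemma phi_add:
  assumes q: "q \<in> V" and x: "x \<in> T q" and y: "y \<in> T q"
  shows "phi q (x + y) = phi q x + phi q y"
proof (rule d_inj[OF q phi_tangent[OF q tangent_add[OF x y]] tangent_add[OF phi_tangent[OF q x] phi_tangent[OF q y]]])
  show "d\<iota> q (phi q (x + y)) = d\<iota> q (phi q x + phi q y)"
    unfolding linear_add[OF linear_d] d_phi_xi'[OF q x] d_phi_xi'[OF q y] d_phi_xi'[OF q tangent_add[OF x y]]
    using x y dx[OF q] by (simp add: J_add[OF q] eta_add[OF q] scaleR_left_distrib)
qed

lemma phi_scale:
  assumes q: "q \<in> V" and x: "x \<in> T q"
  shows "phi q (k *\<^sub>R x) = k *\<^sub>R phi q x"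
proof (rule d_inj[OF q phi_tangent[OF q tangent_scaleR[OF x]] tangent_scaleR[OF phi_tangent[OF q x]]])
  show "d\<iota> q (phi q (k *\<^sub>R x)) = d\<iota> q (k *\<^sub>R phi q x)"
    unfolding linear_cmul[OF linear_d] d_phi_xi'[OF q x] d_phi_xi'[OF q tangent_scaleR[OF x]]
    using x dx[OF q] by (simp add: J_scale[OF q] eta_scale[OF q] scaleR_right_diff_distrib)
qed

lemma tensorial_nabla_phi:
  assumes q: "q \<in> V" and X: "X \<in> VF V"
  shows "tensorial M q (\<lambda>Y. nabla_endo nabla phi X Y q)"
  unfolding tensorial_def
proof (intro conjI allI impI; elim conjE)
  fix W Y Z assume W: "openin (mtop M) W" "q \<in> W" "Y \<in> VF W" "Z \<in> VF W"
  define A where "A = V \<inter> W"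
  have A: "openin (mtop M) A" "q \<in> A" "X \<in> VF A" "Y \<in> VF A" "Z \<in> VF A" "A \<subseteq> V"
    using V_open q W X vf_subset by (auto simp: A_def)
  note ph = phi_vf_sub[OF A(1,6)]
  have "nabla X (\<lambda>r. phi r (Y r + Z r)) q = nabla X (\<lambda>r. phi r (Y r) + phi r (Z r)) q"
    by (rule B.conn_cong2[OF A(1,2,3) ph[OF vf_add[OF A(4,5)]]]) (use A phi_add vf_tangent in blast)
  also have "\<dots> = nabla X (\<lambda>r. phi r (Y r)) q + nabla X (\<lambda>r. phi r (Z r)) q"
    by (rule B.conn_add2[OF A(1,3) ph[OF A(4)] ph[OF A(5)] A(2)])
  finally show "nabla_endo nabla phi X (\<lambda>r. Y r + Z r) q = nabla_endo nabla phi X Y q + nabla_endo nabla phi X Z q"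
    unfolding nabla_endo_def B.conn_add2[OF A(1,3,4,5,2)]
      phi_add[OF q vf_tangent[OF B.conn_vf[OF A(1,3,4)] A(2)] vf_tangent[OF B.conn_vf[OF A(1,3,5)] A(2)]]
    by simp
next
  fix W Y f assume W: "openin (mtop M) W" "q \<in> W" "Y \<in> VF W" "SF W f"
  define A where "A = V \<inter> W"
  have A: "openin (mtop M) A" "q \<in> A" "X \<in> VF A" "Y \<in> VF A" "SF A f" "A \<subseteq> V"
    using V_open q W X vf_subset by (auto simp: A_def)
  note ph = phi_vf_sub[OF A(1,6)]
  note Yq = vf_tangent[OF A(4,2)] and Dq = vf_tangent[OF B.conn_vf[OF A(1,3,4)] A(2)]
  have "nabla X (\<lambda>r. phi r (f r *\<^sub>R Y r)) q = nabla X (\<lambda>r. f r *\<^sub>R phi r (Y r)) q"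
    by (rule B.conn_cong2[OF A(1,2,3) ph[OF vf_scale[OF A(5,4)]]]) (use A phi_scale vf_tangent in blast)
  also have "\<dots> = X q f *\<^sub>R phi q (Y q) + f q *\<^sub>R nabla X (\<lambda>r. phi r (Y r)) q"
    by (rule B.conn_scale2[OF A(1,3) ph[OF A(4)] A(5,2)])
  finally show "nabla_endo nabla phi X (\<lambda>r. f r *\<^sub>R Y r) q = f q *\<^sub>R nabla_endo nabla phi X Y q"
    unfolding nabla_endo_def B.conn_scale2[OF A(1,3,4,5,2)]
      phi_add[OF q tangent_scaleR[OF Yq] tangent_scaleR[OF Dq]] phi_scale[OF q Yq] phi_scale[OF q Dq]
    by (simp add: scaleR_right_diff_distrib)
qed

text \<open>\<open>F_tensor\<close> is defined through the chosen extensions \<open>vext\<close>;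
  tensoriality allows evaluation on any fields with the given values.\<close>

lemma F_nabla:
  assumes q: "q \<in> V" and X: "X \<in> VF V" and Y: "Y \<in> VF V"
  shows "F_tensor M gI nabla phi q (X q) (Y q) z = gI q (nabla_endo nabla phi X Y q) z"
proof -
  note Xq = vf_tangent[OF X q] and Yq = vf_tangent[OF Y q]
  obtain W1 where W1: "openin (mtop M) W1" "q \<in> W1" "vext M q (X q) \<in> VF W1"
    using ex_vext[OF q_top[OF q] Xq] by blast
  obtain W2 where W2: "openin (mtop M) W2" "q \<in> W2" "vext M q (Y q) \<in> VF W2"
    using ex_vext[OF q_top[OF q] Yq] by blast
  define W where "W = V \<inter> (W1 \<inter> W2)"
  have W: "openin (mtop M) W" "q \<in> W" "vext M q (X q) \<in> VF W" "vext M q (Y q) \<in> VF W" "X \<in> VF W" "W \<subseteq> V"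
    using V_open q W1 W2 vf_subset[OF X, of W] vf_subset[OF W1(3), of W] vf_subset[OF W2(3), of W] by (auto simp: W_def)
  have "nabla_endo nabla phi (vext M q (X q)) (vext M q (Y q)) q = nabla_endo nabla phi X (vext M q (Y q)) q"
    unfolding nabla_endo_def
    using B.conn_cong1[OF W(1,2,3) phi_vf_sub[OF W(1,6,4)] W(5) vext_eq[OF q_top[OF q] Xq]]
      B.conn_cong1[OF W(1,2,3,4,5) vext_eq[OF q_top[OF q] Xq]] by simp
  also have "\<dots> = nabla_endo nabla phi X Y q"
    by (rule tensorial_cong[OF tensorial_nabla_phi[OF q X] W(1,2,4) V_open q Y vext_eq[OF q_top[OF q] Yq]])
  finally show ?thesis unfolding F_tensor_def by simp
qed

lemma hor_xi': "q \<in> V \<Longrightarrow> u \<in> T q \<Longrightarrow> eta q u = 0 \<Longrightarrow> G q (xi' q) (d\<iota> q u) = 0"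
  using eta_xi' G_sym[OF _ xi'_tan dx] by simp

lemma hor_J_xi': "q \<in> V \<Longrightarrow> u \<in> T q \<Longrightarrow> eta q u = 0 \<Longrightarrow> G q (xi' q) (JJ q (d\<iota> q u)) = 0"
  using G_d_J_xi'[of q u] G_J[OF _ xi'_tan dx] G_sym[OF _ J_tan[OF _ xi'_tan] dx] by simp

lemma L_d_xi: "q \<in> V \<Longrightarrow> x \<in> T q \<Longrightarrow> Lv q x (\<lambda>r. d\<iota> r (xi r)) = Lv q x xi'"
  by (rule L_cong2) (auto simp: d_xi)

text \<open>From \<phi>\<xi> = 0 follows (\<nabla>\<phi>)\<xi> = -\<phi>(\<nabla>\<xi>), so F(X,
  \<xi>, Z) is minus \<open>hff\<close> on JZ, and the assumed shape of \<open>F\<close> evaluates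
  it. Replacing Z by \<phi>Z, with J^2 = -1, gives \<open>hff\<close> on Z itself.\<close>

lemma hff_formula:
  assumes q: "q \<in> V" and x: "x \<in> T q" and u: "u \<in> T q" "eta q u = 0"
  shows "hff q x (d\<iota> q u) = a q * G q (d\<iota> q x) (JJ q (d\<iota> q u)) + b q * G q (d\<iota> q x) (d\<iota> q u)"
    and "hff q x (JJ q (d\<iota> q u)) = - a q * G q (d\<iota> q x) (d\<iota> q u) + b q * G q (d\<iota> q x) (JJ q (d\<iota> q u))"
proof -
  obtain X where X: "X \<in> VF V" "X q = x" using ex_vf[OF q x] .
  have *: "hff q x (JJ q (d\<iota> q z)) = - a q * G q (d\<iota> q x) (d\<iota> q z) + b q * G q (d\<iota> q x) (JJ q (d\<iota> q z))"
    if z: "z \<in> T q" "eta q z = 0" for z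
  proof -
    define w where "w = nabla X xi q"
    have w: "w \<in> T q" unfolding w_def by (rule nabla_tan[OF q X(1) xi_vf])
    note t = dx[OF q x] dx[OF q z(1)] dx[OF q w] J_tan[OF q] xi'_tan[OF q]
    have "nabla X (\<lambda>r. phi r (xi r)) q = nabla X (\<lambda>r. 0) q"
      by (rule B.conn_cong2[OF V_open q X(1) phi_vf[OF xi_vf]]) (rule phi_xi)
    then have "F_tensor M gI nabla phi q x (xi q) z = gI q (- phi q w) z"
      using F_nabla[OF q X(1) xi_vf] B.conn_zero2[OF V_open q X(1)] X(2) by (simp add: nabla_endo_def w_def)
    also have "\<dots> = - G q (d\<iota> q w) (JJ q (d\<iota> q z))"
      unfolding gI linear_neg[OF linear_d] d_phi_xi'[OF q w]
      using t hor_J_xi'[OF q z] by (simp add: G_lin q A.tangent_scaleR A.tangent_diff G_J[OF q])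
    also have "G q (d\<iota> q w) (JJ q (d\<iota> q z)) = hff q x (JJ q (d\<iota> q z))"
      using nabla_L[OF q X(1) xi_vf phi_tangent[OF q z(1)]] L_d_xi[OF q x]
      unfolding d_phi_hor[OF q z] w_def X(2) hff_def by simp
    finally have "hff q x (JJ q (d\<iota> q z)) = - F_tensor M gI nabla phi q x (xi q) z" by simp
    also have "\<dots> = a q * gI q (phi q x) (phi q z) + b q * gI q x (phi q z)"
      using F[OF q x xi_tangent[OF q] z(1)] z(2) by (simp add: phi_xi[OF q] eta_xi[OF q])
    also have "gI q (phi q x) (phi q z) = - G q (d\<iota> q x) (d\<iota> q z)"
      unfolding gI d_phi_hor[OF q z] d_phi_xi'[OF q x]
      using t hor_xi'[OF q z] by (simp add: G_lin q A.tangent_scaleR G_J_J[OF q])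
    also have "gI q x (phi q z) = G q (d\<iota> q x) (JJ q (d\<iota> q z))"
      unfolding gI d_phi_hor[OF q z] ..
    finally show ?thesis by simp
  qed
  show "hff q x (JJ q (d\<iota> q u)) = - a q * G q (d\<iota> q x) (d\<iota> q u) + b q * G q (d\<iota> q x) (JJ q (d\<iota> q u))"
    by (rule *[OF u])
  show "hff q x (d\<iota> q u) = a q * G q (d\<iota> q x) (JJ q (d\<iota> q u)) + b q * G q (d\<iota> q x) (d\<iota> q u)"
    using *[OF phi_tangent[OF q u(1)] eta_phi[OF q u(1)]] dx[OF q u(1)] dx[OF q x] Lv_tangent[OF q]
    unfolding d_phi_hor[OF q u] hff_def by (simp add: J_J[OF q] G_minus2[OF q] J_tan[OF q])
qed

text \<open>Up to sign, the coefficients of the second fundamental form of \<open>N\<close> relative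
  to g and g(., J.). They arise from (a, b) by an orthogonal matrix, so
  \<open>al^2 + be^2 = a^2 + b^2\<close>.\<close>

abbreviation "al q \<equiv> ct q * a q + st q * b q"
abbreviation "be q \<equiv> st q * a q - ct q * b q"

text \<open>The relation \<open>hff_sff\<close> for \<open>u\<close> and for \<open>Ju\<close> is a
  linear system in the two values of \<open>sff\<close>, with an orthogonal matrix of angle t; it is
  inverted explicitly.\<close>

lemma sff_formula:
  assumes q: "q \<in> V" and x: "x \<in> T q" and u: "u \<in> T q" "eta q u = 0"
  shows "sff q x (d\<iota> q u) = - al q * G q (d\<iota> q x) (d\<iota> q u) - be q * G q (d\<iota> q x) (JJ q (d\<iota> q u))"
proof -
  have n: "sff q x (- d\<iota> q u) = - sff q x (d\<iota> q u)"
    unfolding sff_def using dx[OF q u(1)] Lv_tangent[OF q] by (simp add: G_minus2[OF q])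
  have 1: "hff q x (JJ q (d\<iota> q u)) = - st q * sff q x (JJ q (d\<iota> q u)) + ct q * sff q x (d\<iota> q u)"
    using hff_sff[OF q x phi_tangent[OF q u(1)] eta_phi[OF q u(1)]] n
    unfolding d_phi_hor[OF q u] J_J[OF q dx[OF q u(1)]] by simp
  note 2 = hff_sff[OF q x u]
  have "sff q x (d\<iota> q u) = (ct q * ct q + st q * st q) * sff q x (d\<iota> q u)"
    using sc[OF q] by (simp add: add.commute)
  also have "\<dots> = ct q * hff q x (JJ q (d\<iota> q u)) - st q * hff q x (d\<iota> q u)"
    unfolding 1 2 by (simp add: algebra_simps del: sin_cos_squared_add3)
  also have "\<dots> = - al q * G q (d\<iota> q x) (d\<iota> q u) - be q * G q (d\<iota> q x) (JJ q (d\<iota> q u))"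
    unfolding hff_formula[OF q x u] by (simp add: algebra_simps)
  finally show ?thesis .
qed

text \<open>By symmetry of \<open>sff\<close> this is the horizontal component of A\<xi>, and \<xi>
  is orthogonal to both \<open>y\<close> and \<open>Jy\<close>; so A\<xi> is a multiple of
  \<xi>.\<close>

lemma sff_xi':
  assumes q: "q \<in> V" and y: "y \<in> T q" "eta q y = 0"
  shows "sff q y (xi' q) = 0"
  using sff_sym[OF q y(1) xi_tangent[OF q]] sff_formula[OF q xi_tangent[OF q] y] hor_xi'[OF q y] hor_J_xi'[OF q y]
  by (simp add: d_xi[OF q])

text \<open>So far \<open>a\<close> and \<open>b\<close> are known only pointwise. Evaluating
  \<open>hff_formula\<close> on a horizontal field that is not null at \<open>q\<close> gives two
  equations with smooth data and determinant \<open>v^2 + w^2\<close>, solved by Cramer's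
  rule.\<close>

lemma ab_smooth: "SF V a" "SF V b"
proof -
  have "smooth_at M q a \<and> smooth_at M q b" if q: "q \<in> V" for q
  proof -
    obtain y where y: "y \<in> T q" "eta q y = 0" "G q (d\<iota> q y) (d\<iota> q y) \<noteq> 0" using ex_hor[OF q] by blast
    obtain Y where Y: "Y \<in> VF V" "Y q = y" "\<And>r. r \<in> V \<Longrightarrow> eta r (Y r) = 0" using ex_hor_vf[OF q y(1,2)] by blast
    define dY where "dY r = d\<iota> r (Y r)" for r
    have dY: "dY \<in> vfields_along V" unfolding dY_def[abs_def] by (rule d_af[OF Y(1)])
    define v w h k where "v r = G r (dY r) (JJ r (dY r))" and "w r = G r (dY r) (dY r)"
      and "h r = G r (L Y xi' r) (dY r)" and "k r = G r (L Y xi' r) (JJ r (dY r))" for r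
    have s: "smooth_at M q v" "smooth_at M q w" "smooth_at M q h" "smooth_at M q k"
      using G_smooth[OF dY af_J[OF dY]] G_smooth[OF dY dY] G_smooth[OF L_af[OF Y(1) xi'_af] dY]
        G_smooth[OF L_af[OF Y(1) xi'_af] af_J[OF dY]] q
      by (simp_all add: v_def[abs_def] w_def[abs_def] h_def[abs_def] k_def[abs_def])
    have hk: "h r = a r * v r + b r * w r" "k r = - a r * w r + b r * v r" if "r \<in> V" for r
      using hff_formula[OF that vf_tangent[OF Y(1) that] vf_tangent[OF Y(1) that] Y(3)[OF that]]
      by (simp_all add: hff_def L_def v_def w_def h_def k_def dY_def)
    define e where "e r = v r * v r + w r * w r" for r
    have e: "smooth_at M q e" unfolding e_def[abs_def] by (intro smooth_at_add smooth_at_mult s)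
    have "w q \<noteq> 0" using y(3) by (simp add: w_def dY_def Y(2))
    then have e0: "e q \<noteq> 0" unfolding e_def by (simp add: sum_squares_eq_zero_iff)
    obtain W where W: "openin (mtop M) W" "q \<in> W" "\<And>r. r \<in> W \<Longrightarrow> e r \<noteq> 0" using smooth_at_nonzero[OF e e0] by blast
    have VW: "openin (mtop M) (V \<inter> W)" "q \<in> V \<inter> W" using V_open q W by auto
    have "smooth_at M q (\<lambda>r. (v r * h r - w r * k r) / e r)" "smooth_at M q (\<lambda>r. (w r * h r + v r * k r) / e r)"
      by (intro smooth_at_divide smooth_at_diff smooth_at_add smooth_at_mult s e e0)+
    moreover have "(v r * h r - w r * k r) / e r = a r" "(w r * h r + v r * k r) / e r = b r" if "r \<in> V \<inter> W" for r
    proof -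
      have "r \<in> V" "e r \<noteq> 0" using that W by auto
      then show "(v r * h r - w r * k r) / e r = a r" "(w r * h r + v r * k r) / e r = b r"
        by (simp_all add: hk nonzero_divide_eq_eq, simp_all add: e_def algebra_simps)
    qed
    ultimately show ?thesis
      using smooth_at_cong[OF VW, of "\<lambda>r. (v r * h r - w r * k r) / e r" a]
        smooth_at_cong[OF VW, of "\<lambda>r. (w r * h r + v r * k r) / e r" b] by blast
  qed
  then show "SF V a" "SF V b" by auto
qed

section \<open>The canonical connection in terms of the pulled-back connection\<close>

abbreviation "DD \<equiv> canonical_connection nabla phi xi eta"

lemma DD_eq:
  "DD X Z p = nabla X Z p + (1/2) *\<^sub>R (nabla_endo nabla phi X (\<lambda>q. phi q (Z q)) p + nabla_form nabla eta X Z p *\<^sub>R xi p)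
    - eta p (Z p) *\<^sub>R nabla X xi p"
  by (simp add: canonical_connection_def)

context
  fixes X Z
  assumes X: "X \<in> VF V" and Z: "Z \<in> VF V"
begin

lemma phiZ: "(\<lambda>q. phi q (Z q)) \<in> VF V" by (rule phi_vf[OF Z])

lemma nabla_phi_vf: "nabla_endo nabla phi X (\<lambda>q. phi q (Z q)) \<in> VF V"
  unfolding nabla_endo_def[abs_def]
  by (intro vf_diff nabla_vf phi_vf X phiZ)

lemma nabla_form_smooth: "SF V (nabla_form nabla eta X Z)"
proof
  fix q assume q: "q \<in> V"
  show "smooth_at M q (nabla_form nabla eta X Z)"
    unfolding nabla_form_def[abs_def]
    using vf_smooth[OF X q, of "\<lambda>r. eta r (Z r)"] eta_smooth[OF Z] eta_smooth[OF nabla_vf[OF X Z]] q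
    by (intro smooth_at_diff) auto
qed

lemma DD_vf: "DD X Z \<in> VF V"
proof -
  have "(\<lambda>p. nabla X Z p + (1/2) *\<^sub>R (nabla_endo nabla phi X (\<lambda>q. phi q (Z q)) p + nabla_form nabla eta X Z p *\<^sub>R xi p)
    - eta p (Z p) *\<^sub>R nabla X xi p) \<in> VF V"
    using V_top smooth_at_const
    by (intro vf_diff vf_add vf_scale nabla_vf X Z xi_vf nabla_phi_vf nabla_form_smooth eta_smooth) blast
  then show ?thesis unfolding DD_eq[symmetric] .
qed

text \<open>This is D\<eta> = 0. Differentiating \<open>\<phi>\<phi>Z = -Z + \<eta>(Z)\<xi>\<close>
  shows that the \<eta>-component of (\<nabla>\<phi>)\<phi>Z equals (\<nabla>\<eta>)Z, so the two
  halves in the definition of D add up.\<close>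

lemma eta_DD:
  assumes q: "q \<in> V"
  shows "eta q (DD X Z q) = X q (\<lambda>r. eta r (Z r))"
proof -
  note Zq = vf_tangent[OF Z q] and xq = xi_tangent[OF q]
  note nZ = nabla_tan[OF q X Z] and nx = nabla_tan[OF q X xi_vf] and np = vf_tangent[OF nabla_phi_vf q]
  have sm1: "SF V (\<lambda>_. - 1)" using smooth_at_const V_top by blast
  have nx0: "eta q (nabla X xi q) = 0"
    using nabla_L[OF q X xi_vf xq] L_d_xi[OF q vf_tangent[OF X q]] G_Lxi_xi[OF q vf_tangent[OF X q]]
    by (simp add: eta_xi'[OF q nx] d_xi[OF q])
  have "nabla X (\<lambda>r. phi r (phi r (Z r))) q = nabla X (\<lambda>r. - 1 *\<^sub>R Z r + eta r (Z r) *\<^sub>R xi r) q"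
    by (rule B.conn_cong2[OF V_open q X phi_vf[OF phiZ]]) (simp add: phi_phi vf_tangent[OF Z])
  also have "\<dots> = - nabla X Z q + (X q (\<lambda>r. eta r (Z r)) *\<^sub>R xi q + eta q (Z q) *\<^sub>R nabla X xi q)"
    using B.conn_add2[OF V_open X vf_scale[OF sm1 Z] vf_scale[OF eta_smooth[OF Z] xi_vf] q]
      B.conn_scale2[OF V_open X Z sm1 q] B.conn_scale2[OF V_open X xi_vf eta_smooth[OF Z] q]
      tv_const[OF vf_tangent[OF X q]] by simp
  finally have "eta q (nabla_endo nabla phi X (\<lambda>r. phi r (Z r)) q) = X q (\<lambda>r. eta r (Z r)) - eta q (nabla X Z q)"
    using nZ nx xq nabla_tan[OF q X phiZ] eta_scale[OF q nZ, of "- 1"]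
    by (simp add: nabla_endo_def eta_diff[OF q] eta_add[OF q] eta_scale[OF q] eta_phi[OF q] phi_tangent[OF q] eta_xi[OF q] nx0
        tangent_add tangent_scaleR tangent_minus tangent_diff)
  then show ?thesis
    using nZ nx xq np
    by (simp add: DD_eq eta_diff[OF q] eta_add[OF q] eta_scale[OF q] eta_xi[OF q] nx0 nabla_form_def
        tangent_add tangent_scaleR tangent_diff diff_divide_distrib)
qed

lemma L_hor_part:
  assumes q: "q \<in> V" and u: "u \<in> T q" "eta q u = 0"
  shows "G q (Lv q (X q) (\<lambda>r. d\<iota> r (Z r - eta r (Z r) *\<^sub>R xi r))) (d\<iota> q u)
    = G q (Lv q (X q) (\<lambda>r. d\<iota> r (Z r))) (d\<iota> q u) - eta q (Z q) * hff q (X q) (d\<iota> q u)"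
proof -
  note Xq = vf_tangent[OF X q]
  have "Lv q (X q) (\<lambda>r. d\<iota> r (Z r - eta r (Z r) *\<^sub>R xi r)) = Lv q (X q) (\<lambda>r. d\<iota> r (Z r) - eta r (Z r) *\<^sub>R xi' r)"
    by (rule L_cong2[OF q Xq]) (simp add: linear_diff[OF linear_d] linear_cmul[OF linear_d] d_xi)
  also have "\<dots> = Lv q (X q) (\<lambda>r. d\<iota> r (Z r)) - (X q (\<lambda>r. eta r (Z r)) *\<^sub>R xi' q + eta q (Z q) *\<^sub>R Lv q (X q) xi')"
    unfolding L_diff2[OF q Xq d_af[OF Z] af_scale[OF eta_smooth[OF Z] xi'_af]]
      L_scale2[OF q Xq xi'_af eta_smooth[OF Z]] ..
  finally show ?thesis
    using Lv_tangent[OF q] xi'_tan[OF q] dx[OF q u(1)] hor_xi'[OF q u]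
    by (simp add: hff_def G_lin q A.tangent_add A.tangent_scaleR)
qed

text \<open>The term (\<nabla>\<phi>)\<phi>Z has no horizontal part, because every summand of
  \<open>F\<close> carries \<eta> of its second or third argument. What remains is the derivative of
  the horizontal part of \<open>Z\<close>.\<close>

lemma G_DD:
  assumes q: "q \<in> V" and u: "u \<in> T q" "eta q u = 0"
  shows "G q (d\<iota> q (DD X Z q)) (d\<iota> q u) = G q (Lv q (X q) (\<lambda>r. d\<iota> r (Z r - eta r (Z r) *\<^sub>R xi r))) (d\<iota> q u)"
proof -
  note nZ = nabla_tan[OF q X Z] and nx = nabla_tan[OF q X xi_vf] and np = vf_tangent[OF nabla_phi_vf q]
  have "gI q (nabla_endo nabla phi X (\<lambda>r. phi r (Z r)) q) u = F_tensor M gI nabla phi q (X q) (phi q (Z q)) u"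
    by (rule F_nabla[OF q X phiZ, symmetric])
  also have "\<dots> = 0"
    using F[OF q vf_tangent[OF X q] vf_tangent[OF phiZ q] u(1)] u(2) eta_phi[OF q vf_tangent[OF Z q]] by simp
  finally have 0: "G q (d\<iota> q (nabla_endo nabla phi X (\<lambda>r. phi r (Z r)) q)) (d\<iota> q u) = 0" by (simp add: gI)
  have "G q (d\<iota> q (nabla X xi q)) (d\<iota> q u) = hff q (X q) (d\<iota> q u)"
    using nabla_L[OF q X xi_vf u(1)] L_d_xi[OF q vf_tangent[OF X q]] by (simp add: hff_def)
  then show ?thesis
    unfolding L_hor_part[OF q u] nabla_L[OF q X Z u(1), symmetric]
    using dx[OF q nZ] dx[OF q nx] dx[OF q np] dx[OF q u(1)] xi'_tan[OF q] hor_xi'[OF q u] 0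
    by (simp add: DD_eq linear_diff[OF linear_d] linear_add[OF linear_d] linear_cmul[OF linear_d] d_xi[OF q] G_lin q
        A.tangent_add A.tangent_scaleR A.tangent_diff)
qed

text \<open>Removing the components along \<open>N\<close> and \<xi> leaves the horizontal part.
  Both corrections carry a plus sign: \<open>N\<close> has square -1, and \<open>hff\<close> is
  minus the \<xi>-component of the derivative.\<close>

lemma d_DD_hor:
  assumes hor: "\<And>r. r \<in> V \<Longrightarrow> eta r (Z r) = 0" and q: "q \<in> V"
  shows "d\<iota> q (DD X Z q) = L X (\<lambda>r. d\<iota> r (Z r)) q
    + sff q (X q) (d\<iota> q (Z q)) *\<^sub>R N q + hff q (X q) (d\<iota> q (Z q)) *\<^sub>R xi' q"
proof -
  note Xq = vf_tangent[OF X q] and DDt = vf_tangent[OF DD_vf q]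
  let ?L = "Lv q (X q) (\<lambda>r. d\<iota> r (Z r))" and ?A = "sff q (X q) (d\<iota> q (Z q))" and ?h = "hff q (X q) (d\<iota> q (Z q))"
  note t = dx[OF q DDt] Lv_tangent[OF q, of "X q" "\<lambda>r. d\<iota> r (Z r)"] N_tan[OF q] xi'_tan[OF q]
  have e0: "X q (\<lambda>r. eta r (Z r)) = 0"
    using tv_cong[OF Xq V_open q hor] tv_const[OF Xq] by simp
  have A: "?A = G q ?L (N q)"
    by (rule sff_L[OF q Xq d_af[OF Z]]) (rule d_N[OF _ vf_tangent[OF Z]])
  have h: "?h = - G q ?L (xi' q)"
    by (rule hff_L[OF q Xq d_af[OF Z]]) (use eta_xi'[OF _ vf_tangent[OF Z]] hor in simp)
  have "d\<iota> q (DD X Z q) - (?L + ?A *\<^sub>R N q + ?h *\<^sub>R xi' q) = 0"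
  proof (rule TT_eq_0'[OF q])
    show "d\<iota> q (DD X Z q) - (?L + ?A *\<^sub>R N q + ?h *\<^sub>R xi' q) \<in> TT q"
      using t by (intro A.tangent_add A.tangent_scaleR A.tangent_diff)
    show "G q (d\<iota> q (DD X Z q) - (?L + ?A *\<^sub>R N q + ?h *\<^sub>R xi' q)) (N q) = 0"
      using t by (simp add: G_lin q A.tangent_add A.tangent_scaleR A.tangent_diff d_N[OF q DDt] N_N[OF q] xi'_N[OF q] A)
    show "G q (d\<iota> q (DD X Z q) - (?L + ?A *\<^sub>R N q + ?h *\<^sub>R xi' q)) (xi' q) = 0"
      using t eta_DD[OF q] e0 eta_xi'[OF q DDt]
      by (simp add: G_lin q A.tangent_add A.tangent_scaleR A.tangent_diff N_xi'[OF q] xi'_xi'[OF q] h)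
    fix u assume u: "u \<in> T q" "eta q u = 0"
    show "G q (d\<iota> q (DD X Z q) - (?L + ?A *\<^sub>R N q + ?h *\<^sub>R xi' q)) (d\<iota> q u) = 0"
      using t dx[OF q u(1)] G_DD[OF q u] L_hor_part[OF q u] hor[OF q] hor_xi'[OF q u] d_N[OF q u(1)] G_sym[OF q N_tan[OF q] dx[OF q u(1)]]
      by (simp add: G_lin q A.tangent_add A.tangent_scaleR A.tangent_diff)
  qed
  then show ?thesis unfolding L_def by simp
qed

end

end

section \<open>The canonical curvature tensor\<close>

context hypersurface_F45
begin

lemma phi_hor_part:
  assumes q: "q \<in> V" and z: "z \<in> T q"
  shows "JJ q (d\<iota> q (z - eta q z *\<^sub>R xi q)) = d\<iota> q (phi q z)"
  unfolding d_phi_xi'[OF q z] using dx[OF q z] xi'_tan[OF q]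
  by (simp add: linear_diff[OF linear_d] linear_cmul[OF linear_d] d_xi[OF q] J_diff[OF q] J_scale[OF q] A.tangent_scaleR)

context
  fixes \<nu> \<nu>t :: "'b \<Rightarrow> real"
  assumes const: "const_totally_real_curvatures M' J g' D' \<nu> \<nu>t"
begin

text \<open>The orthogonal pair required by the algebraic theorem consists of \<open>N\<close> and a
  non-null horizontal vector; the latter is orthogonal to both \<open>N\<close> and
  \<open>JN\<close>.\<close>

lemma ambient_Riem:
  assumes q: "q \<in> V" and x: "x \<in> TT q" and y: "y \<in> TT q" and z: "z \<in> TT q" and w: "w \<in> TT q"
  shows "G q (A.Riem (E' (vcomp c' x)) (E' (vcomp c' y)) (E' (vcomp c' z)) (\<iota> q)) w
    = \<nu> (\<iota> q) * (pi1 (G q) x y z w - pi2 (G q) (JJ q) x y z w) + \<nu>t (\<iota> q) * pi3 (G q) (JJ q) x y z w"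
proof -
  obtain y0 where y0: "y0 \<in> T q" "eta q y0 = 0" "G q (d\<iota> q y0) (d\<iota> q y0) \<noteq> 0" using ex_hor[OF q] by blast
  have N0: "G q (N q) (N q) \<noteq> 0" using N_N[OF q] by simp
  have Ny: "G q (N q) (d\<iota> q y0) = 0"
    using G_sym[OF q N_tan[OF q] dx[OF q y0(1)]] d_N[OF q y0(1)] by simp
  have NJy: "G q (N q) (JJ q (d\<iota> q y0)) = 0"
    using G_J[OF q N_tan[OF q] dx[OF q y0(1)]] G_sym[OF q JN_tan[OF q] dx[OF q y0(1)]] hor_JN[OF q y0(1,2)] by simp
  show ?thesis
    using A.totally_real_curvature[OF const U'_open \<iota>_U'[OF q] E'_vf E'_vf E'_vf w N_tan[OF q] N0 dx[OF q y0(1)] y0(3) Ny NJy,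
        of "vcomp c' x" "vcomp c' y" "vcomp c' z"]
    unfolding A.cvec_vcomp[OF chart' \<iota>_U'[OF q] x] A.cvec_vcomp[OF chart' \<iota>_U'[OF q] y] A.cvec_vcomp[OF chart' \<iota>_U'[OF q] z] .
qed

context
  fixes Z
  assumes Z: "Z \<in> VF V"
begin

definition "Zh r = Z r - eta r (Z r) *\<^sub>R xi r"
abbreviation "dZ \<equiv> (\<lambda>r. d\<iota> r (Zh r))"

lemma Zh_vf: "Zh \<in> VF V"
  unfolding Zh_def[abs_def] by (rule vf_diff[OF Z vf_scale[OF eta_smooth[OF Z] xi_vf]])

lemma eta_Zh: "r \<in> V \<Longrightarrow> eta r (Zh r) = 0"
  unfolding Zh_def by (rule hor_split(2)[OF _ vf_tangent[OF Z]])

text \<open>The connection respects the splitting into ker \<eta> and \<xi>, so the horizontal part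
  may be taken before differentiating. This is what allows \<open>G_DD\<close> to be
  iterated.\<close>

lemma DD_Zh:
  assumes Y: "Y \<in> VF V" and r: "r \<in> V"
  shows "DD Y Z r - eta r (DD Y Z r) *\<^sub>R xi r = DD Y Zh r"
proof (rule d_inj[OF r])
  note t1 = vf_tangent[OF DD_vf[OF Y Z] r] and t2 = vf_tangent[OF DD_vf[OF Y Zh_vf] r]
  note t = hor_split(1)[OF r t1]
  show "DD Y Z r - eta r (DD Y Z r) *\<^sub>R xi r \<in> T r" "DD Y Zh r \<in> T r" by (rule t, rule t2)
  let ?v = "d\<iota> r (DD Y Z r - eta r (DD Y Z r) *\<^sub>R xi r) - d\<iota> r (DD Y Zh r)"
  have "?v = 0"
  proof (rule TT_eq_0'[OF r])
    show "?v \<in> TT r" using dx[OF r t] dx[OF r t2] by blast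
    show "G r ?v (N r) = 0"
      using dx[OF r t] dx[OF r t2] N_tan[OF r] d_N[OF r t] d_N[OF r t2] by (simp add: G_diff1[OF r])
    have "eta r (DD Y Zh r) = 0"
      unfolding eta_DD[OF Y Zh_vf r]
      using tv_cong[OF vf_tangent[OF Y r] V_open r eta_Zh] tv_const[OF vf_tangent[OF Y r]] by simp
    then show "G r ?v (xi' r) = 0"
      using dx[OF r t] dx[OF r t2] xi'_tan[OF r] eta_xi'[OF r t] eta_xi'[OF r t2] hor_split(2)[OF r t1]
      by (simp add: G_diff1[OF r])
    fix u assume u: "u \<in> T r" "eta r u = 0"
    have "Lv r (Y r) (\<lambda>r. d\<iota> r (Zh r - eta r (Zh r) *\<^sub>R xi r)) = Lv r (Y r) dZ"
      by (rule L_cong2[OF r vf_tangent[OF Y r]]) (simp add: eta_Zh)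
    then have "G r (d\<iota> r (DD Y Zh r)) (d\<iota> r u) = G r (d\<iota> r (DD Y Z r)) (d\<iota> r u)"
      unfolding G_DD[OF Y Zh_vf r u] G_DD[OF Y Z r u] Zh_def by simp
    then show "G r ?v (d\<iota> r u) = 0"
      using dx[OF r t1] dx[OF r t2] dx[OF r u(1)] xi'_tan[OF r] hor_xi'[OF r u]
      by (simp add: linear_diff[OF linear_d] linear_cmul[OF linear_d] d_xi[OF r] G_lin r A.tangent_scaleR A.tangent_diff)
  qed
  then show "d\<iota> r (DD Y Z r - eta r (DD Y Z r) *\<^sub>R xi r) = d\<iota> r (DD Y Zh r)" by simp
qed

lemma sff_hff_smooth:
  assumes Y: "Y \<in> VF V"
  shows "SF V (\<lambda>r. sff r (Y r) (dZ r))" "SF V (\<lambda>r. hff r (Y r) (dZ r))"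
  using G_smooth[OF L_af[OF Y N_af] d_af[OF Zh_vf]] G_smooth[OF L_af[OF Y xi'_af] d_af[OF Zh_vf]]
  by (auto simp: sff_def hff_def L_def intro: smooth_at_minus)

text \<open>Insert \<open>d_DD_hor\<close> for the inner derivative. Derivatives of its coefficients
  multiply \<open>N\<close> and \<xi> and are invisible to \<open>u\<close>; the derivatives of
  \<open>N\<close> and \<xi> give the second fundamental forms, that of \<open>N\<close> with a
  minus sign.\<close>

lemma G_DD_DD:
  assumes X: "X \<in> VF V" and Y: "Y \<in> VF V" and q: "q \<in> V" and u: "u \<in> T q" "eta q u = 0"
  shows "G q (d\<iota> q (DD X (DD Y Z) q)) (d\<iota> q u) = G q (L X (L Y dZ) q) (d\<iota> q u)
    - sff q (Y q) (dZ q) * sff q (X q) (d\<iota> q u) + hff q (Y q) (dZ q) * hff q (X q) (d\<iota> q u)"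
proof -
  note Xq = vf_tangent[OF X q]
  note s = sff_hff_smooth[OF Y]
  note L1 = L_af[OF Y d_af[OF Zh_vf]] and L2 = af_scale[OF s(1) N_af] and L3 = af_scale[OF s(2) xi'_af]
  have "Lv q (X q) (\<lambda>r. d\<iota> r (DD Y Z r - eta r (DD Y Z r) *\<^sub>R xi r))
    = Lv q (X q) (\<lambda>r. L Y dZ r + sff r (Y r) (dZ r) *\<^sub>R N r + hff r (Y r) (dZ r) *\<^sub>R xi' r)"
    by (rule L_cong2[OF q Xq]) (simp only: DD_Zh[OF Y] d_DD_hor[OF Y Zh_vf eta_Zh])
  also have "\<dots> = Lv q (X q) (L Y dZ)
      + (X q (\<lambda>r. sff r (Y r) (dZ r)) *\<^sub>R N q + sff q (Y q) (dZ q) *\<^sub>R Lv q (X q) N)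
      + (X q (\<lambda>r. hff r (Y r) (dZ r)) *\<^sub>R xi' q + hff q (Y q) (dZ q) *\<^sub>R Lv q (X q) xi')"
    unfolding L_add2[OF q Xq af_add[OF L1 L2] L3] L_add2[OF q Xq L1 L2]
      L_scale2[OF q Xq N_af s(1)] L_scale2[OF q Xq xi'_af s(2)] ..
  finally show ?thesis
    unfolding G_DD[OF X DD_vf[OF Y Z] q u]
    using Lv_tangent[OF q] N_tan[OF q] xi'_tan[OF q] dx[OF q u(1)] hor_xi'[OF q u]
      G_sym[OF q N_tan[OF q] dx[OF q u(1)]] d_N[OF q u(1)]
    by (simp add: G_lin q A.tangent_add A.tangent_scaleR L_def[of X] sff_def[of q "X q"] hff_def[of q "X q"])
qed

context
  fixes X Y
  assumes X: "X \<in> VF V" and Y: "Y \<in> VF V"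
begin

lemma DD_curvature_vf: "curvature M DD X Y Z \<in> VF V"
  unfolding curvature_def[abs_def]
  by (intro vf_diff DD_vf X Y Z vf_bracket[OF V_open])

text \<open>Since D\<eta> = 0, the \<eta>-component is XYf - YXf - [X, Y]f for the function f =
  \<eta>(Z).\<close>

lemma eta_curvature:
  assumes q: "q \<in> V"
  shows "eta q (curvature M DD X Y Z q) = 0"
proof -
  have f: "smooth_at M q (\<lambda>r. eta r (Z r))" using eta_smooth[OF Z] q by blast
  have 1: "eta q (DD X (DD Y Z) q) = X q (\<lambda>r. Y r (\<lambda>s. eta s (Z s)))" if "X \<in> VF V" "Y \<in> VF V" for X Y
    unfolding eta_DD[OF that(1) DD_vf[OF that(2) Z] q]
    by (rule tv_cong[OF vf_tangent[OF that(1) q] V_open q]) (rule eta_DD[OF that(2) Z])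
  note B = vf_bracket[OF V_open X Y]
  have t: "DD X Y q \<in> T q" if "X \<in> VF V" "Y \<in> VF V" for X Y by (rule vf_tangent[OF DD_vf[OF that] q])
  show ?thesis
    unfolding curvature_def
    using t[OF X DD_vf[OF Y Z]] t[OF Y DD_vf[OF X Z]] t[OF B Z]
    by (simp add: eta_diff[OF q] tangent_diff 1 X Y eta_DD[OF B Z q] lie_bracket_apply[OF f])
qed

text \<open>The Gauss equation of the horizontal distribution, whose normals \<open>N\<close> and
  \<xi> have squares -1 and 1.\<close>

lemma G_curvature:
  assumes q: "q \<in> V" and u: "u \<in> T q" "eta q u = 0"
  shows "G q (d\<iota> q (curvature M DD X Y Z q)) (d\<iota> q u)
    = \<nu> (\<iota> q) * (pi1 (G q) (d\<iota> q (X q)) (d\<iota> q (Y q)) (dZ q) (d\<iota> q u) - pi2 (G q) (JJ q) (d\<iota> q (X q)) (d\<iota> q (Y q)) (dZ q) (d\<iota> q u))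
    + \<nu>t (\<iota> q) * pi3 (G q) (JJ q) (d\<iota> q (X q)) (d\<iota> q (Y q)) (dZ q) (d\<iota> q u)
    - sff q (Y q) (dZ q) * sff q (X q) (d\<iota> q u) + sff q (X q) (dZ q) * sff q (Y q) (d\<iota> q u)
    + hff q (Y q) (dZ q) * hff q (X q) (d\<iota> q u) - hff q (X q) (dZ q) * hff q (Y q) (d\<iota> q u)"
proof -
  note B = vf_bracket[OF V_open X Y]
  note dt = dx[OF q vf_tangent[OF X q]] dx[OF q vf_tangent[OF Y q]] dx[OF q vf_tangent[OF Zh_vf q]] dx[OF q u(1)]
  have t: "d\<iota> q (DD X Y q) \<in> TT q" if "X \<in> VF V" "Y \<in> VF V" for X Y by (rule dx[OF q vf_tangent[OF DD_vf[OF that] q]])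
  have Lt: "L X W q \<in> TT q" for X W unfolding L_def by (rule Lv_tangent[OF q])
  have 3: "G q (d\<iota> q (DD (lie_bracket M X Y) Z q)) (d\<iota> q u) = G q (L (lie_bracket M X Y) dZ q) (d\<iota> q u)"
    unfolding G_DD[OF B Z q u] L_def Zh_def ..
  have "G q (d\<iota> q (curvature M DD X Y Z q)) (d\<iota> q u)
    = G q (d\<iota> q (DD X (DD Y Z) q)) (d\<iota> q u) - G q (d\<iota> q (DD Y (DD X Z) q)) (d\<iota> q u) - G q (L (lie_bracket M X Y) dZ q) (d\<iota> q u)"
    unfolding curvature_def linear_diff[OF linear_d] 3[symmetric]
    using t[OF X DD_vf[OF Y Z]] t[OF Y DD_vf[OF X Z]] t[OF B Z] dt by (simp add: G_diff1[OF q] A.tangent_diff)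
  also have "\<dots> = G q (L X (L Y dZ) q - L Y (L X dZ) q - L (lie_bracket M X Y) dZ q) (d\<iota> q u)
    - sff q (Y q) (dZ q) * sff q (X q) (d\<iota> q u) + hff q (Y q) (dZ q) * hff q (X q) (d\<iota> q u)
    + sff q (X q) (dZ q) * sff q (Y q) (d\<iota> q u) - hff q (X q) (dZ q) * hff q (Y q) (d\<iota> q u)"
    unfolding G_DD_DD[OF X Y q u] G_DD_DD[OF Y X q u]
    using Lt dt(4) by (simp add: G_diff1[OF q] A.tangent_diff)
  finally show ?thesis
    unfolding L_curvature[OF X Y d_af[OF Zh_vf] q] ambient_Riem[OF q dt] by linarith
qed

theorem canonical_curvature:
  assumes q: "q \<in> V" and u: "u \<in> T q"
  shows "gI q (curvature M DD X Y Z q) u =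
    (\<nu> (\<iota> q) + (b q)\<^sup>2 - (al q)\<^sup>2) * (pi1 (gI q) (X q) (Y q) (Z q) u - pi2 (gI q) (phi q) (X q) (Y q) (Z q) u - pi4 (gI q) (eta q) (X q) (Y q) (Z q) u)
    + (\<nu>t (\<iota> q) - a q * b q + al q * be q) * (pi3 (gI q) (phi q) (X q) (Y q) (Z q) u + pi5 (gI q) (phi q) (eta q) (X q) (Y q) (Z q) u)"
proof -
  let ?x = "X q" and ?y = "Y q" and ?z = "Z q" and ?u = "u - eta q u *\<^sub>R xi q" and ?R = "curvature M DD X Y Z q"
  note x = vf_tangent[OF X q] and y = vf_tangent[OF Y q] and z = vf_tangent[OF Z q] and R = vf_tangent[OF DD_curvature_vf q]
  note zh = hor_split[OF q z] and uh = hor_split[OF q u]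
  have "d\<iota> q u = d\<iota> q ?u + eta q u *\<^sub>R xi' q"
    by (simp add: linear_diff[OF linear_d] linear_cmul[OF linear_d] d_xi[OF q])
  then have g: "gI q ?R u = G q (d\<iota> q ?R) (d\<iota> q ?u)"
    using dx[OF q R] dx[OF q uh(1)] xi'_tan[OF q] eta_curvature[OF q] eta_xi'[OF q R]
    by (simp add: gI G_lin q A.tangent_scaleR)
  \<comment> \<open>The horizontal metric is g - \<eta>\<otimes>\<eta>. In the curvature expressions
    the terms of fourth order in \<eta> cancel, and the quadratic ones are
    \<open>\<pi>\<^sub>4\<close> and \<open>\<pi>\<^sub>5\<close>.\<close>
  have P: "G q (d\<iota> q x) (d\<iota> q (z - eta q z *\<^sub>R xi q)) = gI q x z - eta q x * eta q z" if "x \<in> T q" "z \<in> T q" for x z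
    using dx[OF q that(1)] dx[OF q that(2)] xi'_tan[OF q] eta_xi'[OF q that(1)]
    by (simp add: gI linear_diff[OF linear_d] linear_cmul[OF linear_d] d_xi[OF q] G_lin q A.tangent_scaleR)
  have Q: "G q (d\<iota> q x) (JJ q (d\<iota> q (z - eta q z *\<^sub>R xi q))) = gI q x (phi q z)" if "z \<in> T q" for x z
    unfolding phi_hor_part[OF q that] gI ..
  have K: "gI q ?R u = \<nu> (\<iota> q) * (((gI q ?y ?z - eta q ?y * eta q ?z) * (gI q ?x u - eta q ?x * eta q u) - (gI q ?x ?z - eta q ?x * eta q ?z) * (gI q ?y u - eta q ?y * eta q u))
      - (gI q ?y (phi q ?z) * gI q ?x (phi q u) - gI q ?x (phi q ?z) * gI q ?y (phi q u)))
    + \<nu>t (\<iota> q) * (- (gI q ?y ?z - eta q ?y * eta q ?z) * gI q ?x (phi q u) + (gI q ?x ?z - eta q ?x * eta q ?z) * gI q ?y (phi q u)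
      - gI q ?y (phi q ?z) * (gI q ?x u - eta q ?x * eta q u) + gI q ?x (phi q ?z) * (gI q ?y u - eta q ?y * eta q u))
    - (- al q * (gI q ?y ?z - eta q ?y * eta q ?z) - be q * gI q ?y (phi q ?z)) * (- al q * (gI q ?x u - eta q ?x * eta q u) - be q * gI q ?x (phi q u))
    + (- al q * (gI q ?x ?z - eta q ?x * eta q ?z) - be q * gI q ?x (phi q ?z)) * (- al q * (gI q ?y u - eta q ?y * eta q u) - be q * gI q ?y (phi q u))
    + (a q * gI q ?y (phi q ?z) + b q * (gI q ?y ?z - eta q ?y * eta q ?z)) * (a q * gI q ?x (phi q u) + b q * (gI q ?x u - eta q ?x * eta q u))
    - (a q * gI q ?x (phi q ?z) + b q * (gI q ?x ?z - eta q ?x * eta q ?z)) * (a q * gI q ?y (phi q u) + b q * (gI q ?y u - eta q ?y * eta q u))"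
    unfolding g G_curvature[OF q uh] Zh_def
      sff_formula[OF q x zh] sff_formula[OF q y zh] sff_formula[OF q x uh] sff_formula[OF q y uh]
      hff_formula(1)[OF q x zh] hff_formula(1)[OF q y zh] hff_formula(1)[OF q x uh] hff_formula(1)[OF q y uh]
      pi1_def pi2_def pi3_def P[OF x z] P[OF y z] P[OF x u] P[OF y u] Q[OF z] Q[OF u] ..
  have ab: "(be q)\<^sup>2 = (a q)\<^sup>2 + (b q)\<^sup>2 - (al q)\<^sup>2"
  proof -
    have "(be q)\<^sup>2 + (al q)\<^sup>2 = (ct q * ct q + st q * st q) * ((a q)\<^sup>2 + (b q)\<^sup>2)"
      by (simp add: power2_eq_square algebra_simps del: sin_cos_squared_add3)
    then show ?thesis by simp
  qed
  \<comment> \<open>Here p stands for values of the horizontal metric and q for values of g(.,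
    \<phi>.). The last summand on the right is the unwanted one; \<open>ab\<close> makes its
    coefficient zero.\<close>
  have gen: "n * ((p1 * p2 - p3 * p4) - (q1 * q2 - q3 * q4)) + m * (- p1 * q2 + p3 * q4 - q1 * p2 + q3 * p4)
      - (- A * p1 - C * q1) * (- A * p2 - C * q2) + (- A * p3 - C * q3) * (- A * p4 - C * q4)
      + (k * q1 + l * p1) * (k * q2 + l * p2) - (k * q3 + l * p3) * (k * q4 + l * p4)
    = (n + l\<^sup>2 - A\<^sup>2) * ((p1 * p2 - p3 * p4) - (q1 * q2 - q3 * q4)) + (m - k * l + A * C) * (- p1 * q2 + p3 * q4 - q1 * p2 + q3 * p4)
      + (k\<^sup>2 + l\<^sup>2 - A\<^sup>2 - C\<^sup>2) * (q1 * q2 - q3 * q4)"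
    for n m A C k l p1 p2 p3 p4 q1 q2 q3 q4 :: real
    by (simp add: power2_eq_square algebra_simps)
  show ?thesis
    unfolding K gen ab by (simp add: pi1_def pi2_def pi3_def pi4_def pi5_def algebra_simps)
qed

end

end

text \<open>The components of the curvature along \<open>\<xi>\<close> determine the derivatives of \<open>a\<close> and \<open>b\<close> in direction \<open>\<xi>\<close>.\<close>

lemma xi_ab:
  assumes q: "q \<in> V"
  shows "xi q b = (a q)\<^sup>2 - (b q)\<^sup>2 - \<nu> (\<iota> q) + \<nu>t (\<iota> q) * tan (tt q) + xi q tt * (a q + b q * tan (tt q)) / 2"
    and "xi q a = - 2 * a q * b q + \<nu> (\<iota> q) * tan (tt q) + \<nu>t (\<iota> q) + xi q tt * (a q * tan (tt q) - b q) / 2"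
proof -
  obtain y where y: "y \<in> T q" "eta q y = 0" "G q (d\<iota> q y) (d\<iota> q y) \<noteq> 0" using ex_hor[OF q] by blast
  obtain Y where Y: "Y \<in> VF V" "Y q = y" "\<And>r. r \<in> V \<Longrightarrow> eta r (Y r) = 0" using ex_hor_vf[OF q y(1,2)] by blast
  define dY where "dY r = d\<iota> r (Y r)" for r
  have dY: "dY \<in> vfields_along V" unfolding dY_def[abs_def] by (rule d_af[OF Y(1)])
  have dYq: "dY q = d\<iota> q y" by (simp add: dY_def Y(2))
  \<comment> \<open>This is g(A\<xi>, \<xi>), the one component of \<open>A\<close> not determined
    by \<open>hff\<close>; it will be expressed through the derivative of t along \<xi>.\<close>
  define k where "k r = G r (Lv r (xi r) xi') (N r)" for r
  have k: "SF V k"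
    using G_smooth[OF L_af[OF xi_vf xi'_af] N_af] by (simp add: k_def[abs_def] L_def)
  have kA: "k r = sff r (xi r) (xi' r)" if "r \<in> V" for r
    unfolding k_def by (rule sff_L[OF that xi_tangent[OF that] xi'_af xi'_N, symmetric])
  \<comment> \<open>The horizontal component is \<open>hff_formula\<close>, the normal one vanishes
    by \<open>sff_xi'\<close>, and the \<xi>-component because \<xi> has constant square.\<close>
  have LY: "L Y xi' r = a r *\<^sub>R JJ r (dY r) + b r *\<^sub>R dY r" if r: "r \<in> V" for r
  proof -
    note Yr = vf_tangent[OF Y(1) r]
    note t = af_tangent[OF dY r] J_tan[OF r af_tangent[OF dY r]] Lv_tangent[OF r, of "Y r" xi'] N_tan[OF r] xi'_tan[OF r] JN_tan[OF r]
    let ?v = "Lv r (Y r) xi' - (a r *\<^sub>R JJ r (dY r) + b r *\<^sub>R dY r)"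
    have "?v = 0"
    proof (rule TT_eq_0'[OF r])
      show "?v \<in> TT r" using t by (intro A.tangent_diff A.tangent_add A.tangent_scaleR)
      have "G r (Lv r (Y r) xi') (N r) = 0"
        using sff_L[OF r Yr xi'_af xi'_N] sff_xi'[OF r Yr Y(3)[OF r]] by simp
      then show "G r ?v (N r) = 0"
        using t d_N[OF r Yr] hor_JN[OF r Yr Y(3)[OF r]]
        by (simp add: G_lin r A.tangent_scaleR A.tangent_add G_J[OF r] dY_def)
      show "G r ?v (xi' r) = 0"
        using t G_Lxi_xi[OF r Yr] eta_xi'[OF r Yr] Y(3)[OF r] G_d_J_xi'[OF r Yr]
        by (simp add: G_lin r A.tangent_scaleR A.tangent_add G_J[OF r] dY_def)
      fix u assume u: "u \<in> T r" "eta r u = 0"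
      show "G r ?v (d\<iota> r u) = 0"
        using t dx[OF r u(1)] hff_formula(1)[OF r Yr u]
        by (simp add: G_lin r A.tangent_scaleR A.tangent_add G_J[OF r] dY_def hff_def)
    qed
    then show ?thesis by (simp add: L_def)
  qed
  have Lx: "L xi xi' r = (- k r) *\<^sub>R N r" if r: "r \<in> V" for r
  proof -
    note xr = xi_tangent[OF r]
    note t = Lv_tangent[OF r, of "xi r" xi'] N_tan[OF r] xi'_tan[OF r]
    let ?v = "Lv r (xi r) xi' - (- k r) *\<^sub>R N r"
    have "?v = 0"
    proof (rule TT_eq_0'[OF r])
      show "?v \<in> TT r" using t by (intro A.tangent_diff A.tangent_scaleR)
      show "G r ?v (N r) = 0"
        unfolding G_diff1[OF r t(1,2) A.tangent_scaleR[OF t(2)]] G_scale1[OF r t(2,2)] N_N[OF r] k_def by simp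
      show "G r ?v (xi' r) = 0"
        unfolding G_diff1[OF r t(1,3) A.tangent_scaleR[OF t(2)]] G_scale1[OF r t(2,3)] N_xi'[OF r] G_Lxi_xi[OF r xr] by simp
      fix u assume u: "u \<in> T r" "eta r u = 0"
      note du = dx[OF r u(1)]
      have "G r (Lv r (xi r) xi') (d\<iota> r u) = 0"
        using hff_formula(1)[OF r xr u] hor_xi'[OF r u] hor_J_xi'[OF r u] by (simp add: hff_def d_xi[OF r])
      then show "G r ?v (d\<iota> r u) = 0"
        unfolding G_diff1[OF r t(1) du A.tangent_scaleR[OF t(2)]] G_scale1[OF r t(2) du]
        using G_sym[OF r t(2) du] d_N[OF r u(1)] by simp
    qed
    then show ?thesis unfolding right_minus_eq L_def .
  qed
  note xq = xi_tangent[OF q]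
  note JdY = af_J[OF dY]
  \<comment> \<open>The unknown derivative of \<open>Y\<close> along \<xi> occurs both in the second
    derivative and in the bracket term, and cancels between them.\<close>
  define w where "w = Lv q (xi q) dY"
  have wt: "w \<in> TT q" unfolding w_def by (rule Lv_tangent[OF q])
  have 1: "L xi (L Y xi') q = xi q a *\<^sub>R JJ q (dY q) + a q *\<^sub>R JJ q w + (xi q b *\<^sub>R dY q + b q *\<^sub>R w)"
  proof -
    have "L xi (L Y xi') q = Lv q (xi q) (\<lambda>r. a r *\<^sub>R JJ r (dY r) + b r *\<^sub>R dY r)"
      unfolding L_def[of xi] by (rule L_cong2[OF q xq LY])
    then show ?thesis
      unfolding L_add2[OF q xq af_scale[OF ab_smooth(1) JdY] af_scale[OF ab_smooth(2) dY]]
        L_scale2[OF q xq JdY ab_smooth(1)] L_scale2[OF q xq dY ab_smooth(2)] L_J[OF dY q xq] w_def .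
  qed
  have mk: "SF V (\<lambda>r. - k r)" using k smooth_at_minus by blast
  have 2: "L Y (L xi xi') q = y (\<lambda>r. - k r) *\<^sub>R N q + (- k q) *\<^sub>R Lv q y N"
  proof -
    have "L Y (L xi xi') q = Lv q y (\<lambda>r. (- k r) *\<^sub>R N r)"
      unfolding L_def[of Y] Y(2) by (rule L_cong2[OF q y(1) Lx])
    then show ?thesis unfolding L_scale2[OF q y(1) N_af mk] .
  qed
  have br: "d\<iota> q (lie_bracket M xi Y q) = w - (a q *\<^sub>R JJ q (dY q) + b q *\<^sub>R dY q)"
  proof -
    have "L Y (\<lambda>r. d\<iota> r (xi r)) q = L Y xi' q" unfolding L_def Y(2) by (rule L_d_xi[OF q y(1)])
    then show ?thesis
      using L_d_torsion[OF q xi_vf Y(1)] LY[OF q] by (simp add: w_def L_def[of xi] dY_def[symmetric])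
  qed
  define p where "p u = G q (dY q) (d\<iota> q u)" for u
  define s where "s u = G q (dY q) (JJ q (d\<iota> q u))" for u
  define \<tau> where "\<tau> = tan (tt q)"
  \<comment> \<open>\<open>e1\<close> and \<open>e2\<close> are the coefficients of g(Y, u) and g(Y,
    Ju) in the difference between the two computations of the ambient curvature; they have to
    vanish.\<close>
  define e1 where "e1 = xi q b + (b q)\<^sup>2 - (a q)\<^sup>2 + k q * al q + \<nu> (\<iota> q) - \<nu>t (\<iota> q) * \<tau>"
  define e2 where "e2 = xi q a + 2 * a q * b q + k q * be q - \<nu> (\<iota> q) * \<tau> - \<nu>t (\<iota> q)"
  have eq: "e1 * p u + e2 * s u = 0" if u: "u \<in> T q" "eta q u = 0" for u
  proof -
    note du = dx[OF q u(1)] and dy = dx[OF q y(1)]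
    note Jt = J_tan[OF q du] J_tan[OF q dy] J_tan[OF q wt]
    note tn = du dy Jt wt N_tan[OF q] xi'_tan[OF q] J_tan[OF q xi'_tan[OF q]] Lv_tangent[OF q, of y N]
    have h: "G q (L (lie_bracket M xi Y) xi' q) (d\<iota> q u) = a q * (G q w (JJ q (d\<iota> q u)) + a q * p u - b q * s u)
        + b q * (G q w (d\<iota> q u) - a q * s u - b q * p u)"
    proof -
      have "G q (L (lie_bracket M xi Y) xi' q) (d\<iota> q u) = hff q (lie_bracket M xi Y q) (d\<iota> q u)" by (simp add: L_def hff_def)
      then show ?thesis
        unfolding hff_formula(1)[OF q bracket_tan[OF q xi_vf Y(1)] u] br dYq p_def s_def
        using tn by (simp add: G_lin q A.tangent_add A.tangent_scaleR G_J_J[OF q] G_J[OF q dy du] right_diff_distrib distrib_left)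
    qed
    have h0: "G q (L xi (L Y xi') q - L Y (L xi xi') q - L (lie_bracket M xi Y) xi' q) (d\<iota> q u)
      = G q (L xi (L Y xi') q) (d\<iota> q u) - G q (L Y (L xi xi') q) (d\<iota> q u) - G q (L (lie_bracket M xi Y) xi' q) (d\<iota> q u)"
      using Lv_tangent[OF q] du by (simp add: L_def G_diff1[OF q] A.tangent_diff)
    have h1: "G q (L xi (L Y xi') q) (d\<iota> q u) = xi q a * s u + a q * G q w (JJ q (d\<iota> q u)) + (xi q b * p u + b q * G q w (d\<iota> q u))"
      unfolding 1 dYq p_def s_def
      using tn by (simp add: G_lin q A.tangent_add A.tangent_scaleR G_J[OF q dy du] G_J[OF q wt du])
    have h2: "G q (L Y (L xi xi') q) (d\<iota> q u) = k q * sff q y (d\<iota> q u)"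
    proof -
      note N = N_tan[OF q] and LN = Lv_tangent[OF q, of y N]
      have Nu: "G q (N q) (d\<iota> q u) = 0" using G_sym[OF q N du] d_N[OF q u(1)] by simp
      have "G q (r *\<^sub>R N q + (- k q) *\<^sub>R Lv q y N) (d\<iota> q u) = r * G q (N q) (d\<iota> q u) + (- k q) * G q (Lv q y N) (d\<iota> q u)" for r
        unfolding G_add1[OF q A.tangent_scaleR[OF N] du A.tangent_scaleR[OF LN]]
          G_scale1[OF q N du] G_scale1[OF q LN du] ..
      then show ?thesis unfolding 2 Nu sff_def by simp
    qed
    have h3: "sff q y (d\<iota> q u) = - al q * p u - be q * s u"
      unfolding sff_formula[OF q y(1) u] p_def s_def dYq ..
    have lhs: "G q (L xi (L Y xi') q - L Y (L xi xi') q - L (lie_bracket M xi Y) xi' q) (d\<iota> q u)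
      = (xi q a + 2 * a q * b q + k q * be q) * s u + (xi q b + (b q)\<^sup>2 - (a q)\<^sup>2 + k q * al q) * p u"
      unfolding h0 h1 h2 h3 h by (simp add: power2_eq_square algebra_simps)
    have T: "G q (xi' q) (JJ q (xi' q)) = \<tau>" unfolding \<tau>_def tan_def by (rule xi'_J_xi'[OF q])
    have yx: "G q (d\<iota> q y) (xi' q) = 0" "G q (d\<iota> q y) (JJ q (xi' q)) = 0"
      using eta_xi'[OF q y(1)] G_d_J_xi'[OF q y(1)] y(2) by simp_all
    have "G q (L xi (L Y xi') q - L Y (L xi xi') q - L (lie_bracket M xi Y) xi' q) (d\<iota> q u)
      = \<nu> (\<iota> q) * (- p u + \<tau> * s u) + \<nu>t (\<iota> q) * (s u + \<tau> * p u)"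
      unfolding L_curvature[OF xi_vf Y(1) xi'_af q] d_xi[OF q] Y(2)
        ambient_Riem[OF q xi'_tan[OF q] dy xi'_tan[OF q] du] pi1_def pi2_def pi3_def T yx
        xi'_xi'[OF q] hor_xi'[OF q u] hor_J_xi'[OF q u] p_def s_def dYq by simp
    then show ?thesis unfolding lhs e1_def e2_def by (simp add: algebra_simps)
  qed
  have "e1 = 0 \<and> e2 = 0"
  proof -
    let ?P = "p y" and ?S = "s y"
    note py = phi_tangent[OF q y(1)] eta_phi[OF q y(1)]
    \<comment> \<open>Testing with \<open>y\<close> and \<open>phi q y\<close> gives a 2x2 system
      whose determinant is, up to sign, a sum of two squares, nonzero since \<open>y\<close> is not
      null.\<close>
    have pphi: "p (phi q y) = ?S" "s (phi q y) = - ?P"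
      unfolding p_def s_def d_phi_hor[OF q y(1,2)] J_J[OF q dx[OF q y(1)]]
      using dx[OF q y(1)] by (simp_all add: dYq G_minus2[OF q])
    note e = eq[OF y(1,2)] eq[OF py, unfolded pphi]
    have "e1 * (?P * ?P + ?S * ?S) = ?P * (e1 * ?P + e2 * ?S) + ?S * (e1 * ?S + e2 * - ?P)" by (simp add: algebra_simps)
    moreover have "e2 * (?P * ?P + ?S * ?S) = ?S * (e1 * ?P + e2 * ?S) - ?P * (e1 * ?S + e2 * - ?P)" by (simp add: algebra_simps)
    moreover have "?P * ?P + ?S * ?S \<noteq> 0" using y(3) by (simp add: p_def dYq sum_squares_eq_zero_iff)
    ultimately show ?thesis unfolding e by auto
  qed
  \<comment> \<open>By \<open>x_tt\<close>, \<open>k\<close> is -dt(\<xi>) / (2 cos t); dividing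
    \<open>al\<close> and \<open>be\<close> by cos t gives a + b tan t and a tan t - b.\<close>
  moreover have kal: "k q * al q = - xi q tt * (a q + b q * \<tau>) / 2" "k q * be q = - xi q tt * (a q * \<tau> - b q) / 2"
  proof -
    have xt: "xi q tt = - 2 * ct q * k q" using x_tt[OF q xq] kA[OF q] by simp
    have T: "ct q * \<tau> = st q" using co_pos[OF q] by (simp add: \<tau>_def tan_def)
    show "k q * al q = - xi q tt * (a q + b q * \<tau>) / 2" "k q * be q = - xi q tt * (a q * \<tau> - b q) / 2"
      unfolding xt T[symmetric] by (simp_all add: algebra_simps)
  qed
  ultimately show "xi q b = (a q)\<^sup>2 - (b q)\<^sup>2 - \<nu> (\<iota> q) + \<nu>t (\<iota> q) * tan (tt q) + xi q tt * (a q + b q * tan (tt q)) / 2"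
    "xi q a = - 2 * a q * b q + \<nu> (\<iota> q) * tan (tt q) + \<nu>t (\<iota> q) + xi q tt * (a q * tan (tt q) - b q) / 2"
    unfolding e1_def e2_def kal \<tau>_def[symmetric] by (simp_all add: field_simps)
qed

end

end

theorem corollary3p2:
  fixes M' :: "('b, 'f::euclidean_space) mfd" and J :: "'b endo" and g' :: "'b metric"
    and nabla' :: "'b connection" and \<nu> \<nu>t :: "'b \<Rightarrow> real"
    and M :: "('a, 'e::euclidean_space) mfd" and \<iota> :: "'a \<Rightarrow> 'b" and N :: "'a \<Rightarrow> 'b tvec"
    and t :: "'a \<Rightarrow> real" and \<phi> :: "'a endo" and \<xi> :: "'a vfield" and \<eta> :: "'a form1"
    and g :: "'a metric" and nabla :: "'a connection" and \<theta> \<theta>s :: "'a form1" and n :: nat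
    and K :: "'a \<Rightarrow> 'a tvec \<Rightarrow> 'a tvec \<Rightarrow> 'a tvec \<Rightarrow> 'a tvec \<Rightarrow> real"
  assumes n: "n \<ge> 1"
    and dim: "DIM('f) = 2 * n + 2" "DIM('e) = 2 * n + 1"
    and ambient: "kaehler_norden M' J g' nabla'"
      "const_totally_real_curvatures M' J g' nabla' \<nu> \<nu>t"
    and hyp: "hypersurface M M' \<iota>" "timelike_unit_normal M M' \<iota> g' N"
    and t: "t = normal_angle \<iota> J g' N"
    and \<phi>: "\<phi> = hyp_phi M M' \<iota> J g' N"
    and \<xi>: "\<xi> = hyp_xi M M' \<iota> J g' N"
    and \<eta>: "\<eta> = hyp_eta M' \<iota> J g' N"
    and g: "g = induced_metric M' \<iota> g'"
    and nabla: "levi_civita M g nabla"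
    and \<theta>: "\<theta> = lee_theta M g nabla \<phi> \<xi> \<eta> n"
    and \<theta>s: "\<theta>s = lee_theta_star M g nabla \<phi> \<xi> \<eta> n"
    and F45: "F40_F50_manifold M g nabla \<phi> \<xi> \<eta> n"
    and K: "K = curvature4 M g (canonical_connection nabla \<phi> \<xi> \<eta>)"
  shows "\<forall>p\<in>topspace (mtop M).
    \<forall>x\<in>tangent_space M p. \<forall>y\<in>tangent_space M p. \<forall>z\<in>tangent_space M p. \<forall>u\<in>tangent_space M p.
      (let \<nu>p = \<nu> (\<iota> p); \<nu>tp = \<nu>t (\<iota> p); tp = t p; m = real n;
           th = \<theta> p (\<xi> p); ths = \<theta>s p (\<xi> p);
           dt_xi = \<xi> p t;
           xi_th = \<xi> p (\<lambda>q. \<theta> q (\<xi> q)); xi_ths = \<xi> p (\<lambda>q. \<theta>s q (\<xi> q));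
           \<pi>1 = pi1 (g p) x y z u; \<pi>2 = pi2 (g p) (\<phi> p) x y z u; \<pi>3 = pi3 (g p) (\<phi> p) x y z u;
           \<pi>4 = pi4 (g p) (\<eta> p) x y z u; \<pi>5 = pi5 (g p) (\<phi> p) (\<eta> p) x y z u
       in K p x y z u =
            (\<nu>p + ths^2 / (4 * m^2)) * (\<pi>1 - \<pi>2)
          + (\<nu>tp - th * ths / (4 * m^2)) * \<pi>3
          - (\<nu>tp * tan tp + dt_xi * th / (4 * m) + dt_xi * ths / (4 * m) * tan tp
               - xi_ths / (2 * m) + th^2 / (4 * m^2)) * \<pi>4
          - (\<nu>p * tan tp + dt_xi * th / (4 * m) * tan tp - dt_xi * ths / (4 * m)
               - xi_th / (2 * m) - th * ths / (4 * m^2)) * \<pi>5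
          - (th * cos tp + ths * sin tp)^2 / (4 * m^2) * (\<pi>1 - \<pi>2 - \<pi>4)
          + (th * sin tp - ths * cos tp) * (th * cos tp + ths * sin tp) / (4 * m^2) * (\<pi>3 + \<pi>5))"
proof (intro ballI)
  fix p x y z u
  assume p: "p \<in> topspace (mtop M)"
    and xyzu: "x \<in> tangent_space M p" "y \<in> tangent_space M p" "z \<in> tangent_space M p" "u \<in> tangent_space M p"
  interpret M: manifold M
    using hyp(1) by unfold_locales (simp add: hypersurface_def)
  interpret A: kaehler_norden_mfd M' nabla' g' J
  proof unfold_locales
    show "smooth_manifold M'" "affine_connection M' nabla'"
      using ambient(1) unfolding kaehler_norden_def levi_civita_def by blast+
    show "kaehler_norden M' J g' nabla'" by (rule ambient(1))
  qed
  interpret B: connection M nabla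
    using nabla by unfold_locales (simp add: levi_civita_def)
  have imm: "immersion M M' \<iota>" using hyp(1) by (simp add: hypersurface_def)
  interpret smooth_map M M' \<iota>
    using imm by unfold_locales (auto simp: immersion_def o_def)
  obtain U c where c: "(U, c) \<in> charts M" "p \<in> U" using M.ex_chart[OF p] .
  have \<iota>p: "\<iota> p \<in> topspace (mtop M')" using continuous_map p by (auto simp: continuous_map_def)
  obtain U' c' where c': "(U', c') \<in> charts M'" "\<iota> p \<in> U'" using A.ex_chart[OF \<iota>p] .
  obtain W1 where W1: "openin (mtop M) W1" "p \<in> W1" "vext M p x \<in> smooth_vfields M W1" using M.ex_vext[OF p xyzu(1)] by blast
  obtain W2 where W2: "openin (mtop M) W2" "p \<in> W2" "vext M p y \<in> smooth_vfields M W2" using M.ex_vext[OF p xyzu(2)] by blast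
  obtain W3 where W3: "openin (mtop M) W3" "p \<in> W3" "vext M p z \<in> smooth_vfields M W3" using M.ex_vext[OF p xyzu(3)] by blast
  \<comment> \<open>One open set inside both chart domains, on which all three chosen extensions are
    smooth.\<close>
  define V where "V = U \<inter> {q \<in> topspace (mtop M). \<iota> q \<in> U'} \<inter> (W1 \<inter> (W2 \<inter> W3))"
  have V: "openin (mtop M) V" "p \<in> V"
    unfolding V_def using M.chart_open[OF c(1)] open_preimage[OF A.chart_open[OF c'(1)]] W1 W2 W3 c c' p by auto
  have V': "\<iota> ` V \<subseteq> U'" "V \<subseteq> U" "V \<subseteq> topspace (mtop M)" by (auto simp: V_def)
  have X: "vext M p x \<in> smooth_vfields M V" "vext M p y \<in> smooth_vfields M V" "vext M p z \<in> smooth_vfields M V"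
    using M.vf_subset[OF W1(3), of V] M.vf_subset[OF W2(3), of V] M.vf_subset[OF W3(3), of V] by (auto simp: V_def)
  define a where "a q = \<theta> q (\<xi> q) / (2 * real n)" for q
  define b where "b q = \<theta>s q (\<xi> q) / (2 * real n)" for q
  interpret H: hypersurface_F45 M M' \<iota> nabla' U' c' V g' J U c N nabla a b
  proof unfold_locales
    show "(U', c') \<in> charts M'" "openin (mtop M) V" "\<iota> ` V \<subseteq> U'" "(U, c) \<in> charts M" "V \<subseteq> U" by fact+
    show "DIM('f) = DIM('e) + 1" "2 \<le> DIM('e)" using dim n by auto
    show "inj_on (differential M' \<iota> q) (tangent_space M q)" if "q \<in> V" for q
      using imm that V'(3) by (auto simp: immersion_def)
    show "timelike_unit_normal M M' \<iota> g' N" by fact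
    show "levi_civita M (induced_metric M' \<iota> g') nabla" using nabla unfolding g .
    fix q x y z
    assume "q \<in> V" "x \<in> tangent_space M q" "y \<in> tangent_space M q" "z \<in> tangent_space M q"
    then show "F_tensor M (induced_metric M' \<iota> g') nabla (hyp_phi M M' \<iota> J g' N) q x y z =
      - a q * (induced_metric M' \<iota> g' q (hyp_phi M M' \<iota> J g' N q x) (hyp_phi M M' \<iota> J g' N q y) * hyp_eta M' \<iota> J g' N q z
        + induced_metric M' \<iota> g' q (hyp_phi M M' \<iota> J g' N q x) (hyp_phi M M' \<iota> J g' N q z) * hyp_eta M' \<iota> J g' N q y)
      - b q * (induced_metric M' \<iota> g' q x (hyp_phi M M' \<iota> J g' N q y) * hyp_eta M' \<iota> J g' N q z
        + induced_metric M' \<iota> g' q x (hyp_phi M M' \<iota> J g' N q z) * hyp_eta M' \<iota> J g' N q y)"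
      using F45 V'(3) unfolding F40_F50_manifold_def F4_F5_manifold_def a_def b_def \<theta> \<theta>s g \<phi> \<eta> \<xi> by blast
  qed
  define m where "m = real n"
  have m: "m \<noteq> 0" using n by (simp add: m_def)
  have th: "\<theta> q (\<xi> q) = (2 * m) * a q" "\<theta>s q (\<xi> q) = (2 * m) * b q" for q
    using m by (simp_all add: a_def b_def m_def)
  have xi_tan: "\<xi> p \<in> tangent_space M p" unfolding \<xi> by (rule H.xi_tangent[OF V(2)])
  have dth: "\<xi> p (\<lambda>q. \<theta> q (\<xi> q)) = 2 * m * \<xi> p a" "\<xi> p (\<lambda>q. \<theta>s q (\<xi> q)) = 2 * m * \<xi> p b"
    unfolding th using M.tv_cmult[OF xi_tan, of a "2 * m"] M.tv_cmult[OF xi_tan, of b "2 * m"] H.ab_smooth V(2) by auto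
  note xi_ab = H.xi_ab[OF ambient(2) V(2), folded \<xi> t]
  define \<alpha> \<beta> where "\<alpha> = cos (t p) * a p + sin (t p) * b p" and "\<beta> = sin (t p) * a p - cos (t p) * b p"
  have K: "K p x y z u = (\<nu> (\<iota> p) + (b p)\<^sup>2 - \<alpha>\<^sup>2) * (pi1 (g p) x y z u - pi2 (g p) (\<phi> p) x y z u - pi4 (g p) (\<eta> p) x y z u)
    + (\<nu>t (\<iota> p) - a p * b p + \<alpha> * \<beta>) * (pi3 (g p) (\<phi> p) x y z u + pi5 (g p) (\<phi> p) (\<eta> p) x y z u)"
    using H.canonical_curvature[OF ambient(2) X(3,1,2) V(2) xyzu(4)]
    unfolding K curvature4_def M.vext_eq[OF p xyzu(1)] M.vext_eq[OF p xyzu(2)] M.vext_eq[OF p xyzu(3)]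
      \<alpha>_def \<beta>_def t g \<phi> \<xi> \<eta> .
  \<comment> \<open>With the derivative of \<open>b\<close> from \<open>xi_ab\<close>, the
    coefficient of \<open>\<pi>\<^sub>4\<close> becomes that of
    \<open>\<pi>\<^sub>1 - \<pi>\<^sub>2\<close>, so the three tensors combine.\<close>
  have c4: "\<nu>t (\<iota> p) * tan (t p) + \<xi> p t * (2 * m * a p) / (4 * m) + \<xi> p t * (2 * m * b p) / (4 * m) * tan (t p)
      - 2 * m * \<xi> p b / (2 * m) + (2 * m * a p)\<^sup>2 / (4 * m\<^sup>2) = \<nu> (\<iota> p) + (b p)\<^sup>2"
    unfolding xi_ab(1) using m by (simp add: field_simps power2_eq_square)
  \<comment> \<open>Likewise the derivative of \<open>a\<close> turns this into the negative of the
    coefficient of \<open>\<pi>\<^sub>3\<close>, which produces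
    \<open>\<pi>\<^sub>3 + \<pi>\<^sub>5\<close>.\<close>
  have c5: "\<nu> (\<iota> p) * tan (t p) + \<xi> p t * (2 * m * a p) / (4 * m) * tan (t p) - \<xi> p t * (2 * m * b p) / (4 * m)
      - 2 * m * \<xi> p a / (2 * m) - (2 * m * a p) * (2 * m * b p) / (4 * m\<^sup>2) = a p * b p - \<nu>t (\<iota> p)"
    unfolding xi_ab(2) using m by (simp add: field_simps power2_eq_square)
  have e: "(2 * m * b p)\<^sup>2 / (4 * m\<^sup>2) = (b p)\<^sup>2" "(2 * m * a p) * (2 * m * b p) / (4 * m\<^sup>2) = a p * b p"
    "(2 * m * a p * cos (t p) + 2 * m * b p * sin (t p))\<^sup>2 / (4 * m\<^sup>2) = \<alpha>\<^sup>2"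
    "(2 * m * a p * sin (t p) - 2 * m * b p * cos (t p)) * (2 * m * a p * cos (t p) + 2 * m * b p * sin (t p)) / (4 * m\<^sup>2) = \<alpha> * \<beta>"
    using m by (simp_all add: \<alpha>_def \<beta>_def field_simps power2_eq_square)
  show "let \<nu>p = \<nu> (\<iota> p); \<nu>tp = \<nu>t (\<iota> p); tp = t p; m = real n;
           th = \<theta> p (\<xi> p); ths = \<theta>s p (\<xi> p);
           dt_xi = \<xi> p t;
           xi_th = \<xi> p (\<lambda>q. \<theta> q (\<xi> q)); xi_ths = \<xi> p (\<lambda>q. \<theta>s q (\<xi> q));
           \<pi>1 = pi1 (g p) x y z u; \<pi>2 = pi2 (g p) (\<phi> p) x y z u; \<pi>3 = pi3 (g p) (\<phi> p) x y z u;
           \<pi>4 = pi4 (g p) (\<eta> p) x y z u; \<pi>5 = pi5 (g p) (\<phi> p) (\<eta> p) x y z u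
       in K p x y z u =
            (\<nu>p + ths^2 / (4 * m^2)) * (\<pi>1 - \<pi>2)
          + (\<nu>tp - th * ths / (4 * m^2)) * \<pi>3
          - (\<nu>tp * tan tp + dt_xi * th / (4 * m) + dt_xi * ths / (4 * m) * tan tp
               - xi_ths / (2 * m) + th^2 / (4 * m^2)) * \<pi>4
          - (\<nu>p * tan tp + dt_xi * th / (4 * m) * tan tp - dt_xi * ths / (4 * m)
               - xi_th / (2 * m) - th * ths / (4 * m^2)) * \<pi>5
          - (th * cos tp + ths * sin tp)^2 / (4 * m^2) * (\<pi>1 - \<pi>2 - \<pi>4)
          + (th * sin tp - ths * cos tp) * (th * cos tp + ths * sin tp) / (4 * m^2) * (\<pi>3 + \<pi>5)"
    unfolding Let_def dth m_def[symmetric]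
    unfolding th c4 c5 unfolding e K by (simp add: algebra_simps)
qed

end
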